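(* Let $(R,\mathfrak m,k)$ be a local Gorenstein ring of Krull dimension $d$ with an isolated singularity, $\mathcal T=\mathbf K_{\mathrm{ac}}(\mathrm{free}\,R)$ and $X,Y\in\mathcal T$. Let $$\langle\!\langle-,-\rangle\!\rangle:\mathcal T(Y,X[d-1])\otimes\mathcal T(X,Y)\longrightarrow H^d_{\mathfrak m}(R)$$ be the nondegenerate pairing corresponding to the Auslander duality isomorphism $\mathcal T(Y,X[d-1])\cong\operatorname{Hom}_R(\mathcal T(X,Y),H^d_{\mathfrak m}(R))$ described in the context. Let $\partial$ be the differential of $X$, let $\boldsymbol t=(t_1,\dots,t_d)$ be a system of parameters acting null-homotopically on $X$, and let $\lambda_i$ be homotopies on $X$ with $\lambda_i\circ\partial+\partial\circ\lambda_i=t_i\cdot1_X$. Then for morphisms $\psi:Y\to X[d-1]$ and $\phi:X\to Y$, $$\langle\!\langle\psi,\phi\rangle\!\rangle=\langle\!\langle\psi\circ\phi\rangle\!\rangle=(-1)^{\binom{d+1}{2}}\begin{bmatrix}\operatorname{tr}\left(\psi\circ\phi\circ\lambda_1\cdots\lambda_d\circ\partial\right)^0\\ t_1,\ldots,t_d\end{bmatrix}.$$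
   Context: Rings are commutative and noetherian; tensor products are over $R$. Isolated singularity: $R_{\mathfrak p}$ is regular for every non-maximal prime $\mathfrak p$. $\mathbf K_{\mathrm{ac}}(\mathrm{free}\,R)$ is the homotopy category of acyclic complexes of finite free $R$-modules. Complexes are cohomologically graded, $X[1]^i=X^{i+1}$ with differential $-\partial_X$. The superscript $0$ denotes the component $X^0\to X^0$. Generalised fractions. For a system of parameters $\boldsymbol t$, $K_\infty(\boldsymbol t)=\bigotimes_{i=1}^d(R\to R[t_i^{-1}]\theta_i)$ with $R$ in degree $0$, $\theta_i$ anticommuting symbols of degree $1$ with $\theta_i^2=0$, and differential left multiplication by $\sum_i\theta_i$. $H^d_{\mathfrak m}(R)=H^d(K_\infty(\boldsymbol t))$, identified for different $\boldsymbol t$ by the canonical isomorphisms coming from the fact that $K_\infty(\boldsymbol t)\to R$ is the universal map in $\mathbf D(R)$ to $R$ from a complex with cohomology supported on $\{\mathfrak m\}$. The generalised fraction $\begin{bmatrix}r\\ t_1,\dots,t_d\end{bmatrix}$ is $(-1)^d$ times the class of $\frac{r}{t_1\cdots t_d}\theta_1\cdots\theta_d$. Pretrace. For $\alpha\in\mathcal T(X,X[d-1])$, $$\langle\!\langle\alpha\rangle\!\rangle:=(-1)^{\binom{d+1}{2}+i}\begin{bmatrix}\operatorname{tr}(\alpha\circ\lambda_1\cdots\lambda_d\circ\partial)^i\\ t_1,\dots,t_d\end{bmatrix},$$ which is independent of $i\in\mathbb Z$. The duality pairing. Let $N=\operatorname{Coker}(Y^{-1}\to Y^0)$; for $y\in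 Y^0$ write $\overline y$ for its class in $N$. Let $\vartheta_N:N\to Y\otimes H^d_{\mathfrak m}(R)[1-d]$ be the complete injective resolution of $N$: for any system of parameters $\boldsymbol s$ acting null-homotopically on $Y$ and homotopies $\mu_i$ on $Y$ with $\mu_i\partial_Y+\partial_Y\mu_i=s_i$, it is the morphism $$\vartheta_N(\overline y)=(-1)^{\binom{d+1}{2}}\mu_1\cdots\mu_d\,\partial_Y(y)\otimes\begin{bmatrix}1\\ s_1,\dots,s_d\end{bmatrix},$$ which up to homotopy is independent of these choices; precomposition with it is a quasi-isomorphism $\operatorname{Hom}_R(Y\otimes H^d_{\mathfrak m}(R)[1-d],I)\to\operatorname{Hom}_R(N,I)$ for every acyclic complex $I$ of injectives. The duality isomorphism sends $\psi:Y\to X[d-1]$ to the functional obtained as follows. The composite $g_\psi=(\psi\otimes1)\circ\vartheta_N:N\to X\otimes H^d_{\mathfrak m}(R)$ (using $\psi:Y^{1-d}\to X^0$) is transported through the natural isomorphisms $$\operatorname{Hom}_R(N,X\otimes H^d_{\mathfrak m}(R))\cong\operatorname{Hom}_R(X^\vee\otimes N,H^d_{\mathfrak m}(R))\cong\operatorname{Hom}_R(\operatorname{Hom}_R(X,N),H^d_{\mathfrak m}(R)),\qquad X^\vee=\operatorname{Hom}_R(X,R),$$ and then pulled back along the quasi-isomorphism $\operatorname{Hom}_R(X,Y)\to\operatorname{Hom}_R(X,N)$ given by the canonical map $Y\to N$. Explicitly, $\langle\!\langle\psi,\phi\rangle\!\rangle=\sum_i(e_i^*\otimes1)\big(g_\psi(\overline{\phi(e_i)})\big)$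 for a basis $e_i$ of $X^0$ with dual basis $e_i^*$. Nondegenerate means that $\psi\mapsto\langle\!\langle\psi,-\rangle\!\rangle$ is an isomorphism $\mathcal T(Y,X[d-1])\to\operatorname{Hom}_R(\mathcal T(X,Y),H^d_{\mathfrak m}(R))$. *)

theory Defs
  imports
    "Jordan_Normal_Form.VS_Connect"
    "HOL-Algebra.Ring_Divisibility"
    "HOL-Library.Extended_Nat"
begin

hide_const (open) Multiset.mult
hide_const (open) Modules.module
hide_const (open) Polynomial.smult

text \<open>
  The ambient ring is a type of class \<^class>\<open>comm_ring_1\<close>; its ideal theory and the properties that
  also have to be stated for its localizations go through HOL-Algebra records, the ambient
  ring being the record \<^term>\<open>class_ring\<close>. A finite free module is \<open>R\<^sup>n\<close>, i.e.
  \<^term>\<open>carrier_vec n\<close>, and a linear map between two of them is a matrix.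
\<close>

section \<open>Local, regular and Gorenstein rings\<close>

definition local_ring :: "('r, 'c) ring_scheme \<Rightarrow> 'r set \<Rightarrow> bool" where
  "local_ring R m \<longleftrightarrow> cring R \<and> maximalideal m R \<and> (\<forall>m'. maximalideal m' R \<longrightarrow> m' = m)"

definition krull_dim :: "('r, 'c) ring_scheme \<Rightarrow> enat" where
  "krull_dim R = (SUP n \<in> {n. \<exists>p :: nat \<Rightarrow> 'r set.
      (\<forall>i\<le>n. primeideal (p i) R) \<and> (\<forall>i<n. p i \<subset> p (Suc i))}. enat n)"

definition regular_local_ring :: "('r, 'c) ring_scheme \<Rightarrow> bool" where
  "regular_local_ring R \<longleftrightarrow> noetherian_ring R \<and>
     (\<exists>m xs. local_ring R m \<and> set xs \<subseteq> carrier R \<and> krull_dim R = enat (length xs) \<and>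
        m = genideal R (set xs))"

definition self_module :: "('r, 'c) ring_scheme \<Rightarrow> ('r, 'r) module" where
  "self_module R = \<lparr>carrier = carrier R, mult = undefined, one = undefined,
     zero = zero R, add = add R, smult = mult R\<rparr>"

text \<open>
  Injectivity is tested on modules whose elements live in the type \<open>'e\<close>. Below \<open>'e\<close> is
  \<open>nat \<Rightarrow> 'r\<close>, into which \<open>'r\<close> injects; so ideals of \<open>R\<close> are among the test modules, and by
  Baer's criterion nothing is lost by the restriction.
\<close>

definition injective_module :: "('r, 'c) ring_scheme \<Rightarrow> ('r, 'e) module \<Rightarrow> bool" where
  "injective_module R E \<longleftrightarrow> module R E \<and>
     (\<forall>(B :: ('r, 'e) module) A f.
        module R B \<and> A \<subseteq> carrier B \<and> mod_hom R (B\<lparr>carrier := A\<rparr>) E f \<longrightarrow>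
        (\<exists>g. mod_hom R B E g \<and> (\<forall>x\<in>A. g x = f x)))"

text \<open>
  Over a noetherian ring, the terms of the minimal injective resolution of a finitely generated
  module have cardinality at most \<open>max |R| \<aleph>\<^sub>0\<close>, hence are realised on subsets of
  \<open>nat \<Rightarrow> 'r\<close>.
\<close>

definition finite_injective_dim :: "('r, 'c) ring_scheme \<Rightarrow> ('r, 'b) module \<Rightarrow> bool" where
  "finite_injective_dim R M \<longleftrightarrow>
     (\<exists>(E :: nat \<Rightarrow> ('r, nat \<Rightarrow> 'r) module) e \<delta> n.
        (\<forall>j. injective_module R (E j)) \<and>
        mod_hom R M (E 0) e \<and> inj_on e (carrier M) \<and>
        (\<forall>j. mod_hom R (E j) (E (Suc j)) (\<delta> j)) \<and>
        e ` carrier M = {x \<in> carrier (E 0). \<delta> 0 x = \<zero>\<^bsub>E (Suc 0)\<^esub>} \<and>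
        (\<forall>j. \<delta> j ` carrier (E j) =
              {x \<in> carrier (E (Suc j)). \<delta> (Suc j) x = \<zero>\<^bsub>E (Suc (Suc j))\<^esub>}) \<and>
        (\<forall>j>n. carrier (E j) = {\<zero>\<^bsub>E j\<^esub>}))"

definition gorenstein_local_ring :: "('r, 'c) ring_scheme \<Rightarrow> 'r set \<Rightarrow> bool" where
  "gorenstein_local_ring R m \<longleftrightarrow>
     noetherian_ring R \<and> local_ring R m \<and> finite_injective_dim R (self_module R)"

section \<open>Localization\<close>

text \<open>\<open>S\<close> is meant to be a multiplicative submonoid of the ring.\<close>

definition loc_rel :: "'a::comm_ring_1 set \<Rightarrow> (('a \<times> 'a) \<times> ('a \<times> 'a)) set" where
  "loc_rel S = {((r, s), (r', s')). s \<in> S \<and> s' \<in> S \<and> (\<exists>u\<in>S. u * (r * s' - r' * s) = 0)}"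

definition lfrac :: "'a::comm_ring_1 set \<Rightarrow> 'a \<Rightarrow> 'a \<Rightarrow> ('a \<times> 'a) set" where
  "lfrac S r s = loc_rel S `` {(r, s)}"

definition localization :: "'a::comm_ring_1 set \<Rightarrow> ('a \<times> 'a) set ring" where
  "localization S = \<lparr>carrier = (UNIV \<times> S) // loc_rel S,
     mult = (\<lambda>A B. \<Union>(r, s)\<in>A. \<Union>(r', s')\<in>B. lfrac S (r * r') (s * s')),
     one = lfrac S 1 1,
     zero = lfrac S 0 1,
     add = (\<lambda>A B. \<Union>(r, s)\<in>A. \<Union>(r', s')\<in>B. lfrac S (r * s' + r' * s) (s * s'))\<rparr>"

text \<open>The canonical map from \<open>S\<^sup>-\<^sup>1R\<close> to \<open>S'\<^sup>-\<^sup>1R\<close> for \<open>S \<subseteq> S'\<close>.\<close>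

definition loc_map :: "'a::comm_ring_1 set \<Rightarrow> ('a \<times> 'a) set \<Rightarrow> ('a \<times> 'a) set" where
  "loc_map S' A = (\<Union>(r, s)\<in>A. lfrac S' r s)"

definition isolated_singularity :: "'a::comm_ring_1 set \<Rightarrow> bool" where
  "isolated_singularity m \<longleftrightarrow>
     (\<forall>p. primeideal p (class_ring :: 'a ring) \<and> p \<noteq> m \<longrightarrow>
        regular_local_ring (localization (- p)))"

section \<open>The complex \<open>K\<^sub>\<infinity>\<close> and local cohomology\<close>

text \<open>
  In degree \<open>p\<close> the complex \<open>K\<^sub>\<infinity>(t\<^sub>0, \<dots>, t\<^bsub>n-1\<^esub>)\<close> is the direct sum of the modules
  \<open>R[t\<^sub>j\<^sup>-\<^sup>1 : j \<in> J] \<theta>\<^sub>J\<close> over the \<open>p\<close>-element sets \<open>J\<close> of indices, where \<open>\<theta>\<^sub>J\<close> is the product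
  of the \<open>\<theta>\<^sub>j\<close>, \<open>j \<in> J\<close>, in increasing order. The sign in \<open>Kdiff\<close> comes from
  \<open>\<theta>\<^sub>i \<theta>\<^bsub>J-{i}\<^esub> = (-1)\<^bsup>#{j \<in> J. j < i}\<^esup> \<theta>\<^sub>J\<close>.
\<close>

definition mult_set :: "'a::comm_ring_1 list \<Rightarrow> nat set \<Rightarrow> 'a set" where
  "mult_set t J = {(\<Prod>j\<in>J. (t ! j) ^ e j) | e :: nat \<Rightarrow> nat. True}"

abbreviation loc_at :: "'a::comm_ring_1 list \<Rightarrow> nat set \<Rightarrow> ('a \<times> 'a) set ring" where
  "loc_at t J \<equiv> localization (mult_set t J)"

definition Kidx :: "'a list \<Rightarrow> nat \<Rightarrow> nat set set" where
  "Kidx t p = {J. J \<subseteq> {..<length t} \<and> card J = p}"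

type_synonym 'a cochain = "nat set \<Rightarrow> ('a \<times> 'a) set"

definition Kmod :: "'a::comm_ring_1 list \<Rightarrow> nat \<Rightarrow> ('a, 'a cochain) module" where
  "Kmod t p = \<lparr>carrier = (\<Pi>\<^sub>E J\<in>Kidx t p. carrier (loc_at t J)),
     mult = undefined, one = undefined,
     zero = (\<lambda>J\<in>Kidx t p. \<zero>\<^bsub>loc_at t J\<^esub>),
     add = (\<lambda>x y. \<lambda>J\<in>Kidx t p. x J \<oplus>\<^bsub>loc_at t J\<^esub> y J),
     smult = (\<lambda>r x. \<lambda>J\<in>Kidx t p. lfrac (mult_set t J) r 1 \<otimes>\<^bsub>loc_at t J\<^esub> x J)\<rparr>"

definition Kdiff :: "'a::comm_ring_1 list \<Rightarrow> nat \<Rightarrow> 'a cochain \<Rightarrow> 'a cochain" where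
  "Kdiff t p x = (\<lambda>J\<in>Kidx t (Suc p).
     \<Oplus>\<^bsub>loc_at t J\<^esub>i\<in>J. lfrac (mult_set t J) ((-1) ^ card {j\<in>J. j < i}) 1
        \<otimes>\<^bsub>loc_at t J\<^esub> loc_map (mult_set t J) (x (J - {i})))"

definition Kcocycles :: "'a::comm_ring_1 list \<Rightarrow> nat \<Rightarrow> 'a cochain set" where
  "Kcocycles t p = {x \<in> carrier (Kmod t p). Kdiff t p x = \<zero>\<^bsub>Kmod t (Suc p)\<^esub>}"

definition Kcoboundaries :: "'a::comm_ring_1 list \<Rightarrow> nat \<Rightarrow> 'a cochain set" where
  "Kcoboundaries t p =
     (case p of 0 \<Rightarrow> {\<zero>\<^bsub>Kmod t 0\<^esub>} | Suc q \<Rightarrow> Kdiff t q ` carrier (Kmod t q))"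

definition Kclass :: "'a::comm_ring_1 list \<Rightarrow> nat \<Rightarrow> 'a cochain \<Rightarrow> 'a cochain set" where
  "Kclass t p x = Kcoboundaries t p +>\<^bsub>Kmod t p\<^esub> x"

definition Kcohom :: "'a::comm_ring_1 list \<Rightarrow> nat \<Rightarrow> ('a, 'a cochain set) module" where
  "Kcohom t p = \<lparr>carrier = Kclass t p ` Kcocycles t p,
     mult = undefined, one = undefined,
     zero = Kcoboundaries t p,
     add = set_add (Kmod t p),
     smult = (\<lambda>r c. \<Union>x\<in>c. Kclass t p (r \<odot>\<^bsub>Kmod t p\<^esub> x))\<rparr>"

text \<open>
  For systems of parameters \<open>s\<close> and \<open>t\<close>, the complex
  \<open>K\<^sub>\<infinity>(s) \<otimes> K\<^sub>\<infinity>(t) = K\<^sub>\<infinity>(s @ t)\<close> maps quasi-isomorphically, and over \<open>R\<close>, to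
  \<open>K\<^sub>\<infinity>(s)\<close> (set the second group of \<open>\<theta>\<close>s to zero) and to \<open>K\<^sub>\<infinity>(t)\<close> (set the first group to
  zero). By the universal property of \<open>K\<^sub>\<infinity>(t) \<rightarrow> R\<close>, the isomorphism in the derived category
  given by this roof is the canonical one; \<open>Kcanonical\<close> is the graph of the map it induces
  on cohomology.
\<close>

definition Kproj1 :: "'a list \<Rightarrow> nat \<Rightarrow> 'a cochain \<Rightarrow> 'a cochain" where
  "Kproj1 s p x = (\<lambda>J\<in>Kidx s p. x J)"

definition Kproj2 :: "'a list \<Rightarrow> 'a list \<Rightarrow> nat \<Rightarrow> 'a cochain \<Rightarrow> 'a cochain" where
  "Kproj2 s t p x = (\<lambda>J\<in>Kidx t p. x ((\<lambda>j. length s + j) ` J))"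

definition Kcanonical ::
    "'a::comm_ring_1 list \<Rightarrow> 'a list \<Rightarrow> nat \<Rightarrow> ('a cochain set \<times> 'a cochain set) set" where
  "Kcanonical s t p =
     {(Kclass s p (Kproj1 s p x), Kclass t p (Kproj2 s t p x)) | x. x \<in> Kcocycles (s @ t) p}"

text \<open>For a noetherian local ring with maximal ideal \<open>m\<close> and Krull dimension \<open>d\<close>.\<close>

definition sop :: "'a::comm_ring_1 set \<Rightarrow> nat \<Rightarrow> 'a list \<Rightarrow> bool" where
  "sop m d t \<longleftrightarrow> length t = d \<and> {x. \<exists>n. x ^ n \<in> genideal class_ring (set t)} = m"

text \<open>
  An element of \<open>H\<^sup>d\<^sub>m(R)\<close> is the family, indexed by all systems of parameters \<open>t\<close>, of the classes
  in \<open>H\<^sup>d(K\<^sub>\<infinity>(t))\<close> that correspond to each other under the canonical isomorphisms. The family is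
  encoded by its graph, and the module operations are pointwise.
\<close>

type_synonym 'a lc_elt = "('a list \<times> 'a cochain set) set"

definition lc_class ::
    "'a::comm_ring_1 set \<Rightarrow> nat \<Rightarrow> 'a list \<Rightarrow> 'a cochain set \<Rightarrow> 'a lc_elt" where
  "lc_class m d s c = {(t, c'). sop m d t \<and> (c, c') \<in> Kcanonical s t d}"

definition local_cohomology :: "'a::comm_ring_1 set \<Rightarrow> nat \<Rightarrow> ('a, 'a lc_elt) module" where
  "local_cohomology m d =
    \<lparr>carrier = {lc_class m d s c | s c. sop m d s \<and> c \<in> carrier (Kcohom s d)},
     mult = undefined, one = undefined,
     zero = {(t, \<zero>\<^bsub>Kcohom t d\<^esub>) | t. sop m d t},
     add = (\<lambda>A B. {(t, c \<oplus>\<^bsub>Kcohom t d\<^esub> c') | t c c'. (t, c) \<in> A \<and> (t, c') \<in> B}),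
     smult = (\<lambda>r A. {(t, r \<odot>\<^bsub>Kcohom t d\<^esub> c) | t c. (t, c) \<in> A})\<rparr>"

text \<open>The only index in \<^term>\<open>Kidx t d\<close> is the set of all \<open>d\<close> positions of \<open>t\<close>.\<close>

definition gen_frac :: "'a::comm_ring_1 set \<Rightarrow> nat \<Rightarrow> 'a \<Rightarrow> 'a list \<Rightarrow> 'a lc_elt" where
  "gen_frac m d r t = lc_class m d t
     ((-1) ^ d \<odot>\<^bsub>Kcohom t d\<^esub>
        Kclass t d (\<lambda>J\<in>Kidx t d. lfrac (mult_set t J) r (prod_list t)))"

section \<open>Complexes of finite free modules\<close>

record 'a free_complex =
  rk :: "int \<Rightarrow> nat"
  diff :: "int \<Rightarrow> 'a mat"

text \<open>The objects of \<open>\<^bold>K\<^sub>a\<^sub>c(free R)\<close>.\<close>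

definition acyclic_free_complex :: "'a::comm_ring_1 free_complex \<Rightarrow> bool" where
  "acyclic_free_complex X \<longleftrightarrow>
     (\<forall>i. diff X i \<in> carrier_mat (rk X (i + 1)) (rk X i)) \<and>
     (\<forall>i. diff X (i + 1) * diff X i = 0\<^sub>m (rk X (i + 2)) (rk X i)) \<and>
     (\<forall>i. \<forall>v\<in>carrier_vec (rk X i). diff X i *\<^sub>v v = 0\<^sub>v (rk X (i + 1)) \<longrightarrow>
        (\<exists>u\<in>carrier_vec (rk X (i - 1)). v = diff X (i - 1) *\<^sub>v u))"

definition sign_of :: "int \<Rightarrow> 'a::comm_ring_1" where
  "sign_of i = (if even i then 1 else -1)"

definition shift :: "int \<Rightarrow> 'a::comm_ring_1 free_complex \<Rightarrow> 'a free_complex" where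
  "shift n X = \<lparr>rk = (\<lambda>i. rk X (i + n)), diff = (\<lambda>i. sign_of n \<cdot>\<^sub>m diff X (i + n))\<rparr>"

definition chain_map ::
    "'a::comm_ring_1 free_complex \<Rightarrow> 'a free_complex \<Rightarrow> (int \<Rightarrow> 'a mat) \<Rightarrow> bool" where
  "chain_map X Y f \<longleftrightarrow>
     (\<forall>i. f i \<in> carrier_mat (rk Y i) (rk X i)) \<and>
     (\<forall>i. diff Y i * f i = f (i + 1) * diff X i)"

definition homotopy_rel ::
    "'a::comm_ring_1 free_complex \<Rightarrow> 'a free_complex \<Rightarrow> ((int \<Rightarrow> 'a mat) \<times> (int \<Rightarrow> 'a mat)) set"
  where
  "homotopy_rel X Y = {(f, g). chain_map X Y f \<and> chain_map X Y g \<and>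
     (\<exists>h. (\<forall>i. h i \<in> carrier_mat (rk Y (i - 1)) (rk X i)) \<and>
          (\<forall>i. f i - g i = diff Y (i - 1) * h i + h (i + 1) * diff X i))}"

text \<open>Morphisms and composition in the homotopy category.\<close>

definition K_hom ::
    "'a::comm_ring_1 free_complex \<Rightarrow> 'a free_complex \<Rightarrow> (int \<Rightarrow> 'a mat) set set" where
  "K_hom X Y = {f. chain_map X Y f} // homotopy_rel X Y"

definition K_comp :: "'a::comm_ring_1 free_complex \<Rightarrow> 'a free_complex \<Rightarrow>
    (int \<Rightarrow> 'a mat) set \<Rightarrow> (int \<Rightarrow> 'a mat) set \<Rightarrow> (int \<Rightarrow> 'a mat) set" where
  "K_comp X Z \<Psi> \<Phi> = (\<Union>\<psi>\<in>\<Psi>. \<Union>\<phi>\<in>\<Phi>. homotopy_rel X Z `` {\<lambda>i. \<psi> i * \<phi> i})"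

text \<open>Lists \<open>hs\<close> of homotopies \<open>h\<^sub>j\<close> with \<open>h\<^sub>j \<partial> + \<partial> h\<^sub>j = t\<^sub>j\<close>.\<close>

definition null_homotopies ::
    "'a::comm_ring_1 free_complex \<Rightarrow> 'a list \<Rightarrow> (int \<Rightarrow> 'a mat) list \<Rightarrow> bool" where
  "null_homotopies X t hs \<longleftrightarrow> length hs = length t \<and>
     (\<forall>j<length t. \<forall>i.
        (hs ! j) i \<in> carrier_mat (rk X (i - 1)) (rk X i) \<and>
        (hs ! j) (i + 1) * diff X i + diff X (i - 1) * (hs ! j) i = (t ! j) \<cdot>\<^sub>m 1\<^sub>m (rk X i))"

text \<open>The component \<open>X\<^sup>i \<rightarrow> X\<^bsup>i-n\<^esup>\<close> of the composite \<open>h\<^sub>1 \<cdots> h\<^sub>n\<close>, in which \<open>h\<^sub>n\<close> is applied first.\<close>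

fun htpy_comp ::
    "'a::comm_ring_1 free_complex \<Rightarrow> (int \<Rightarrow> 'a mat) list \<Rightarrow> int \<Rightarrow> 'a mat" where
  "htpy_comp X [] i = 1\<^sub>m (rk X i)"
| "htpy_comp X (h # hs) i = h (i - int (length hs)) * htpy_comp X hs i"

definition mat_trace :: "'a::comm_ring_1 mat \<Rightarrow> 'a" where
  "mat_trace A = (\<Sum>k<dim_row A. A $$ (k, k))"

section \<open>The pretrace and the duality pairing\<close>

text \<open>The sign \<open>(-1)\<^bsup>(d+1 choose 2)\<^esup>\<close>.\<close>

definition bsign :: "nat \<Rightarrow> 'a::comm_ring_1" where
  "bsign d = (-1) ^ ((d + 1) choose 2)"

text \<open>
  The pretrace of a morphism \<open>A : X \<rightarrow> X[d-1]\<close> of the homotopy category: the common value of the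
  defining expression over all representatives \<open>\<alpha>\<close> of \<open>A\<close>, degrees \<open>i\<close>, systems of parameters
  \<open>t\<close> acting null-homotopically on \<open>X\<close>, and homotopies \<open>\<lambda>\<^sub>j\<close> for them.
\<close>

definition pretrace :: "'a::comm_ring_1 set \<Rightarrow> nat \<Rightarrow> 'a free_complex \<Rightarrow>
    (int \<Rightarrow> 'a mat) set \<Rightarrow> 'a lc_elt" where
  "pretrace m d X A = the_elem
     {(bsign d * sign_of i) \<odot>\<^bsub>local_cohomology m d\<^esub>
        gen_frac m d (mat_trace (\<alpha> (i + 1 - int d) * htpy_comp X ls (i + 1) * diff X i)) t
      | i \<alpha> t ls. \<alpha> \<in> A \<and> sop m d t \<and> null_homotopies X t ls}"

text \<open>
  For a module \<open>H\<close>, elements of \<open>R\<^sup>n \<otimes> H\<close> are vectors of length \<open>n\<close> with entries in \<open>H\<close>: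
  \<open>tensor_elt H y h\<close> is \<open>y \<otimes> h\<close>, and \<open>tensor_map H A\<close> is \<open>A \<otimes> 1\<close>.
\<close>

definition tensor_elt :: "('a, 'h) module \<Rightarrow> 'a vec \<Rightarrow> 'h \<Rightarrow> 'h vec" where
  "tensor_elt H y h = vec (dim_vec y) (\<lambda>k. y $ k \<odot>\<^bsub>H\<^esub> h)"

definition tensor_map :: "('a, 'h) module \<Rightarrow> 'a mat \<Rightarrow> 'h vec \<Rightarrow> 'h vec" where
  "tensor_map H A v =
     vec (dim_row A) (\<lambda>k. \<Oplus>\<^bsub>H\<^esub>l\<in>{..<dim_col A}. A $$ (k, l) \<odot>\<^bsub>H\<^esub> v $ l)"

text \<open>The class of \<open>y\<close> in \<open>N = Coker(Y\<^sup>-\<^sup>1 \<rightarrow> Y\<^sup>0)\<close>.\<close>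

definition coker_class :: "'a::comm_ring_1 free_complex \<Rightarrow> 'a vec \<Rightarrow> 'a vec set" where
  "coker_class Y y = {y + diff Y (-1) *\<^sub>v u | u. u \<in> carrier_vec (rk Y (-1))}"

text \<open>
  The complete injective resolution of \<open>N\<close>, computed with the system of parameters \<open>s\<close> and the
  homotopies \<open>\<mu>\<^sub>j\<close> on \<open>Y\<close>: a map \<open>N \<rightarrow> Y\<^bsup>1-d\<^esup> \<otimes> H\<^sup>d\<^sub>m(R)\<close>, where the target is the degree \<open>0\<close>
  component of \<open>Y \<otimes> H\<^sup>d\<^sub>m(R)[1-d]\<close>.
\<close>

definition complete_inj_res :: "'a::comm_ring_1 set \<Rightarrow> nat \<Rightarrow> 'a free_complex \<Rightarrow>
    'a list \<Rightarrow> (int \<Rightarrow> 'a mat) list \<Rightarrow> 'a vec set \<Rightarrow> 'a lc_elt vec" where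
  "complete_inj_res m d Y s \<mu> c = the_elem
     ((\<lambda>y. tensor_elt (local_cohomology m d)
             (bsign d \<cdot>\<^sub>v (htpy_comp Y \<mu> 1 *\<^sub>v (diff Y 0 *\<^sub>v y))) (gen_frac m d 1 s)) ` c)"

text \<open>The map \<open>g\<^sub>\<psi> = (\<psi> \<otimes> 1) \<circ> \<vartheta>\<^sub>N : N \<rightarrow> X\<^sup>0 \<otimes> H\<^sup>d\<^sub>m(R)\<close>.\<close>

definition g_map :: "'a::comm_ring_1 set \<Rightarrow> nat \<Rightarrow> 'a free_complex \<Rightarrow>
    'a list \<Rightarrow> (int \<Rightarrow> 'a mat) list \<Rightarrow> (int \<Rightarrow> 'a mat) \<Rightarrow> 'a vec set \<Rightarrow> 'a lc_elt vec" where
  "g_map m d Y s \<mu> \<psi> c =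
     tensor_map (local_cohomology m d) (\<psi> (1 - int d)) (complete_inj_res m d Y s \<mu> c)"

definition pairing_value :: "'a::comm_ring_1 set \<Rightarrow> nat \<Rightarrow> 'a free_complex \<Rightarrow> 'a free_complex \<Rightarrow>
    'a list \<Rightarrow> (int \<Rightarrow> 'a mat) list \<Rightarrow> (int \<Rightarrow> 'a mat) \<Rightarrow> (int \<Rightarrow> 'a mat) \<Rightarrow> 'a lc_elt" where
  "pairing_value m d X Y s \<mu> \<psi> \<phi> =
     (\<Oplus>\<^bsub>local_cohomology m d\<^esub>k\<in>{..<rk X 0}.
        g_map m d Y s \<mu> \<psi> (coker_class Y (\<phi> 0 *\<^sub>v unit_vec (rk X 0) k)) $ k)"

text \<open>
  The duality pairing of morphisms \<open>\<Psi> : Y \<rightarrow> X[d-1]\<close> and \<open>\<Phi> : X \<rightarrow> Y\<close> of the homotopy category,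
  for the complete injective resolution determined by \<open>s\<close> and \<open>\<mu>\<close>.
\<close>

definition duality_pairing :: "'a::comm_ring_1 set \<Rightarrow> nat \<Rightarrow> 'a free_complex \<Rightarrow>
    'a free_complex \<Rightarrow> 'a list \<Rightarrow> (int \<Rightarrow> 'a mat) list \<Rightarrow>
    (int \<Rightarrow> 'a mat) set \<Rightarrow> (int \<Rightarrow> 'a mat) set \<Rightarrow> 'a lc_elt" where
  "duality_pairing m d X Y s \<mu> \<Psi> \<Phi> = the_elem
     {pairing_value m d X Y s \<mu> \<psi> \<phi> | \<psi> \<phi>. \<psi> \<in> \<Psi> \<and> \<phi> \<in> \<Phi>}"

end

theory Submission
  imports Defs
begin

text \<open>
  Write \<open>r[J]\<close> for the trace of \<open>\<psi> \<mu>\<^sub>A \<phi> \<lambda>\<^sub>B \<partial>\<close> in a fixed degree, where \<open>J\<close> is a \<open>d\<close>-element subset of the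
  \<open>2d\<close> positions of \<open>s @ t\<close>, \<open>A\<close> and \<open>B\<close> are its parts in \<open>s\<close> and \<open>t\<close>, and \<open>\<mu>\<^sub>A\<close>, \<open>\<lambda>\<^sub>B\<close> are the ordered
  products of the corresponding homotopies. Commuting \<open>\<partial>\<close> past the homotopies and using \<open>\<partial>\<partial> = 0\<close> with
  the cyclicity of the trace shows that the fractions \<open>r[J] \<theta>\<^sub>J / \<Prod>\<^bsub>j\<in>J\<^esub> (s @ t)\<^sub>j\<close> form a cocycle of
  \<open>K\<^sub>\<infinity>(s @ t)\<close>. Its two projections are the fractions of \<open>tr(\<psi> \<mu> \<partial> \<phi>)\<close> over \<open>s\<close> and of \<open>tr(\<psi> \<phi> \<lambda> \<partial>)\<close>
  over \<open>t\<close>, so these agree in local cohomology; the first is the value of the pairing. The case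
  \<open>\<phi> = 1\<close> gives the independence of the pretrace of the parameters and homotopies, and the same
  commutation rule shows that changing the degree or the representative alters the numerator by an
  element of the ideal \<open>(t)\<close>, on which the generalised fraction vanishes.

  That the classes over \<open>s\<close> and \<open>t\<close> determine each other rests on \<open>K\<^sub>\<infinity>(w @ v) \<rightarrow> K\<^sub>\<infinity>(w)\<close> being a
  quasi-isomorphism when \<open>v\<close> lies in the radical of \<open>(w)\<close>: the kernel consists of localizations of
  \<open>K\<^sub>\<infinity>(w)\<close> at elements of \<open>v\<close>, a power of which annihilates the Koszul homology of powers of \<open>w\<close>.
\<close>

section \<open>Arithmetic of fractions\<close>

definition submonoid_set :: "'a::comm_ring_1 set \<Rightarrow> bool" where
  "submonoid_set S \<longleftrightarrow> 1 \<in> S \<and> (\<forall>a\<in>S. \<forall>b\<in>S. a * b \<in> S)"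

lemma submonoid_setD [simp]:
  assumes "submonoid_set S"
  shows "1 \<in> S" "a \<in> S \<Longrightarrow> b \<in> S \<Longrightarrow> a * b \<in> S"
  using assms by (auto simp: submonoid_set_def)

lemma equiv_loc_rel:
  assumes S: "submonoid_set S"
  shows "equiv (UNIV \<times> S) (loc_rel S)"
proof (rule equivI)
  show "loc_rel S \<subseteq> (UNIV \<times> S) \<times> (UNIV \<times> S)"
    by (auto simp: loc_rel_def)
  show "refl_on (UNIV \<times> S) (loc_rel S)"
    using S by (auto simp: refl_on_def loc_rel_def intro!: bexI[of _ 1])
  show "sym (loc_rel S)"
  proof (rule symI)
    fix x y assume "(x, y) \<in> loc_rel S"
    then obtain a b c e u where x: "x = (a, b)" "y = (c, e)" "b \<in> S" "e \<in> S" "u \<in> S"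
      and u: "u * (a * e - c * b) = 0"
      by (auto simp: loc_rel_def)
    have "u * (c * b - a * e) = - (u * (a * e - c * b))"
      by (simp add: algebra_simps)
    then show "(y, x) \<in> loc_rel S"
      using x u by (auto simp: loc_rel_def)
  qed
  show "trans (loc_rel S)"
  proof (rule transI)
    fix x y z assume "(x, y) \<in> loc_rel S" "(y, z) \<in> loc_rel S"
    then obtain a b c e f g u v where x: "x = (a, b)" "y = (c, e)" "z = (f, g)"
      and S': "b \<in> S" "e \<in> S" "g \<in> S" "u \<in> S" "v \<in> S"
      and u: "u * (a * e - c * b) = 0" and v: "v * (c * g - f * e) = 0"
      by (auto simp: loc_rel_def)
    \<comment> \<open>The middle denominator \<open>e\<close> joins the witness, since it cannot be
      cancelled in a ring with zero divisors.\<close>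
    have "(u * v * e) * (a * g - f * b)
        = v * g * (u * (a * e - c * b)) + u * b * (v * (c * g - f * e))"
      by (simp add: algebra_simps)
    also have "\<dots> = 0" by (simp only: u v mult_zero_right add_0)
    finally show "(x, z) \<in> loc_rel S"
      using S S' x by (auto simp: loc_rel_def intro!: bexI[of _ "u * v * e"])
  qed
qed

lemma lfrac_eq_iff:
  assumes "submonoid_set S" "s \<in> S" "s' \<in> S"
  shows "lfrac S r s = lfrac S r' s' \<longleftrightarrow> (\<exists>u\<in>S. u * (r * s' - r' * s) = 0)"
  using eq_equiv_class_iff[OF equiv_loc_rel[OF assms(1)], of "(r, s)" "(r', s')"] assms
  by (auto simp: lfrac_def loc_rel_def)

lemma lfrac_cancel:
  assumes "submonoid_set S" "s \<in> S" "u \<in> S"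
  shows "lfrac S (u * r) (u * s) = lfrac S r s"
  using assms by (subst lfrac_eq_iff) (auto intro!: bexI[of _ 1] simp: algebra_simps)

lemma carrier_localization:
  "carrier (localization S) = {lfrac S r s | r s. s \<in> S}"
  by (auto simp: localization_def lfrac_def quotient_def)

lemma mem_lfrac:
  assumes "submonoid_set S" "s \<in> S"
  shows "(r', s') \<in> lfrac S r s \<longleftrightarrow> s' \<in> S \<and> lfrac S r' s' = lfrac S r s"
proof -
  have "(r', s') \<in> lfrac S r s \<longleftrightarrow> ((r, s), (r', s')) \<in> loc_rel S"
    by (simp add: lfrac_def)
  also have "\<dots> \<longleftrightarrow> s' \<in> S \<and> lfrac S r s = lfrac S r' s'"
    using assms lfrac_eq_iff[OF assms(1,2), of s'] by (auto simp: loc_rel_def simp del: set_eq_iff)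
  finally show ?thesis by metis
qed

lemma lfrac_self:
  assumes "submonoid_set S" "s \<in> S"
  shows "(r, s) \<in> lfrac S r s"
  using assms by (simp add: mem_lfrac)

text \<open>The operations of \<open>localization\<close> are unions over all representatives; such
  a union collapses once its members do not depend on the representative.\<close>

lemma UN_lfrac:
  assumes "submonoid_set S" "s \<in> S"
    and "\<And>r' s'. s' \<in> S \<Longrightarrow> lfrac S r' s' = lfrac S r s \<Longrightarrow> F r' s' = F r s"
  shows "(\<Union>(r', s')\<in>lfrac S r s. F r' s') = F r s"
proof -
  have "(\<Union>(r', s')\<in>lfrac S r s. F r' s') = (\<Union>(r', s')\<in>lfrac S r s. F r s)"
    using assms mem_lfrac[OF assms(1,2)] by (intro SUP_cong refl) blast
  also have "\<dots> = F r s"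
    using lfrac_self[OF assms(1,2), of r] by auto
  finally show ?thesis .
qed

lemma lfrac_add_cong:
  assumes S: "submonoid_set S" "s \<in> S" "s' \<in> S" "q \<in> S" "q' \<in> S"
    and "lfrac S r s = lfrac S r' s'" "lfrac S p q = lfrac S p' q'"
  shows "lfrac S (r * q + p * s) (s * q) = lfrac S (r' * q' + p' * s') (s' * q')"
proof -
  obtain u v where uv: "u \<in> S" "v \<in> S"
    and u: "u * (r * s' - r' * s) = 0" and v: "v * (p * q' - p' * q) = 0"
    using assms by (auto simp: lfrac_eq_iff)
  have "(u * v) * ((r * q + p * s) * (s' * q') - (r' * q' + p' * s') * (s * q))
    = v * q * q' * (u * (r * s' - r' * s)) + u * s * s' * (v * (p * q' - p' * q))"
    by (simp add: algebra_simps)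
  also have "\<dots> = 0" by (simp only: u v mult_zero_right add_0)
  finally show ?thesis
    using S uv by (auto simp: lfrac_eq_iff intro!: bexI[of _ "u * v"])
qed

lemma lfrac_mult_cong:
  assumes S: "submonoid_set S" "s \<in> S" "s' \<in> S" "q \<in> S" "q' \<in> S"
    and "lfrac S r s = lfrac S r' s'" "lfrac S p q = lfrac S p' q'"
  shows "lfrac S (r * p) (s * q) = lfrac S (r' * p') (s' * q')"
proof -
  obtain u v where uv: "u \<in> S" "v \<in> S"
    and u: "u * (r * s' - r' * s) = 0" and v: "v * (p * q' - p' * q) = 0"
    using assms by (auto simp: lfrac_eq_iff)
  have "(u * v) * ((r * p) * (s' * q') - (r' * p') * (s * q))
    = v * p * q' * (u * (r * s' - r' * s)) + u * r' * s * (v * (p * q' - p' * q))"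
    by (simp add: algebra_simps)
  also have "\<dots> = 0" by (simp only: u v mult_zero_right add_0)
  finally show ?thesis
    using S uv by (auto simp: lfrac_eq_iff intro!: bexI[of _ "u * v"])
qed

section \<open>Operations and canonical maps of localizations, computed on representatives\<close>

lemma localization_add:
  assumes S: "submonoid_set S" "s \<in> S" "q \<in> S"
  shows "lfrac S r s \<oplus>\<^bsub>localization S\<^esub> lfrac S p q = lfrac S (r * q + p * s) (s * q)"
proof -
  have inner: "(\<Union>(p', q')\<in>lfrac S p q. lfrac S (r' * q' + p' * s') (s' * q')) = lfrac S (r' * q + p * s') (s' * q)"
    if "s' \<in> S" for r' s'
    using S that by (intro UN_lfrac lfrac_add_cong) auto
  have "lfrac S r s \<oplus>\<^bsub>localization S\<^esub> lfrac S p q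
      = (\<Union>(r', s')\<in>lfrac S r s. \<Union>(p', q')\<in>lfrac S p q. lfrac S (r' * q' + p' * s') (s' * q'))"
    by (simp add: localization_def)
  also have "\<dots> = (\<Union>(p', q')\<in>lfrac S p q. lfrac S (r * q' + p' * s) (s * q'))"
    using S by (intro UN_lfrac) (simp_all add: inner, rule lfrac_add_cong, simp_all)
  also have "\<dots> = lfrac S (r * q + p * s) (s * q)"
    using S(2) by (rule inner)
  finally show ?thesis .
qed

lemma localization_mult:
  assumes S: "submonoid_set S" "s \<in> S" "q \<in> S"
  shows "lfrac S r s \<otimes>\<^bsub>localization S\<^esub> lfrac S p q = lfrac S (r * p) (s * q)"
proof -
  have inner: "(\<Union>(p', q')\<in>lfrac S p q. lfrac S (r' * p') (s' * q')) = lfrac S (r' * p) (s' * q)"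
    if "s' \<in> S" for r' s'
    using S that by (intro UN_lfrac lfrac_mult_cong) auto
  have "lfrac S r s \<otimes>\<^bsub>localization S\<^esub> lfrac S p q
      = (\<Union>(r', s')\<in>lfrac S r s. \<Union>(p', q')\<in>lfrac S p q. lfrac S (r' * p') (s' * q'))"
    by (simp add: localization_def)
  also have "\<dots> = (\<Union>(p', q')\<in>lfrac S p q. lfrac S (r * p') (s * q'))"
    using S by (intro UN_lfrac) (simp_all add: inner, rule lfrac_mult_cong, simp_all)
  also have "\<dots> = lfrac S (r * p) (s * q)"
    using S(2) by (rule inner)
  finally show ?thesis .
qed

lemma lfrac_mono:
  assumes "submonoid_set S" "submonoid_set S'" "S \<subseteq> S'" "s \<in> S" "q \<in> S"
    and "lfrac S r s = lfrac S p q"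
  shows "lfrac S' r s = lfrac S' p q"
proof -
  obtain u where "u \<in> S" "u * (r * q - p * s) = 0"
    using assms by (auto simp: lfrac_eq_iff)
  with assms show ?thesis
    by (subst lfrac_eq_iff) auto
qed

lemma loc_map_lfrac:
  assumes "submonoid_set S" "submonoid_set S'" "S \<subseteq> S'" "s \<in> S"
  shows "loc_map S' (lfrac S r s) = lfrac S' r s"
  unfolding loc_map_def using assms by (intro UN_lfrac) (simp_all, rule lfrac_mono[of S S'], simp_all)

lemma localization_simps:
  "\<zero>\<^bsub>localization S\<^esub> = lfrac S 0 1" "\<one>\<^bsub>localization S\<^esub> = lfrac S 1 1"
  by (simp_all add: localization_def)

text \<open>Provides what \<open>finsum\<close> needs in order to evaluate the sum in
  \<open>Kdiff\<close>.\<close>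

lemma abelian_monoid_localization:
  assumes S: "submonoid_set S"
  shows "abelian_monoid (localization S)"
proof (rule abelian_monoidI)
  fix x y z
  assume "x \<in> carrier (localization S)" "y \<in> carrier (localization S)"
    "z \<in> carrier (localization S)"
  then obtain a b c a' b' c' where x: "x = lfrac S a a'" "y = lfrac S b b'" "z = lfrac S c c'"
    and [simp]: "a' \<in> S" "b' \<in> S" "c' \<in> S"
    by (auto simp: carrier_localization)
  note [simp] = S
  show "x \<oplus>\<^bsub>localization S\<^esub> y \<in> carrier (localization S)"
    unfolding carrier_localization x
    by (subst localization_add[OF S]; simp) (metis S submonoid_setD(2) \<open>a' \<in> S\<close> \<open>b' \<in> S\<close>)
  show "(x \<oplus>\<^bsub>localization S\<^esub> y) \<oplus>\<^bsub>localization S\<^esub> z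
      = x \<oplus>\<^bsub>localization S\<^esub> (y \<oplus>\<^bsub>localization S\<^esub> z)"
    by (simp add: x localization_add algebra_simps)
  show "x \<oplus>\<^bsub>localization S\<^esub> y = y \<oplus>\<^bsub>localization S\<^esub> x"
    by (simp add: x localization_add algebra_simps)
next
  fix x assume "x \<in> carrier (localization S)"
  then show "\<zero>\<^bsub>localization S\<^esub> \<oplus>\<^bsub>localization S\<^esub> x = x"
    using S by (auto simp: carrier_localization localization_simps localization_add)
next
  show "\<zero>\<^bsub>localization S\<^esub> \<in> carrier (localization S)"
    using submonoid_setD(1)[OF S] unfolding carrier_localization localization_simps by blast
qed

lemma localization_add_same:
  assumes "submonoid_set S" "s \<in> S"
  shows "lfrac S r s \<oplus>\<^bsub>localization S\<^esub> lfrac S p s = lfrac S (r + p) s"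
  using assms lfrac_cancel[of S s s "r + p"] by (simp add: localization_add algebra_simps)

lemma finsum_localization:
  assumes S: "submonoid_set S" "s \<in> S" and "finite A"
  shows "(\<Oplus>\<^bsub>localization S\<^esub>i\<in>A. lfrac S (f i) s) = lfrac S (\<Sum>i\<in>A. f i) s"
proof -
  interpret L: abelian_monoid "localization S"
    by (rule abelian_monoid_localization[OF S(1)])
  from \<open>finite A\<close> show ?thesis
  proof (induction A)
    case empty
    show ?case using S lfrac_cancel[of S 1 s 0] by (simp add: localization_simps)
  next
    case (insert i A)
    then show ?case using S
      by (subst L.finsum_insert) (auto simp: carrier_localization localization_add_same)
  qed
qed

section \<open>Cochains with a common denominator\<close>

lemma submonoid_mult_set [simp]: "submonoid_set (mult_set w J)"
proof -
  have "1 \<in> mult_set w J"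
    unfolding mult_set_def by (intro CollectI exI[of _ "\<lambda>_. 0"]) simp
  moreover have "a * b \<in> mult_set w J" if "a \<in> mult_set w J" "b \<in> mult_set w J" for a b
  proof -
    from that obtain e f where "a = (\<Prod>j\<in>J. (w ! j) ^ e j)" "b = (\<Prod>j\<in>J. (w ! j) ^ f j)"
      by (auto simp: mult_set_def)
    then have "a * b = (\<Prod>j\<in>J. (w ! j) ^ (e j + f j))"
      by (simp add: power_add prod.distrib)
    then show ?thesis
      unfolding mult_set_def by (intro CollectI exI[of _ "\<lambda>j. e j + f j"]) simp
  qed
  ultimately show ?thesis unfolding submonoid_set_def by blast
qed

lemma mult_set_mono:
  assumes "J \<subseteq> J'" "finite J'"
  shows "mult_set w J \<subseteq> mult_set w J'"
proof
  fix a assume "a \<in> mult_set w J"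
  then obtain e where e: "a = (\<Prod>j\<in>J. (w ! j) ^ e j)"
    by (auto simp: mult_set_def)
  have "(\<Prod>j\<in>J'. (w ! j) ^ (if j \<in> J then e j else 0)) = (\<Prod>j\<in>J. (w ! j) ^ e j)"
    using assms by (intro prod.mono_neutral_cong_right) auto
  then show "a \<in> mult_set w J'"
    unfolding mult_set_def e by (intro CollectI exI[of _ "\<lambda>j. if j \<in> J then e j else 0"]) simp
qed

definition idx_prod :: "'a::comm_ring_1 list \<Rightarrow> nat set \<Rightarrow> 'a" where
  "idx_prod w J = (\<Prod>j\<in>J. w ! j)"

lemma idx_prod_power_mem [simp]: "idx_prod w J ^ k \<in> mult_set w J"
  unfolding mult_set_def idx_prod_def
  by (intro CollectI exI[of _ "\<lambda>_. k"]) (simp add: prod_power_distrib)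

lemma idx_prod_remove:
  "finite J \<Longrightarrow> i \<in> J \<Longrightarrow> idx_prod w J = w ! i * idx_prod w (J - {i})"
  unfolding idx_prod_def by (rule prod.remove)

text \<open>The sum of all exponents of \<open>a\<close> bounds each of them, so it is a sufficient
  power. The bound is stated with \<open>eventually\<close> so that finitely many of them combine
  without explicit maxima.\<close>

lemma mult_set_dvd_power:
  assumes "a \<in> mult_set w J" "finite J"
  shows "\<forall>\<^sub>F N in sequentially. a dvd idx_prod w J ^ N"
proof -
  obtain e where e: "a = (\<Prod>j\<in>J. (w ! j) ^ e j)"
    using assms by (auto simp: mult_set_def)
  have "a dvd idx_prod w J ^ N" if "N \<ge> sum e J" for N
    unfolding e idx_prod_def prod_power_distrib
    using that assms(2) member_le_sum[of _ J e]
    by (intro prod_dvd_prod le_imp_power_dvd) (meson le_trans zero_le)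
  then show ?thesis
    unfolding eventually_sequentially by blast
qed

section \<open>Index sets, and cochains at a fixed level of the colimit\<close>

lemma Kidx_finite [simp]: "finite (Kidx w p)"
  by (rule finite_subset[of _ "Pow {..<length w}"]) (auto simp: Kidx_def)

lemma Kidx_memD:
  assumes "J \<in> Kidx w p"
  shows "finite J" "J \<subseteq> {..<length w}" "card J = p"
  using assms by (auto simp: Kidx_def intro: finite_subset)

lemma Kidx_remove: "J \<in> Kidx w (Suc p) \<Longrightarrow> i \<in> J \<Longrightarrow> J - {i} \<in> Kidx w p"
  by (auto simp: Kidx_def card_Diff_singleton_if)

text \<open>
  \<open>K\<^sub>\<infinity>(w)\<close> is the colimit of the Koszul complexes on the powers \<open>w\<^sup>k\<close>: with all denominators raised
  to the same exponent \<open>k\<close>, a cochain is given by numerators \<open>r\<close>, only the values of \<open>r\<close> on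
  \<^term>\<open>Kidx w p\<close> matter, and the differential acts on numerators as \<open>koszul_diff\<close>.
\<close>

definition cfrac :: "'a::comm_ring_1 list \<Rightarrow> nat \<Rightarrow> nat \<Rightarrow> (nat set \<Rightarrow> 'a) \<Rightarrow> 'a cochain" where
  "cfrac w p k r = (\<lambda>J\<in>Kidx w p. lfrac (mult_set w J) (r J) (idx_prod w J ^ k))"

definition koszul_diff ::
    "'a::comm_ring_1 list \<Rightarrow> nat \<Rightarrow> (nat set \<Rightarrow> 'a) \<Rightarrow> nat set \<Rightarrow> 'a" where
  "koszul_diff w k r J = (\<Sum>i\<in>J. (-1) ^ card {j\<in>J. j < i} * (w ! i) ^ k * r (J - {i}))"

lemma cfrac_cong: "(\<And>J. J \<in> Kidx w p \<Longrightarrow> r J = r' J) \<Longrightarrow> cfrac w p k r = cfrac w p k r'"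
  unfolding cfrac_def by (intro restrict_ext) simp

text \<open>The transition maps of the colimit: each fraction is extended by
  \<open>idx_prod w J ^ l\<close>.\<close>

lemma cfrac_raise:
  "cfrac w p k r = cfrac w p (k + l) (\<lambda>J. idx_prod w J ^ l * r J)"
  unfolding cfrac_def
proof (intro restrict_ext)
  fix J
  have "lfrac (mult_set w J) (idx_prod w J ^ l * r J) (idx_prod w J ^ l * idx_prod w J ^ k)
      = lfrac (mult_set w J) (r J) (idx_prod w J ^ k)"
    by (intro lfrac_cancel) simp_all
  then show "lfrac (mult_set w J) (r J) (idx_prod w J ^ k)
      = lfrac (mult_set w J) (idx_prod w J ^ l * r J) (idx_prod w J ^ (k + l))"
    by (simp add: power_add mult.commute)
qed

text \<open>For a single \<open>J\<close>, equality of fractions supplies a multiplier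
  \<open>u\<close>, and high powers of \<open>idx_prod w J\<close> are divisible by
  \<open>u * idx_prod w J ^ k\<close>. The finitely many \<open>J\<close> then share one
  exponent.\<close>

lemma cfrac_eqD:
  assumes "cfrac w p k r = cfrac w p k r'"
  shows "\<forall>\<^sub>F N in sequentially. \<forall>J\<in>Kidx w p. idx_prod w J ^ N * r J = idx_prod w J ^ N * r' J"
proof (intro eventually_ball_finite ballI Kidx_finite)
  fix J assume J: "J \<in> Kidx w p"
  let ?P = "idx_prod w J"
  have "lfrac (mult_set w J) (r J) (?P ^ k) = lfrac (mult_set w J) (r' J) (?P ^ k)"
    using fun_cong[OF assms, of J] J by (simp add: cfrac_def)
  then obtain u where u: "u \<in> mult_set w J" "u * (r J * ?P ^ k - r' J * ?P ^ k) = 0"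
    by (auto simp: lfrac_eq_iff)
  have "\<forall>\<^sub>F N in sequentially. u * ?P ^ k dvd ?P ^ N"
    using u J by (intro mult_set_dvd_power) (auto dest: Kidx_memD)
  then show "\<forall>\<^sub>F N in sequentially. ?P ^ N * r J = ?P ^ N * r' J"
  proof eventually_elim
    case (elim N)
    then obtain c where "?P ^ N = u * ?P ^ k * c" by blast
    then have "?P ^ N * r J - ?P ^ N * r' J = c * (u * (r J * ?P ^ k - r' J * ?P ^ k))"
      by (simp add: algebra_simps)
    then show ?case using u by simp
  qed
qed

lemma cfrac_carrier [simp]: "cfrac w p k r \<in> carrier (Kmod w p)"
proof -
  have "\<exists>a s. lfrac (mult_set w J) (r J) (idx_prod w J ^ k) = lfrac (mult_set w J) a s
      \<and> s \<in> mult_set w J" for J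
    using idx_prod_power_mem by blast
  then show ?thesis
    by (auto simp: Kmod_def cfrac_def carrier_localization)
qed

text \<open>Every denominator in \<open>mult_set w J\<close> divides a high power of
  \<open>idx_prod w J\<close>; as there are finitely many \<open>J\<close>, one exponent serves all
  components.\<close>

lemma cfrac_surj:
  assumes "x \<in> carrier (Kmod w p)"
  shows "\<forall>\<^sub>F k in sequentially. \<exists>r. x = cfrac w p k r"
proof -
  have "\<forall>\<^sub>F k in sequentially. \<forall>J\<in>Kidx w p.
      \<exists>a. x J = lfrac (mult_set w J) a (idx_prod w J ^ k)"
  proof (intro eventually_ball_finite ballI Kidx_finite)
    fix J assume J: "J \<in> Kidx w p"
    then have "x J \<in> carrier (loc_at w J)"
      using assms by (auto simp: Kmod_def)
    then obtain a s where x: "x J = lfrac (mult_set w J) a s" and s: "s \<in> mult_set w J"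
      by (auto simp: carrier_localization)
    have "\<forall>\<^sub>F N in sequentially. s dvd idx_prod w J ^ N"
      using s J by (intro mult_set_dvd_power) (auto dest: Kidx_memD)
    then show "\<forall>\<^sub>F k in sequentially. \<exists>a. x J = lfrac (mult_set w J) a (idx_prod w J ^ k)"
    proof eventually_elim
      case (elim N)
      then obtain c where c: "idx_prod w J ^ N = s * c" by blast
      have "x J = lfrac (mult_set w J) (a * c) (idx_prod w J ^ N)"
        unfolding x using s idx_prod_power_mem[of w J N] c
        by (subst lfrac_eq_iff) (auto intro!: bexI[of _ 1] simp: algebra_simps)
      then show ?case by blast
    qed
  qed
  then show ?thesis
  proof eventually_elim
    case (elim k)
    then obtain r where "\<And>J. J \<in> Kidx w p \<Longrightarrow> x J = lfrac (mult_set w J) (r J) (idx_prod w J ^ k)"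
      by metis
    moreover have "x \<in> extensional (Kidx w p)"
      using assms by (simp add: Kmod_def PiE_def)
    ultimately have "x = cfrac w p k r"
      by (intro extensionalityI[of _ "Kidx w p"]) (auto simp: cfrac_def)
    then show ?case by blast
  qed
qed

lemma Kmod_zero: "\<zero>\<^bsub>Kmod w p\<^esub> = cfrac w p k (\<lambda>_. 0)"
proof -
  have "lfrac (mult_set w J) 0 1 = lfrac (mult_set w J) 0 (idx_prod w J ^ k)" for J
    by (subst lfrac_eq_iff) (simp_all, metis submonoid_setD(1) submonoid_mult_set)
  then show ?thesis
    by (simp add: Kmod_def cfrac_def localization_simps)
qed

lemma Kmod_add:
  "cfrac w p k r \<oplus>\<^bsub>Kmod w p\<^esub> cfrac w p k r' = cfrac w p k (\<lambda>J. r J + r' J)"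
  by (auto simp: Kmod_def cfrac_def localization_add_same intro!: restrict_ext)

lemma Kmod_smult:
  "c \<odot>\<^bsub>Kmod w p\<^esub> cfrac w p k r = cfrac w p k (\<lambda>J. c * r J)"
  by (auto simp: Kmod_def cfrac_def localization_mult intro!: restrict_ext)

text \<open>The component at \<open>J - {i}\<close> lacks the factor \<open>w ! i\<close> in its
  denominator; extending by \<open>(w ! i) ^ k\<close> gives the common denominator. Hence the
  Koszul differential of the \<open>k\<close>-th powers acts on the numerators.\<close>

lemma Kdiff_cfrac:
  "Kdiff w p (cfrac w p k r) = cfrac w (Suc p) k (koszul_diff w k r)"
  unfolding Kdiff_def cfrac_def[of w "Suc p"]
proof (intro restrict_ext)
  fix J assume J: "J \<in> Kidx w (Suc p)"
  let ?S = "mult_set w J" and ?P = "idx_prod w J"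
  have fin: "finite J" using J by (rule Kidx_memD)
  have "lfrac ?S ((-1) ^ card {j\<in>J. j < i}) 1
        \<otimes>\<^bsub>loc_at w J\<^esub> loc_map ?S (cfrac w p k r (J - {i}))
      = lfrac ?S ((-1) ^ card {j\<in>J. j < i} * (w ! i) ^ k * r (J - {i})) (?P ^ k)"
    if i: "i \<in> J" for i
  proof -
    let ?Q = "idx_prod w (J - {i})"
    have sub: "mult_set w (J - {i}) \<subseteq> ?S"
      using fin by (intro mult_set_mono) auto
    then have Q: "?Q ^ k \<in> ?S" using idx_prod_power_mem by blast
    have w: "(w ! i) ^ k * ?Q ^ k = ?P ^ k"
      by (simp add: idx_prod_remove[OF fin i] power_mult_distrib)
    have "loc_map ?S (cfrac w p k r (J - {i})) = lfrac ?S (r (J - {i})) (?Q ^ k)"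
      using sub Kidx_remove[OF J i] by (simp add: cfrac_def loc_map_lfrac)
    also have "\<dots> = lfrac ?S ((w ! i) ^ k * r (J - {i})) (?P ^ k)"
      using Q idx_prod_power_mem[of w J k]
      by (subst lfrac_eq_iff) (simp_all add: algebra_simps flip: w, metis submonoid_setD(1) submonoid_mult_set)
    finally show ?thesis
      by (simp add: localization_mult mult.assoc)
  qed
  then have "(\<Oplus>\<^bsub>loc_at w J\<^esub>i\<in>J. lfrac ?S ((-1) ^ card {j\<in>J. j < i}) 1
        \<otimes>\<^bsub>loc_at w J\<^esub> loc_map ?S (cfrac w p k r (J - {i})))
      = (\<Oplus>\<^bsub>loc_at w J\<^esub>i\<in>J.
          lfrac ?S ((-1) ^ card {j\<in>J. j < i} * (w ! i) ^ k * r (J - {i})) (?P ^ k))"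
    using abelian_monoid_localization[of ?S]
    by (intro abelian_monoid.finsum_cong') (auto simp: carrier_localization intro!: exI)
  also have "\<dots> = lfrac ?S (koszul_diff w k r J) (?P ^ k)"
    unfolding koszul_diff_def using fin by (intro finsum_localization) simp_all
  finally show "(\<Oplus>\<^bsub>loc_at w J\<^esub>i\<in>J. lfrac ?S ((-1) ^ card {j\<in>J. j < i}) 1
        \<otimes>\<^bsub>loc_at w J\<^esub> loc_map ?S (cfrac w p k r (J - {i})))
      = lfrac ?S (koszul_diff w k r J) (?P ^ k)" .
qed

text \<open>Compatibility of the transition maps with the Koszul differentials, from
  \<open>idx_prod w J = w ! i * idx_prod w (J - {i})\<close>.\<close>

lemma koszul_diff_raise:
  assumes "finite J"
  shows "koszul_diff w (k + l) (\<lambda>J. idx_prod w J ^ l * r J) J = idx_prod w J ^ l * koszul_diff w k r J"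
  unfolding koszul_diff_def sum_distrib_left
  by (intro sum.cong refl)
    (simp add: idx_prod_remove[OF assms] power_add power_mult_distrib algebra_simps)

lemma abelian_group_Kmod: "abelian_group (Kmod w p)"
proof (rule abelian_groupI)
  fix x y z assume "x \<in> carrier (Kmod w p)" "y \<in> carrier (Kmod w p)" "z \<in> carrier (Kmod w p)"
  then have "\<forall>\<^sub>F k in sequentially. (\<exists>r. x = cfrac w p k r) \<and> (\<exists>r. y = cfrac w p k r)
      \<and> (\<exists>r. z = cfrac w p k r)"
    by (intro eventually_conj cfrac_surj)
  then obtain k a b c where x: "x = cfrac w p k a" "y = cfrac w p k b" "z = cfrac w p k c"
    by (auto dest: eventually_happens)
  show "x \<oplus>\<^bsub>Kmod w p\<^esub> y \<oplus>\<^bsub>Kmod w p\<^esub> z = x \<oplus>\<^bsub>Kmod w p\<^esub> (y \<oplus>\<^bsub>Kmod w p\<^esub> z)"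
    by (simp add: x Kmod_add add.assoc)
  show "x \<oplus>\<^bsub>Kmod w p\<^esub> y \<in> carrier (Kmod w p)"
    by (simp add: x Kmod_add)
  show "x \<oplus>\<^bsub>Kmod w p\<^esub> y = y \<oplus>\<^bsub>Kmod w p\<^esub> x"
    by (simp add: x Kmod_add add.commute)
  show "\<zero>\<^bsub>Kmod w p\<^esub> \<oplus>\<^bsub>Kmod w p\<^esub> x = x"
    by (simp add: x Kmod_add Kmod_zero[of w p k])
  have "cfrac w p k (\<lambda>J. - a J) \<oplus>\<^bsub>Kmod w p\<^esub> x = \<zero>\<^bsub>Kmod w p\<^esub>"
    by (simp add: x Kmod_add Kmod_zero[of w p k])
  then show "\<exists>y\<in>carrier (Kmod w p). y \<oplus>\<^bsub>Kmod w p\<^esub> x = \<zero>\<^bsub>Kmod w p\<^esub>"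
    by (intro bexI[of _ "cfrac w p k (\<lambda>J. - a J)"]) simp_all
next
  show "\<zero>\<^bsub>Kmod w p\<^esub> \<in> carrier (Kmod w p)"
    by (simp add: Kmod_zero[of w p 0])
qed

text \<open>Increasing the exponent turns a cocycle of fractions into a cocycle of numerators.\<close>

lemma cocycleE:
  assumes "x \<in> Kcocycles w p"
  shows "\<forall>\<^sub>F k in sequentially. \<exists>r. x = cfrac w p k r \<and> (\<forall>J\<in>Kidx w (Suc p). koszul_diff w k r J = 0)"
proof -
  have "x \<in> carrier (Kmod w p)" and d: "Kdiff w p x = \<zero>\<^bsub>Kmod w (Suc p)\<^esub>"
    using assms by (auto simp: Kcocycles_def)
  from cfrac_surj[OF this(1)] obtain k r where x: "x = cfrac w p k r"
    by (auto dest: eventually_happens)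
  from d have "cfrac w (Suc p) k (koszul_diff w k r) = cfrac w (Suc p) k (\<lambda>_. 0)"
    unfolding x Kdiff_cfrac Kmod_zero[of w "Suc p" k] .
  from cfrac_eqD[OF this] obtain N0 where N0: "\<And>N. N \<ge> N0 \<Longrightarrow>
      \<forall>J\<in>Kidx w (Suc p). idx_prod w J ^ N * koszul_diff w k r J = 0"
    by (auto simp: eventually_sequentially)
  show ?thesis
    unfolding eventually_sequentially
  proof (intro exI[of _ "k + N0"] allI impI)
    fix K assume "k + N0 \<le> K"
    then obtain l where K: "K = k + l" "l \<ge> N0"
      by (metis add_le_cancel_left le_Suc_ex le_add1 le_trans)
    \<comment> \<open>Raising the level by \<open>l\<close> multiplies
      \<open>koszul_diff w k r J\<close> by \<open>idx_prod w J ^ l\<close>, and \<open>l\<close> is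
      large enough for this to vanish.\<close>
    show "\<exists>r. x = cfrac w p K r \<and> (\<forall>J\<in>Kidx w (Suc p). koszul_diff w K r J = 0)"
      using N0[OF K(2)] unfolding K(1)
      by (intro exI[of _ "\<lambda>J. idx_prod w J ^ l * r J"] conjI)
        (auto simp: x koszul_diff_raise Kidx_memD(1) cfrac_raise[symmetric])
  qed
qed

lemma cocycleI:
  assumes "\<forall>J\<in>Kidx w (Suc p). koszul_diff w k r J = 0"
  shows "cfrac w p k r \<in> Kcocycles w p"
  using assms by (auto simp: Kcocycles_def Kdiff_cfrac Kmod_zero[of w "Suc p" k] intro: cfrac_cong)

lemma coboundaryI: "cfrac w (Suc p) k (koszul_diff w k e) \<in> Kcoboundaries w (Suc p)"
  unfolding Kcoboundaries_def by (auto simp: Kdiff_cfrac[symmetric])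

lemma coboundaryE:
  assumes "x \<in> Kcoboundaries w (Suc p)"
  shows "\<forall>\<^sub>F k in sequentially. \<exists>e. x = cfrac w (Suc p) k (koszul_diff w k e)"
proof -
  obtain y where y: "y \<in> carrier (Kmod w p)" and x: "x = Kdiff w p y"
    using assms by (auto simp: Kcoboundaries_def)
  from cfrac_surj[OF y] show ?thesis
    by eventually_elim (auto simp: x Kdiff_cfrac)
qed

section \<open>Enlarging the sequence of parameters\<close>

text \<open>Contraction with the \<open>i\<close>-th basis vector of the exterior algebra; the sign
  is that of moving the \<open>i\<close>-th \<theta> to the front of the monomial for
  \<open>insert i J\<close>.\<close>

definition koszul_htpy :: "nat \<Rightarrow> (nat set \<Rightarrow> 'a::comm_ring_1) \<Rightarrow> nat set \<Rightarrow> 'a" where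
  "koszul_htpy i c J = (if i \<in> J then 0 else (-1) ^ card {j\<in>J. j < i} * c (insert i J))"

text \<open>Anticommutativity of the \<theta>s: whichever of \<open>i\<close> and \<open>k\<close>
  is smaller, exactly one of the two counts changes, and it changes by one.\<close>

lemma koszul_sign_swap:
  fixes i k :: nat
  assumes "finite J" "k \<in> J" "i \<notin> J"
  shows "(-1) ^ card {j\<in>J. j < i} * (-1) ^ card {j\<in>insert i J. j < k}
    = - ((-1) ^ card {j\<in>J. j < k} * (-1) ^ card {j\<in>J - {k}. j < i} :: 'a::comm_ring_1)"
proof (cases "k < i")
  case True
  have "{j\<in>insert i J. j < k} = {j\<in>J. j < k}" "{j\<in>J. j < i} = insert k {j\<in>J - {k}. j < i}"
    using True assms by (auto dest: less_asym)
  then show ?thesis using assms(1) by simp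
next
  case False
  then have "i < k" using assms by (cases "i = k") auto
  then have "{j\<in>insert i J. j < k} = insert i {j\<in>J. j < k}" "{j\<in>J - {k}. j < i} = {j\<in>J. j < i}"
    by auto
  then show ?thesis using assms by simp
qed

text \<open>Exterior multiplication and contraction anticommute up to the scalar
  \<open>(w ! i) ^ k\<close>. If \<open>i\<close> lies in \<open>J\<close>, only the summand
  removing \<open>i\<close> survives; otherwise the mixed summands cancel by
  \<open>koszul_sign_swap\<close>.\<close>

lemma koszul_contraction:
  assumes J: "finite J"
  shows "koszul_diff w k (koszul_htpy i c) J + koszul_htpy i (koszul_diff w k c) J = (w ! i) ^ k * c J"
proof (cases "i \<in> J")
  case True
  \<comment> \<open>For \<open>l\<close> other than \<open>i\<close> the set \<open>J - {l}\<close>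
    still contains \<open>i\<close>, where \<open>koszul_htpy i c\<close> is zero.\<close>
  have "koszul_diff w k (koszul_htpy i c) J
      = (\<Sum>l\<in>{i}. (-1) ^ card {j\<in>J. j < l} * (w ! l) ^ k * koszul_htpy i c (J - {l}))"
    unfolding koszul_diff_def using True J
    by (intro sum.mono_neutral_right) (auto simp: koszul_htpy_def)
  also have "\<dots> = ((-1) ^ card {j\<in>J. j < i} * (-1) ^ card {j\<in>J - {i}. j < i}) * ((w ! i) ^ k * c J)"
    using True by (simp add: koszul_htpy_def insert_absorb algebra_simps)
  also have "{j\<in>J - {i}. j < i} = {j\<in>J. j < i}"
    by auto
  finally have "koszul_diff w k (koszul_htpy i c) J = (w ! i) ^ k * c J"
    by (simp add: power_add[symmetric] mult_2[symmetric])
  then show ?thesis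
    using True by (simp add: koszul_htpy_def[of i "koszul_diff w k c" J])
next
  case False
  have set: "{j\<in>insert i J. j < i} = {j\<in>J. j < i}" by auto
  have summand: "(-1) ^ card {j\<in>J. j < i} * ((-1) ^ card {j\<in>insert i J. j < l} * (w ! l) ^ k * c (insert i J - {l}))
      = - ((-1) ^ card {j\<in>J. j < l} * (w ! l) ^ k * koszul_htpy i c (J - {l}))"
    if l: "l \<in> J" for l
  proof -
    have "insert i J - {l} = insert i (J - {l})" using l False by auto
    then have "(-1) ^ card {j\<in>J. j < i} * ((-1) ^ card {j\<in>insert i J. j < l} * (w ! l) ^ k * c (insert i J - {l}))
      = ((-1) ^ card {j\<in>J. j < i} * (-1) ^ card {j\<in>insert i J. j < l}) * ((w ! l) ^ k * c (insert i (J - {l})))"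
      by (simp add: mult.assoc)
    also have "\<dots> = - ((-1) ^ card {j\<in>J. j < l} * (w ! l) ^ k * koszul_htpy i c (J - {l}))"
      unfolding koszul_sign_swap[OF J l False] using False
      by (simp add: koszul_htpy_def algebra_simps)
    finally show ?thesis .
  qed
  have "koszul_diff w k c (insert i J)
      = (-1) ^ card {j\<in>J. j < i} * (w ! i) ^ k * c J
      + (\<Sum>l\<in>J. (-1) ^ card {j\<in>insert i J. j < l} * (w ! l) ^ k * c (insert i J - {l}))"
    unfolding koszul_diff_def sum.insert[OF J False] set using False by simp
  then have "koszul_htpy i (koszul_diff w k c) J
      = (-1) ^ card {j\<in>J. j < i} * ((-1) ^ card {j\<in>J. j < i} * (w ! i) ^ k * c J)
      + (\<Sum>l\<in>J. (-1) ^ card {j\<in>J. j < i} * ((-1) ^ card {j\<in>insert i J. j < l} * (w ! l) ^ k * c (insert i J - {l})))"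
    using False by (simp add: koszul_htpy_def distrib_left sum_distrib_left)
  also have "(\<Sum>l\<in>J. (-1) ^ card {j\<in>J. j < i} * ((-1) ^ card {j\<in>insert i J. j < l} * (w ! l) ^ k * c (insert i J - {l})))
      = - koszul_diff w k (koszul_htpy i c) J"
    unfolding koszul_diff_def sum_negf[symmetric] by (intro sum.cong refl summand)
  finally show ?thesis
    by (simp add: mult.assoc[symmetric] power_add[symmetric] mult_2[symmetric])
qed

section \<open>Linearity of the Koszul differential and annihilators of its cohomology\<close>

lemma koszul_diff_cong:
  "(\<And>i. i \<in> J \<Longrightarrow> r (J - {i}) = r' (J - {i})) \<Longrightarrow> koszul_diff w k r J = koszul_diff w k r' J"
  by (simp add: koszul_diff_def)

lemma koszul_diff_add:
  "koszul_diff w k (\<lambda>J. r J + r' J) J = koszul_diff w k r J + koszul_diff w k r' J"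
  by (simp add: koszul_diff_def distrib_left sum.distrib)

lemma koszul_diff_diff:
  "koszul_diff w k (\<lambda>J. r J - r' J) J = koszul_diff w k r J - koszul_diff w k r' J"
  by (simp add: koszul_diff_def right_diff_distrib sum_subtractf)

lemma koszul_diff_scale: "koszul_diff w k (\<lambda>J. c * r J) J = c * koszul_diff w k r J"
  by (simp add: koszul_diff_def sum_distrib_left algebra_simps)

lemma koszul_diff_sum:
  "koszul_diff w k (\<lambda>J. \<Sum>i\<in>A. r i J) J = (\<Sum>i\<in>A. koszul_diff w k (r i) J)"
  unfolding koszul_diff_def by (simp add: sum_distrib_left sum.swap[of _ A])

text \<open>On a cocycle the contraction formula exhibits \<open>(w ! i) ^ k * c\<close> as a
  boundary, and the primitives combine linearly. So the ideal of the \<open>k\<close>-th powers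
  annihilates Koszul cohomology.\<close>

lemma koszul_cocycle_annihilated:
  assumes c: "\<forall>J\<in>Kidx w (Suc p). koszul_diff w k c J = 0" and J: "J \<in> Kidx w p"
  shows "(\<Sum>i<length w. b i * (w ! i) ^ k) * c J
    = koszul_diff w k (\<lambda>J. \<Sum>i<length w. b i * koszul_htpy i c J) J"
proof -
  have "(w ! i) ^ k * c J = koszul_diff w k (koszul_htpy i c) J" if "i < length w" for i
  proof -
    \<comment> \<open>If \<open>i\<close> is not in \<open>J\<close>, then \<open>insert i J\<close>
      has \<open>Suc p\<close> elements, where \<open>c\<close> satisfies the cocycle
      condition.\<close>
    have "koszul_htpy i (koszul_diff w k c) J = 0"
      using c J that by (auto simp: koszul_htpy_def Kidx_def card_insert_if finite_subset)
    then show ?thesis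
      using koszul_contraction[OF Kidx_memD(1)[OF J], of w k i c] by simp
  qed
  then show ?thesis
    by (simp add: koszul_diff_sum koszul_diff_scale sum_distrib_right mult.assoc)
qed

text \<open>The radical of the ideal generated by \<open>w\<close>, with explicit coefficients
  because \<open>koszul_cocycle_annihilated\<close> consumes a linear combination.\<close>

definition in_radical :: "'a::comm_ring_1 list \<Rightarrow> 'a \<Rightarrow> bool" where
  "in_radical w v \<longleftrightarrow> (\<exists>N b. v ^ N = (\<Sum>i<length w. b i * w ! i))"

text \<open>In each term of the binomial expansion either \<open>y\<close> has exponent at least
  \<open>A\<close> or \<open>z\<close> has exponent at least \<open>B\<close>.\<close>

lemma radical_add:
  fixes y z :: "'a::comm_ring_1"
  assumes add: "\<And>a b. a \<in> I \<Longrightarrow> b \<in> I \<Longrightarrow> a + b \<in> I" and mult: "\<And>a c. a \<in> I \<Longrightarrow> c * a \<in> I"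
    and zero: "0 \<in> I" and y: "y ^ A \<in> I" and z: "z ^ B \<in> I"
  shows "(y + z) ^ (A + B) \<in> I"
proof -
  have "of_nat ((A + B) choose k) * y ^ k * z ^ (A + B - k) \<in> I" for k
  proof (cases "A \<le> k")
    case True
    then have "y ^ k = y ^ (k - A) * y ^ A"
      by (simp add: power_add[symmetric])
    then have "of_nat ((A + B) choose k) * y ^ k * z ^ (A + B - k)
        = (of_nat ((A + B) choose k) * y ^ (k - A) * z ^ (A + B - k)) * y ^ A"
      by (simp add: mult_ac)
    then show ?thesis using mult[OF y] by metis
  next
    case False
    then have "z ^ (A + B - k) = z ^ (A - k) * z ^ B"
      by (simp add: power_add[symmetric])
    then have "of_nat ((A + B) choose k) * y ^ k * z ^ (A + B - k)
        = (of_nat ((A + B) choose k) * y ^ k * z ^ (A - k)) * z ^ B"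
      by (simp add: mult_ac)
    then show ?thesis using mult[OF z] by metis
  qed
  moreover have "finite K \<Longrightarrow> (\<And>k. k \<in> K \<Longrightarrow> f k \<in> I) \<Longrightarrow> sum f K \<in> I" for f and K :: "nat set"
    by (induction K rule: finite_induct) (auto intro: add zero)
  ultimately show ?thesis
    unfolding binomial_ring by simp
qed

text \<open>Replacing generators by their powers does not change the radical. The combination that
  equals \<open>v ^ N\<close> is treated one summand at a time by
  \<open>radical_add\<close>.\<close>

lemma in_radical_powers:
  assumes "in_radical w v"
  shows "\<exists>L b. v ^ L = (\<Sum>i<length w. b i * (w ! i) ^ k)"
proof -
  let ?I = "{\<Sum>i<length w. b i * (w ! i) ^ k | b. True}"
  have add: "x + y \<in> ?I" if "x \<in> ?I" "y \<in> ?I" for x y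
  proof -
    from that obtain b b' where "x = (\<Sum>i<length w. b i * (w ! i) ^ k)"
      "y = (\<Sum>i<length w. b' i * (w ! i) ^ k)"
      by blast
    then have "x + y = (\<Sum>i<length w. (b i + b' i) * (w ! i) ^ k)"
      by (simp add: distrib_right sum.distrib)
    then show ?thesis by (intro CollectI exI[of _ "\<lambda>i. b i + b' i"]) simp
  qed
  have mult: "c * x \<in> ?I" if "x \<in> ?I" for c x
  proof -
    from that obtain b where "x = (\<Sum>i<length w. b i * (w ! i) ^ k)" by blast
    then have "c * x = (\<Sum>i<length w. (c * b i) * (w ! i) ^ k)"
      by (simp add: sum_distrib_left mult.assoc)
    then show ?thesis by (intro CollectI exI[of _ "\<lambda>i. c * b i"]) simp
  qed
  have zero: "0 \<in> ?I"
    by (intro CollectI exI[of _ "\<lambda>_. 0"]) simp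
  have gen: "(w ! i) ^ k \<in> ?I" if "i < length w" for i
    using that by (intro CollectI exI[of _ "\<lambda>j. if j = i then 1 else 0"]) (simp add: sum.remove[of _ i])
  have ex: "\<exists>L. (\<Sum>i<n. b i * w ! i) ^ L \<in> ?I" if "n \<le> length w" for n b
    using that
  proof (induction n)
    case 0
    \<comment> \<open>The exponent is 1 because \<open>0 ^ 0\<close> is \<open>1\<close>.\<close>
    then show ?case using zero by (intro exI[of _ 1]) simp
  next
    case (Suc n)
    then obtain L where L: "(\<Sum>i<n. b i * w ! i) ^ L \<in> ?I" by auto
    moreover have "(b n * w ! n) ^ k \<in> ?I"
      unfolding power_mult_distrib using Suc.prems by (intro mult gen) simp
    ultimately have "((\<Sum>i<n. b i * w ! i) + b n * w ! n) ^ (L + k) \<in> ?I"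
      by (intro radical_add add mult zero)
    then show ?case by auto
  qed
  obtain N b where N: "v ^ N = (\<Sum>i<length w. b i * w ! i)"
    using assms by (auto simp: in_radical_def)
  obtain L where "(v ^ N) ^ L \<in> ?I"
    using ex[OF order_refl, of b] unfolding N by (rule exE)
  then show ?thesis
    unfolding power_mult[symmetric] by blast
qed

text \<open>Exactness of the Koszul complex after inverting \<open>v\<close>: some
  \<open>v ^ L\<close> is a combination of the \<open>k\<close>-th powers, and these annihilate
  cohomology. One \<open>L\<close> serves all \<open>J\<close>.\<close>

lemma koszul_cocycle_exact:
  assumes "in_radical w v" and "\<forall>J\<in>Kidx w (Suc p). koszul_diff w k c J = 0"
  shows "\<exists>L e. \<forall>J\<in>Kidx w p. v ^ L * c J = koszul_diff w k e J"
proof -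
  obtain L b where "v ^ L = (\<Sum>i<length w. b i * (w ! i) ^ k)"
    using in_radical_powers[OF assms(1)] by blast
  then show ?thesis
    using koszul_cocycle_annihilated[OF assms(2)]
    by (intro exI[of _ L] exI[of _ "\<lambda>J. \<Sum>i<length w. b i * koszul_htpy i c J"]) simp
qed

section \<open>Appending one element to the sequence\<close>

lemma in_radical_append: "in_radical w v \<Longrightarrow> in_radical (w @ w') v"
proof -
  assume "in_radical w v"
  then obtain N b where b: "v ^ N = (\<Sum>i<length w. b i * w ! i)"
    by (auto simp: in_radical_def)
  have "(\<Sum>i<length (w @ w'). (if i < length w then b i else 0) * (w @ w') ! i) = v ^ N"
    unfolding b by (rule sum.mono_neutral_cong_right) (auto simp: nth_append)
  then show ?thesis
    unfolding in_radical_def by metis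
qed

lemma koszul_diff_append:
  assumes "J \<subseteq> {..<length w}"
  shows "koszul_diff (w @ w') k r J = koszul_diff w k r J"
  using assms unfolding koszul_diff_def by (intro sum.cong refl) (auto simp: nth_append)

text \<open>The new index exceeds all of \<open>J\<close>, so the old signs are unchanged and its
  own summand has sign \<open>(-1) ^ card J\<close>. This presents the complex of
  \<open>w @ [v]\<close> as a mapping cone of localization at \<open>v\<close>.\<close>

lemma koszul_diff_snoc:
  assumes J: "J \<subseteq> {..<length w}"
  shows "koszul_diff (w @ [v]) k r (insert (length w) J)
    = koszul_diff w k (\<lambda>J. r (insert (length w) J)) J + (-1) ^ card J * v ^ k * r J"
proof -
  let ?n = "length w"
  have n: "?n \<notin> J" "finite J" using J by (auto intro: finite_subset)
  have 1: "insert ?n J - {i} = insert ?n (J - {i})" "{j\<in>insert ?n J. j < i} = {j\<in>J. j < i}"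
      "(w @ [v]) ! i = w ! i" if "i \<in> J" for i
    using that J n by (auto simp: nth_append)
  have 2: "insert ?n J - {?n} = J" "{j\<in>insert ?n J. j < ?n} = J" using J n by auto
  have "koszul_diff (w @ [v]) k r (insert ?n J)
      = (\<Sum>i\<in>J. (-1) ^ card {j\<in>insert ?n J. j < i} * ((w @ [v]) ! i) ^ k * r (insert ?n J - {i}))
        + (-1) ^ card J * v ^ k * r J"
    using n unfolding koszul_diff_def by (simp add: 2[simplified])
  also have "(\<Sum>i\<in>J. (-1) ^ card {j\<in>insert ?n J. j < i} * ((w @ [v]) ! i) ^ k * r (insert ?n J - {i}))
      = koszul_diff w k (\<lambda>J. r (insert (length w) J)) J"
    unfolding koszul_diff_def by (intro sum.cong refl) (simp only: 1)
  finally show ?thesis .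
qed

lemma idx_prod_append:
  assumes "J \<subseteq> {..<length w}"
  shows "idx_prod (w @ w') J = idx_prod w J"
  using assms unfolding idx_prod_def by (intro prod.cong refl) (auto simp: nth_append)

lemma idx_prod_snoc:
  assumes "J \<subseteq> {..<length w}"
  shows "idx_prod (w @ [v]) (insert (length w) J) = v * idx_prod w J"
proof -
  have "length w \<notin> J" "finite J" using assms by (auto intro: finite_subset)
  then show ?thesis
    using idx_prod_append[OF assms, of "[v]"] by (simp add: idx_prod_def)
qed

lemma mult_set_append:
  assumes "J \<subseteq> {..<length w}"
  shows "mult_set (w @ w') J = mult_set w J"
proof -
  have "(\<Prod>j\<in>J. ((w @ w') ! j) ^ e j) = (\<Prod>j\<in>J. (w ! j) ^ e j)" for e :: "nat \<Rightarrow> nat"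
    using assms by (intro prod.cong refl) (auto simp: nth_append)
  then show ?thesis by (simp add: mult_set_def)
qed

lemma Kproj1_cfrac: "Kproj1 w p (cfrac (w @ w') p k r) = cfrac w p k r"
  unfolding Kproj1_def cfrac_def
  by (intro restrict_ext) (auto simp: Kidx_def mult_set_append idx_prod_append)

lemma Kidx_append: "J \<in> Kidx w p \<Longrightarrow> J \<in> Kidx (w @ w') p"
  by (auto simp: Kidx_def)

lemma Kidx_snoc_cases:
  assumes "J \<in> Kidx (w @ [v]) p"
  obtains "J \<in> Kidx w p"
  | q J' where "p = Suc q" "J = insert (length w) J'" "J' \<in> Kidx w q" "length w \<notin> J'"
proof (cases "length w \<in> J")
  case False
  with assms have "J \<in> Kidx w p"
    by (auto simp: Kidx_def less_Suc_eq)
  then show ?thesis by (rule that(1))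
next
  case True
  then have "card J > 0"
    using Kidx_memD(1)[OF assms] card_gt_0_iff by blast
  then obtain q where q: "p = Suc q"
    using Kidx_memD(3)[OF assms] by (metis Suc_pred)
  have "J - {length w} \<in> Kidx w q"
    using Kidx_remove[OF assms[unfolded q] True] by (auto simp: Kidx_def less_Suc_eq)
  with True q show ?thesis
    by (intro that(2)[of q "J - {length w}"]) auto
qed

text \<open>
  The new components of the lift live in \<open>K\<^sub>\<infinity>(w)[v\<^sup>-\<^sup>1]\<close>, where the given cocycle \<open>a / w\<^sub>J\<^sup>k\<close> is the
  boundary of \<open>v\<^sup>-\<^sup>L e / w\<^sub>J\<^sup>k\<close>.
\<close>

lemma cocycle_lift_snoc:
  assumes rad: "in_radical w v" and x: "x \<in> Kcocycles w p"
  shows "\<exists>z\<in>Kcocycles (w @ [v]) p. Kproj1 w p z = x"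
proof -
  let ?n = "length w"
  obtain k a where xa: "x = cfrac w p k a" and a: "\<forall>J\<in>Kidx w (Suc p). koszul_diff w k a J = 0"
    using cocycleE[OF x] by (auto dest: eventually_happens)
  obtain L e where e: "\<And>J. J \<in> Kidx w p \<Longrightarrow> v ^ L * a J = koszul_diff w k e J"
    using koszul_cocycle_exact[OF rad a] by blast
  \<comment> \<open>Over the denominator \<open>(v * idx_prod w J) ^ (k + L)\<close> the fraction
    \<open>e J / (v ^ L * idx_prod w J ^ k)\<close> has numerator
    \<open>v ^ k * idx_prod w J ^ L * e J\<close>. The sign cancels the \<open>(-1) ^ p\<close> from
    \<open>koszul_diff_snoc\<close>.\<close>
  define f where "f J = (-1) ^ Suc p * v ^ k * (idx_prod w J ^ L * e J)" for J
  define r where "r J = (if ?n \<in> J then f (J - {?n}) else idx_prod w J ^ L * a J)" for J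
  have "koszul_diff (w @ [v]) (k + L) r J = 0" if "J \<in> Kidx (w @ [v]) (Suc p)" for J
    using that
  proof (cases rule: Kidx_snoc_cases)
    case 1
    note J = Kidx_memD[OF 1]
    have "koszul_diff (w @ [v]) (k + L) r J = koszul_diff w (k + L) (\<lambda>J. idx_prod w J ^ L * a J) J"
      unfolding koszul_diff_append[OF J(2)] using J by (intro koszul_diff_cong) (auto simp: r_def)
    then show ?thesis using a 1 J by (simp add: koszul_diff_raise)
  next
    case (2 q J')
    note J = Kidx_memD[OF 2(3)]
    have "koszul_diff (w @ [v]) (k + L) r J
        = koszul_diff w (k + L) f J' + (-1) ^ p * v ^ (k + L) * (idx_prod w J' ^ L * a J')"
      using 2 J koszul_diff_cong[of J' "\<lambda>J. r (insert ?n J)" f w "k + L"]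
      by (auto simp: koszul_diff_snoc r_def)
    also have "koszul_diff w (k + L) f J' = (-1) ^ Suc p * v ^ k * (idx_prod w J' ^ L * (v ^ L * a J'))"
      unfolding f_def[abs_def] koszul_diff_scale
      using 2 J by (simp add: koszul_diff_raise e)
    finally show ?thesis
      by (simp add: power_add algebra_simps)
  qed
  then have z: "cfrac (w @ [v]) p (k + L) r \<in> Kcocycles (w @ [v]) p"
    by (intro cocycleI) blast
  have "cfrac w p (k + L) r = cfrac w p (k + L) (\<lambda>J. idx_prod w J ^ L * a J)"
    by (intro cfrac_cong) (auto simp: r_def Kidx_def)
  then have "Kproj1 w p (cfrac (w @ [v]) p (k + L) r) = x"
    by (simp add: xa Kproj1_cfrac cfrac_raise[of w p k a L])
  with z show ?thesis by blast
qed

text \<open>Injectivity on cohomology: once the contribution of a primitive of the projection is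
  subtracted, the components at sets containing the new index form a cocycle, which is a boundary
  after inverting \<open>v\<close>.\<close>

lemma coboundary_reflect_snoc:
  assumes rad: "in_radical w v" and z: "z \<in> Kcocycles (w @ [v]) (Suc q)"
    and cob: "Kproj1 w (Suc q) z \<in> Kcoboundaries w (Suc q)"
  shows "z \<in> Kcoboundaries (w @ [v]) (Suc q)"
proof -
  let ?n = "length w" and ?w = "w @ [v]" and ?p = "Suc q"
  from eventually_conj[OF cocycleE[OF z] coboundaryE[OF cob]]
  obtain k x a where zx: "z = cfrac ?w ?p k x"
    and x: "\<forall>J\<in>Kidx ?w (Suc ?p). koszul_diff ?w k x J = 0"
    and "Kproj1 w ?p z = cfrac w ?p k (koszul_diff w k a)"
    by (auto dest: eventually_happens)
  then have "cfrac w ?p k x = cfrac w ?p k (koszul_diff w k a)"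
    by (simp add: Kproj1_cfrac)
  from cfrac_eqD[OF this] obtain N where
    N: "\<forall>J\<in>Kidx w ?p. idx_prod w J ^ N * x J = idx_prod w J ^ N * koszul_diff w k a J"
    by (auto dest: eventually_happens)
  \<comment> \<open>At level \<open>k + N\<close> the equality of fractions becomes the equality
    \<open>yb\<close> of numerators.\<close>
  define K where "K = k + N"
  define y where "y J = idx_prod ?w J ^ N * x J" for J
  define b where "b J = idx_prod w J ^ N * a J" for J
  have zy: "z = cfrac ?w ?p K y"
    unfolding zx K_def y_def by (rule cfrac_raise)
  have y: "koszul_diff ?w K y J = 0" if "J \<in> Kidx ?w (Suc ?p)" for J
    using x that Kidx_memD(1)[OF that] by (simp add: K_def y_def[abs_def] koszul_diff_raise)
  have yb: "y J = koszul_diff w K b J" if "J \<in> Kidx w ?p" for J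
    using N that Kidx_memD(1,2)[OF that]
    by (simp add: K_def y_def b_def[abs_def] koszul_diff_raise idx_prod_append)
  \<comment> \<open>What remains of the new components after subtracting the contribution of
    \<open>b\<close>. It is a cocycle because \<open>y\<close> is one and
    \<open>koszul_diff w K b\<close> equals \<open>y\<close> on the old index sets.\<close>
  define c where "c J = y (insert ?n J) - (-1) ^ q * v ^ K * b J" for J
  have "koszul_diff w K c J = 0" if J: "J \<in> Kidx w ?p" for J
  proof -
    have sub: "J \<subseteq> {..<?n}" "finite J" "card J = ?p" using J by (auto dest: Kidx_memD)
    then have "insert ?n J \<in> Kidx ?w (Suc ?p)"
      by (auto simp: Kidx_def card_insert_if)
    then have "koszul_diff w K (\<lambda>J. y (insert ?n J)) J + (-1) ^ ?p * v ^ K * y J = 0"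
      using y koszul_diff_snoc[OF sub(1), of v K y] sub(3) by simp
    then show ?thesis
      by (simp add: c_def[abs_def] koszul_diff_diff koszul_diff_scale yb[OF J, symmetric])
  qed
  then obtain L e where e: "\<And>J. J \<in> Kidx w q \<Longrightarrow> v ^ L * c J = koszul_diff w K e J"
    using koszul_cocycle_exact[OF rad, of q K c] by blast
  \<comment> \<open>Raising the level by \<open>L\<close> multiplies a new component by
    \<open>(v * idx_prod w J) ^ L\<close>. Since \<open>v ^ L * c J\<close> is the differential of
    \<open>e\<close>, the factor left for \<open>f\<close> is
    \<open>idx_prod w J ^ L\<close>.\<close>
  define f where "f J = idx_prod w J ^ L * e J" for J
  define g where "g J = (if ?n \<in> J then f (J - {?n}) else idx_prod w J ^ L * b J)" for J
  have "idx_prod ?w J ^ L * y J = koszul_diff ?w (K + L) g J" if "J \<in> Kidx ?w ?p" for J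
    using that
  proof (cases rule: Kidx_snoc_cases)
    case 1
    note J = Kidx_memD[OF 1]
    have "koszul_diff ?w (K + L) g J = koszul_diff w (K + L) (\<lambda>J. idx_prod w J ^ L * b J) J"
      unfolding koszul_diff_append[OF J(2)] using J by (intro koszul_diff_cong) (auto simp: g_def)
    then show ?thesis using 1 J by (simp add: koszul_diff_raise yb idx_prod_append)
  next
    case (2 q' J')
    then have J': "J' \<in> Kidx w q" by simp
    note J = Kidx_memD[OF J']
    have "koszul_diff ?w (K + L) g J
        = koszul_diff w (K + L) f J' + (-1) ^ q * v ^ (K + L) * (idx_prod w J' ^ L * b J')"
      using 2 J koszul_diff_cong[of J' "\<lambda>J. g (insert ?n J)" f w "K + L"]
      by (auto simp: koszul_diff_snoc g_def)
    also have "koszul_diff w (K + L) f J' = idx_prod w J' ^ L * (v ^ L * c J')"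
      using J by (simp add: f_def[abs_def] koszul_diff_raise e[OF J'])
    finally show ?thesis
      using 2 J by (simp add: c_def idx_prod_snoc power_add power_mult_distrib algebra_simps)
  qed
  then have "z = cfrac ?w ?p (K + L) (koszul_diff ?w (K + L) g)"
    unfolding zy cfrac_raise[of ?w ?p K y L] by (rule cfrac_cong)
  then show ?thesis by (simp add: coboundaryI)
qed

section \<open>Appending a whole list of elements of the radical\<close>

lemma Kcocycles_extensional: "x \<in> Kcocycles w p \<Longrightarrow> x \<in> extensional (Kidx w p)"
  by (auto simp: Kcocycles_def Kmod_def PiE_def)

lemma Kproj1_append: "Kproj1 w p (Kproj1 (w @ w') p z) = Kproj1 w p z"
  unfolding Kproj1_def by (intro restrict_ext) (simp add: Kidx_append)

lemma Kproj1_cocycle: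
  assumes "z \<in> Kcocycles (w @ w') p"
  shows "Kproj1 w p z \<in> Kcocycles w p"
proof -
  obtain k r where "z = cfrac (w @ w') p k r"
    and r: "\<forall>J\<in>Kidx (w @ w') (Suc p). koszul_diff (w @ w') k r J = 0"
    using cocycleE[OF assms] by (auto dest: eventually_happens)
  moreover have "koszul_diff w k r J = 0" if "J \<in> Kidx w (Suc p)" for J
    using r that Kidx_append[OF that, of w'] koszul_diff_append[OF Kidx_memD(2)[OF that], of w'] by metis
  ultimately show ?thesis
    by (auto simp: Kproj1_cfrac intro: cocycleI)
qed

lemma cocycle_lift:
  assumes "\<forall>v\<in>set vs. in_radical w v" and "x \<in> Kcocycles w p"
  shows "\<exists>z\<in>Kcocycles (w @ vs) p. Kproj1 w p z = x"
  using assms(1)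
proof (induction vs rule: rev_induct)
  case Nil
  have "Kproj1 w p x = x"
    unfolding Kproj1_def using Kcocycles_extensional[OF assms(2)] by (rule extensional_restrict)
  then show ?case using assms(2) by auto
next
  case (snoc v vs)
  then obtain z where z: "z \<in> Kcocycles (w @ vs) p" "Kproj1 w p z = x" by auto
  moreover have "in_radical (w @ vs) v"
    using snoc.prems by (intro in_radical_append) simp
  ultimately obtain z' where "z' \<in> Kcocycles ((w @ vs) @ [v]) p" "Kproj1 (w @ vs) p z' = z"
    using cocycle_lift_snoc by blast
  then show ?case
    using z(2) Kproj1_append[of w p vs z'] by (metis append.assoc)
qed

text \<open>For positive \<open>p\<close> the elements are appended one at a time by
  \<open>coboundary_reflect_snoc\<close>. The premise on \<open>p = 0\<close> fits systems of
  parameters, which are empty when \<open>d = 0\<close>.\<close>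

lemma coboundary_reflect:
  assumes "\<forall>v\<in>set vs. in_radical w v" and "p = 0 \<longrightarrow> vs = []"
    and "z \<in> Kcocycles (w @ vs) p" and "Kproj1 w p z \<in> Kcoboundaries w p"
  shows "z \<in> Kcoboundaries (w @ vs) p"
  using assms
proof (induction vs arbitrary: z rule: rev_induct)
  case Nil
  have "Kproj1 w p z = z"
    unfolding Kproj1_def using Kcocycles_extensional Nil.prems(3) by (intro extensional_restrict) auto
  then show ?case using Nil.prems(4) by simp
next
  case (snoc v vs)
  obtain q where q: "p = Suc q" using snoc.prems(2) by (cases p) auto
  have z: "z \<in> Kcocycles ((w @ vs) @ [v]) p" using snoc.prems(3) by simp
  have "Kproj1 (w @ vs) p z \<in> Kcoboundaries (w @ vs) p"
    using snoc.prems Kproj1_cocycle[OF z] q by (intro snoc.IH) (auto simp: Kproj1_append)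
  moreover have "in_radical (w @ vs) v"
    using snoc.prems by (intro in_radical_append) simp
  ultimately have "z \<in> Kcoboundaries ((w @ vs) @ [v]) p"
    using coboundary_reflect_snoc z q by blast
  then show ?case by simp
qed

section \<open>Local cohomology of a system of parameters\<close>

text \<open>A common generalisation of \<open>Kproj1\<close> and \<open>Kproj2\<close>, which also
  covers the restriction from three concatenated sequences to the outer two.\<close>

definition Kpull :: "'a list \<Rightarrow> (nat \<Rightarrow> nat) \<Rightarrow> nat \<Rightarrow> 'a cochain \<Rightarrow> 'a cochain" where
  "Kpull u f p x = (\<lambda>J\<in>Kidx u p. x (f ` J))"

text \<open>Strict monotonicity preserves the order of the \<theta>s and with it the signs of the
  differential.\<close>

definition idx_emb :: "'a list \<Rightarrow> (nat \<Rightarrow> nat) \<Rightarrow> 'a list \<Rightarrow> bool" where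
  "idx_emb u f w \<longleftrightarrow> strict_mono_on {..<length u} f \<and>
     (\<forall>j<length u. f j < length w \<and> u ! j = w ! f j)"

lemma idx_emb_inj: "idx_emb u f w \<Longrightarrow> J \<subseteq> {..<length u} \<Longrightarrow> inj_on f J"
  unfolding idx_emb_def by (meson inj_on_subset strict_mono_on_imp_inj_on)

lemma idx_emb_Kidx:
  assumes "idx_emb u f w" "J \<in> Kidx u p"
  shows "f ` J \<in> Kidx w p"
  using assms idx_emb_inj[OF assms(1), of J]
  by (auto simp: Kidx_def idx_emb_def card_image)

lemma mult_set_emb:
  assumes f: "idx_emb u f w" and J: "J \<subseteq> {..<length u}"
  shows "mult_set u J = mult_set w (f ` J)"
proof -
  note inj = idx_emb_inj[OF f J]
  have eq: "(\<Prod>j\<in>f ` J. (w ! j) ^ e j) = (\<Prod>j\<in>J. (u ! j) ^ e (f j))" for e :: "nat \<Rightarrow> nat"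
    unfolding prod.reindex[OF inj] using f J by (intro prod.cong refl) (auto simp: idx_emb_def)
  have "(\<Prod>j\<in>J. (u ! j) ^ e j) = (\<Prod>j\<in>f ` J. (w ! j) ^ e (inv_into J f j))" for e :: "nat \<Rightarrow> nat"
    unfolding eq using inj by (intro prod.cong refl) simp
  with eq show ?thesis
    unfolding mult_set_def by (intro Collect_cong) metis
qed

lemma idx_prod_emb:
  assumes f: "idx_emb u f w" and J: "J \<subseteq> {..<length u}"
  shows "idx_prod u J = idx_prod w (f ` J)"
  unfolding idx_prod_def prod.reindex[OF idx_emb_inj[OF f J]]
  using f J by (intro prod.cong refl) (auto simp: idx_emb_def)

lemma Kpull_cfrac:
  assumes f: "idx_emb u f w"
  shows "Kpull u f p (cfrac w p k r) = cfrac u p k (\<lambda>J. r (f ` J))"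
  unfolding Kpull_def cfrac_def
  by (intro restrict_ext)
    (simp add: idx_emb_Kidx[OF f] mult_set_emb[OF f Kidx_memD(2)] idx_prod_emb[OF f Kidx_memD(2)])

text \<open>Removing an element from an image under \<open>f\<close> gives an image again, so
  restriction to such index sets is compatible with the differential.\<close>

lemma koszul_diff_emb:
  assumes f: "idx_emb u f w" and J: "J \<subseteq> {..<length u}"
  shows "koszul_diff u k (\<lambda>J. r (f ` J)) J = koszul_diff w k r (f ` J)"
  unfolding koszul_diff_def sum.reindex[OF idx_emb_inj[OF f J]] comp_def
proof (intro sum.cong refl)
  fix i assume i: "i \<in> J"
  have less: "f j < f i \<longleftrightarrow> j < i" if "j \<in> J" for j
    using f i J that strict_mono_on_less[of "{..<length u}" f j i] by (auto simp: idx_emb_def)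
  then have "{j \<in> f ` J. j < f i} = f ` {j\<in>J. j < i}"
    by auto
  then have "card {j \<in> f ` J. j < f i} = card {j\<in>J. j < i}"
    using J by (simp add: card_image idx_emb_inj[OF f] subset_iff)
  moreover have "f ` (J - {i}) = f ` J - {f i}"
    using inj_on_image_set_diff[OF idx_emb_inj[OF f J], of J "{i}"] i by auto
  moreover have "u ! i = w ! f i" using f i J by (auto simp: idx_emb_def)
  ultimately show "(-1) ^ card {j\<in>J. j < i} * (u ! i) ^ k * r (f ` (J - {i}))
      = (-1) ^ card {j \<in> f ` J. j < f i} * (w ! f i) ^ k * r (f ` J - {f i})"
    by simp
qed

lemma Kpull_cocycle:
  assumes f: "idx_emb u f w" and "z \<in> Kcocycles w p"
  shows "Kpull u f p z \<in> Kcocycles u p"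
proof -
  obtain k r where "z = cfrac w p k r" "\<forall>J\<in>Kidx w (Suc p). koszul_diff w k r J = 0"
    using cocycleE[OF assms(2)] by (auto dest: eventually_happens)
  then show ?thesis
    using idx_emb_Kidx[OF f]
    by (auto simp: Kpull_cfrac[OF f] koszul_diff_emb[OF f Kidx_memD(2)] intro!: cocycleI)
qed

lemma Kpull_coboundary:
  assumes f: "idx_emb u f w" and z: "z \<in> Kcoboundaries w p"
  shows "Kpull u f p z \<in> Kcoboundaries u p"
proof (cases p)
  case 0
  then have "z = cfrac w 0 0 (\<lambda>_. 0)"
    using z by (simp add: Kcoboundaries_def Kmod_zero[of w 0 0])
  then show ?thesis
    using 0 by (simp add: Kpull_cfrac[OF f] Kcoboundaries_def Kmod_zero[of u 0 0])
next
  case (Suc q)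
  then obtain k e where "z = cfrac w p k (koszul_diff w k e)"
    using z coboundaryE[of z w q] by (auto dest: eventually_happens)
  then have "Kpull u f p z = cfrac u p k (koszul_diff u k (\<lambda>J. e (f ` J)))"
    unfolding Kpull_cfrac[OF f]
    by (auto simp: Kpull_cfrac[OF f] koszul_diff_emb[OF f Kidx_memD(2)] intro!: cfrac_cong)
  then show ?thesis by (simp add: Suc coboundaryI)
qed

lemma Kpull_Kpull:
  assumes "idx_emb u g w"
  shows "Kpull u g p (Kpull w f p x) = Kpull u (\<lambda>j. f (g j)) p x"
  unfolding Kpull_def using idx_emb_Kidx[OF assms] by (intro restrict_ext) (simp add: image_image)

lemma Kpull_cong:
  assumes "\<And>j. j < length u \<Longrightarrow> f j = g j"
  shows "Kpull u f p x = Kpull u g p x"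
  unfolding Kpull_def
proof (intro restrict_ext)
  fix J assume "J \<in> Kidx u p"
  then have "f ` J = g ` J"
    using assms by (intro image_cong refl) (auto dest: Kidx_memD)
  then show "x (f ` J) = x (g ` J)" by simp
qed

section \<open>The two projections as restrictions\<close>

lemma Kproj1_eq_Kpull: "Kproj1 s p x = Kpull s (\<lambda>j. j) p x"
  by (simp add: Kproj1_def Kpull_def)

lemma Kproj2_eq_Kpull: "Kproj2 s t p x = Kpull t (\<lambda>j. length s + j) p x"
  by (simp add: Kproj2_def Kpull_def)

lemma idx_emb_left: "idx_emb s (\<lambda>j. j) (s @ t)"
  by (auto simp: idx_emb_def strict_mono_on_def nth_append)

lemma idx_emb_right: "idx_emb t (\<lambda>j. length s + j) (s @ t)"
  by (auto simp: idx_emb_def strict_mono_on_def)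

lemma idx_emb_outer: "idx_emb (s @ u) (\<lambda>j. if j < length s then j else j + length t) (s @ t @ u)"
  by (auto simp: idx_emb_def strict_mono_on_def nth_append)

lemma Kmod_common_level:
  assumes "x \<in> carrier (Kmod w p)" "y \<in> carrier (Kmod w p)"
  obtains k r r' where "x = cfrac w p k r" "y = cfrac w p k r'"
  using eventually_happens[OF eventually_conj[OF assms[THEN cfrac_surj]]] by auto

lemma Kpull_add:
  assumes f: "idx_emb u f w" and "x \<in> carrier (Kmod w p)" "y \<in> carrier (Kmod w p)"
  shows "Kpull u f p (x \<oplus>\<^bsub>Kmod w p\<^esub> y) = Kpull u f p x \<oplus>\<^bsub>Kmod u p\<^esub> Kpull u f p y"
proof -
  obtain k r r' where "x = cfrac w p k r" "y = cfrac w p k r'"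
    using Kmod_common_level[OF assms(2,3)] .
  then show ?thesis by (simp add: Kmod_add Kpull_cfrac[OF f])
qed

lemma Kpull_smult:
  assumes f: "idx_emb u f w" and "x \<in> carrier (Kmod w p)"
  shows "Kpull u f p (c \<odot>\<^bsub>Kmod w p\<^esub> x) = c \<odot>\<^bsub>Kmod u p\<^esub> Kpull u f p x"
proof -
  obtain k r where "x = cfrac w p k r"
    using Kmod_common_level[OF assms(2,2)] .
  then show ?thesis by (simp add: Kmod_smult Kpull_cfrac[OF f])
qed

section \<open>Cocycles, coboundaries and the module operations on cohomology\<close>

lemma Kmod_minus: "\<ominus>\<^bsub>Kmod w p\<^esub> cfrac w p k r = cfrac w p k (\<lambda>J. - r J)"
proof -
  interpret abelian_group "Kmod w p" by (rule abelian_group_Kmod)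
  show ?thesis
    by (rule minus_equality) (simp_all add: Kmod_add Kmod_zero[of w p k])
qed

lemma Kcocycles_carrier: "x \<in> Kcocycles w p \<Longrightarrow> x \<in> carrier (Kmod w p)"
  by (simp add: Kcocycles_def)

lemma Kcocycles_add:
  assumes "x \<in> Kcocycles w p" "y \<in> Kcocycles w p"
  shows "x \<oplus>\<^bsub>Kmod w p\<^esub> y \<in> Kcocycles w p"
proof -
  from eventually_happens[OF eventually_conj[OF assms[THEN cocycleE]]]
  obtain k r r' where "x = cfrac w p k r" "\<forall>J\<in>Kidx w (Suc p). koszul_diff w k r J = 0"
    "y = cfrac w p k r'" "\<forall>J\<in>Kidx w (Suc p). koszul_diff w k r' J = 0"
    by auto
  then show ?thesis
    by (auto simp: Kmod_add koszul_diff_add intro: cocycleI)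
qed

lemma Kcocycles_smult:
  assumes "x \<in> Kcocycles w p"
  shows "c \<odot>\<^bsub>Kmod w p\<^esub> x \<in> Kcocycles w p"
proof -
  obtain k r where "x = cfrac w p k r" "\<forall>J\<in>Kidx w (Suc p). koszul_diff w k r J = 0"
    using cocycleE[OF assms] by (auto dest: eventually_happens)
  then show ?thesis
    by (auto simp: Kmod_smult koszul_diff_scale intro: cocycleI)
qed

lemma additive_subgroup_coboundaries: "additive_subgroup (Kcoboundaries w p) (Kmod w p)"
proof -
  interpret abelian_group "Kmod w p" by (rule abelian_group_Kmod)
  have sub: "Kcoboundaries w p \<subseteq> carrier (Kmod w p)"
  proof (cases p)
    case 0
    then show ?thesis by (simp add: Kcoboundaries_def Kmod_zero[of w 0 0])
  next
    case (Suc q)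
    then show ?thesis
      by (auto dest!: coboundaryE eventually_happens)
  qed
  have zero: "\<zero>\<^bsub>Kmod w p\<^esub> \<in> Kcoboundaries w p"
  proof (cases p)
    case 0
    then show ?thesis by (simp add: Kcoboundaries_def)
  next
    case (Suc q)
    have "koszul_diff w 0 (\<lambda>_. 0) = (\<lambda>_. 0)" by (simp add: koszul_diff_def fun_eq_iff)
    then show ?thesis
      using coboundaryI[of w q 0 "\<lambda>_. 0"] by (simp add: Suc Kmod_zero[of w "Suc q" 0])
  qed
  \<comment> \<open>Closure under differences yields both negatives and sums.\<close>
  have diff: "x \<oplus>\<^bsub>Kmod w p\<^esub> (\<ominus>\<^bsub>Kmod w p\<^esub> y) \<in> Kcoboundaries w p"
    if "x \<in> Kcoboundaries w p" "y \<in> Kcoboundaries w p" for x y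
  proof (cases p)
    case 0
    then show ?thesis using that r_neg[OF zero_closed] by (simp add: Kcoboundaries_def)
  next
    case (Suc q)
    with eventually_happens[OF eventually_conj[OF that[unfolded Suc, THEN coboundaryE]]]
    obtain k e e' where "x = cfrac w p k (koszul_diff w k e)" "y = cfrac w p k (koszul_diff w k e')"
      by auto
    then have "x \<oplus>\<^bsub>Kmod w p\<^esub> (\<ominus>\<^bsub>Kmod w p\<^esub> y) = cfrac w p k (koszul_diff w k (\<lambda>J. e J - e' J))"
      by (simp add: Kmod_minus Kmod_add koszul_diff_diff[abs_def])
    then show ?thesis by (simp add: Suc coboundaryI)
  qed
  have minus: "\<ominus>\<^bsub>Kmod w p\<^esub> y \<in> Kcoboundaries w p" if "y \<in> Kcoboundaries w p" for y
    using diff[OF zero that] sub that by (simp add: subset_iff)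
  have add: "x \<oplus>\<^bsub>Kmod w p\<^esub> y \<in> Kcoboundaries w p"
    if "x \<in> Kcoboundaries w p" "y \<in> Kcoboundaries w p" for x y
    using diff[OF that(1) minus[OF that(2)]] sub that by (simp add: subset_iff)
  show ?thesis
    using sub zero add minus
    by (intro additive_subgroup.intro subgroup.intro) (auto simp: a_inv_def)
qed

lemma abelian_subgroup_coboundaries: "abelian_subgroup (Kcoboundaries w p) (Kmod w p)"
  by (intro abelian_subgroupI3 additive_subgroup_coboundaries abelian_group_Kmod)

text \<open>At a common level cochains are subtracted on numerators, so equality of cosets becomes a
  condition on one cochain.\<close>

lemma Kclass_eq_cfrac:
  "Kclass w p (cfrac w p k r) = Kclass w p (cfrac w p k r')
    \<longleftrightarrow> cfrac w p k (\<lambda>J. r J - r' J) \<in> Kcoboundaries w p"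
proof -
  interpret abelian_subgroup "Kcoboundaries w p" "Kmod w p"
    by (rule abelian_subgroup_coboundaries)
  have "cfrac w p k r \<in> Kclass w p (cfrac w p k r') \<longleftrightarrow>
      cfrac w p k (\<lambda>J. r J - r' J) \<in> Kcoboundaries w p"
    unfolding Kclass_def by (subst a_rcos_module) (simp_all add: Kmod_minus Kmod_add)
  moreover have "cfrac w p k r \<in> Kclass w p (cfrac w p k r') \<longleftrightarrow>
      Kclass w p (cfrac w p k r) = Kclass w p (cfrac w p k r')"
    unfolding Kclass_def
    using a_repr_independence[OF _ _ a_subgroup] a_rcos_self cfrac_carrier by metis
  ultimately show ?thesis by simp
qed

lemma Kclass_zero: "Kclass w p \<zero>\<^bsub>Kmod w p\<^esub> = Kcoboundaries w p"
proof -
  interpret abelian_subgroup "Kcoboundaries w p" "Kmod w p"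
    by (rule abelian_subgroup_coboundaries)
  show ?thesis
    unfolding Kclass_def by (rule a_coset_join2[OF _ a_subgroup]) simp_all
qed

lemma Kcohom_add:
  assumes "x \<in> carrier (Kmod w p)" "y \<in> carrier (Kmod w p)"
  shows "Kclass w p x \<oplus>\<^bsub>Kcohom w p\<^esub> Kclass w p y = Kclass w p (x \<oplus>\<^bsub>Kmod w p\<^esub> y)"
  using abelian_subgroup.a_rcos_sum[OF abelian_subgroup_coboundaries assms]
  by (simp add: Kcohom_def Kclass_def)

lemma Kcoboundaries_smult:
  assumes "x \<in> Kcoboundaries w p"
  shows "c \<odot>\<^bsub>Kmod w p\<^esub> x \<in> Kcoboundaries w p"
proof (cases p)
  case 0
  then show ?thesis
    using assms by (simp add: Kcoboundaries_def Kmod_zero[of w 0 0] Kmod_smult)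
next
  case (Suc q)
  then obtain k e where "x = cfrac w p k (koszul_diff w k e)"
    using assms coboundaryE[of x w q] by (auto dest: eventually_happens)
  then have "c \<odot>\<^bsub>Kmod w p\<^esub> x = cfrac w p k (koszul_diff w k (\<lambda>J. c * e J))"
    by (simp add: Kmod_smult koszul_diff_scale[abs_def])
  then show ?thesis by (simp add: Suc coboundaryI)
qed

text \<open>The scalar action on \<open>Kcohom\<close> is a union over the representatives of a
  class; its members agree because coboundaries are closed under scalars.\<close>

lemma Kcohom_smult:
  assumes x: "x \<in> carrier (Kmod w p)"
  shows "c \<odot>\<^bsub>Kcohom w p\<^esub> Kclass w p x = Kclass w p (c \<odot>\<^bsub>Kmod w p\<^esub> x)"
proof -
  interpret abelian_subgroup "Kcoboundaries w p" "Kmod w p"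
    by (rule abelian_subgroup_coboundaries)
  have "Kclass w p (c \<odot>\<^bsub>Kmod w p\<^esub> y) = Kclass w p (c \<odot>\<^bsub>Kmod w p\<^esub> x)" if y: "y \<in> Kclass w p x" for y
  proof -
    have "y \<in> carrier (Kmod w p)"
      using y x a_r_coset_subset_G[OF a_subset] unfolding Kclass_def by blast
    then obtain k r r' where xy: "y = cfrac w p k r" "x = cfrac w p k r'"
      using Kmod_common_level x by metis
    have "Kclass w p y = Kclass w p x"
      using y x a_repr_independence[OF _ _ a_subgroup] unfolding Kclass_def by metis
    then have "cfrac w p k (\<lambda>J. r J - r' J) \<in> Kcoboundaries w p"
      unfolding xy Kclass_eq_cfrac .
    from Kcoboundaries_smult[OF this, of c] show ?thesis
      unfolding xy Kmod_smult Kclass_eq_cfrac by (simp add: right_diff_distrib)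
  qed
  moreover have "x \<in> Kclass w p x"
    unfolding Kclass_def using x by (rule a_rcos_self)
  ultimately have "(\<Union>y\<in>Kclass w p x. Kclass w p (c \<odot>\<^bsub>Kmod w p\<^esub> y)) = Kclass w p (c \<odot>\<^bsub>Kmod w p\<^esub> x)"
    by blast
  then show ?thesis by (simp add: Kcohom_def)
qed

text \<open>Single-valuedness of the canonical graph: if the first projections of two cocycles have
  the same class, their difference is a coboundary on \<open>s @ t\<close> by
  \<open>coboundary_reflect\<close>, and so is its second projection.\<close>

lemma Kcanonical_iff:
  assumes rad: "\<forall>v\<in>set t. in_radical s v" "d = 0 \<longrightarrow> t = []" and z: "z \<in> Kcocycles (s @ t) d"
  shows "(Kclass s d (Kproj1 s d z), c) \<in> Kcanonical s t d \<longleftrightarrow> c = Kclass t d (Kproj2 s t d z)"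
proof
  assume "(Kclass s d (Kproj1 s d z), c) \<in> Kcanonical s t d"
  then obtain z' where z': "z' \<in> Kcocycles (s @ t) d"
    and eq: "Kclass s d (Kproj1 s d z') = Kclass s d (Kproj1 s d z)"
    and c: "c = Kclass t d (Kproj2 s t d z')"
    by (auto simp: Kcanonical_def)
  from eventually_happens[OF eventually_conj[OF cocycleE[OF z] cocycleE[OF z']]]
  obtain k r r' where r: "z = cfrac (s @ t) d k r" "\<forall>J\<in>Kidx (s @ t) (Suc d). koszul_diff (s @ t) k r J = 0"
    and r': "z' = cfrac (s @ t) d k r'" "\<forall>J\<in>Kidx (s @ t) (Suc d). koszul_diff (s @ t) k r' J = 0"
    by auto
  let ?y = "cfrac (s @ t) d k (\<lambda>J. r' J - r J)"
  have "?y \<in> Kcocycles (s @ t) d"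
    using r r' by (intro cocycleI) (simp add: koszul_diff_diff)
  moreover have "Kproj1 s d ?y \<in> Kcoboundaries s d"
    using eq by (simp add: r r' Kproj1_cfrac Kclass_eq_cfrac)
  ultimately have "?y \<in> Kcoboundaries (s @ t) d"
    using rad by (intro coboundary_reflect) auto
  from Kpull_coboundary[OF idx_emb_right this]
  have "Kclass t d (Kproj2 s t d z') = Kclass t d (Kproj2 s t d z)"
    by (simp add: Kproj2_eq_Kpull r r' Kpull_cfrac[OF idx_emb_right] Kclass_eq_cfrac)
  then show "c = Kclass t d (Kproj2 s t d z)" using c by simp
qed (use z in \<open>auto simp: Kcanonical_def\<close>)

section \<open>Ideals generated by lists, and systems of parameters\<close>

lemma ideal_combinations:
  fixes s :: "'a::comm_ring_1 list"
  shows "ideal {\<Sum>i<length s. b i * s ! i | b. True} (class_ring :: 'a ring)" (is "ideal ?I _")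
proof (rule idealI)
  have gen: "(\<Sum>i<length s. b i * s ! i) \<in> ?I" for b by blast
  have mult: "c * x \<in> ?I" if "x \<in> ?I" for c x
  proof -
    from that obtain b where "x = (\<Sum>i<length s. b i * s ! i)" by blast
    then have "c * x = (\<Sum>i<length s. (c * b i) * s ! i)"
      by (simp add: sum_distrib_left mult.assoc)
    then show ?thesis by (simp only: gen)
  qed
  have add: "x + y \<in> ?I" if "x \<in> ?I" "y \<in> ?I" for x y
  proof -
    from that obtain b b' where "x = (\<Sum>i<length s. b i * s ! i)" "y = (\<Sum>i<length s. b' i * s ! i)"
      by blast
    then have "x + y = (\<Sum>i<length s. (b i + b' i) * s ! i)"
      by (simp add: distrib_right sum.distrib)
    then show ?thesis by (simp only: gen)
  qed
  have zero: "0 \<in> ?I" using gen[of "\<lambda>_. 0"] by simp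
  show "ring (class_ring :: 'a ring)"
    using class_ring.ring_axioms .
  show "x \<otimes>\<^bsub>class_ring\<^esub> a \<in> ?I" "a \<otimes>\<^bsub>class_ring\<^esub> x \<in> ?I"
    if "a \<in> ?I" "x \<in> carrier (class_ring :: 'a ring)" for a x
    using mult[OF that(1), of x] by (simp_all add: mult.commute)
  show "subgroup ?I (add_monoid (class_ring :: 'a ring))"
  proof (rule subgroup.intro)
    fix x assume "x \<in> ?I"
    moreover have "inv\<^bsub>add_monoid (class_ring :: 'a ring)\<^esub> x = (-1) * x"
      using fun_cong[OF class_ring_simps(8), of x] unfolding a_inv_def by simp
    ultimately show "inv\<^bsub>add_monoid (class_ring :: 'a ring)\<^esub> x \<in> ?I"
      by (simp only: mult)
  qed (simp_all only: monoid.simps partial_object.simps ring.simps add zero subset_UNIV)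
qed

text \<open>\<open>genideal\<close> is the intersection of all ideals containing the generators, and
  the linear combinations form one of these.\<close>

lemma genideal_class_ringD:
  fixes s :: "'a::comm_ring_1 list"
  assumes "x \<in> genideal class_ring (set s)"
  shows "\<exists>b. x = (\<Sum>i<length s. b i * s ! i)"
proof -
  have "s ! i \<in> {\<Sum>i<length s. b i * s ! i | b. True}" if "i < length s" for i
    using that by (intro CollectI exI[of _ "\<lambda>j. if j = i then 1 else 0"]) (simp add: sum.remove[of _ i])
  then have "set s \<subseteq> {\<Sum>i<length s. b i * s ! i | b. True}"
    by (metis (no_types, lifting) in_set_conv_nth subsetI)
  then show ?thesis
    using assms ideal_combinations[of s] unfolding genideal_def by blast
qed

text \<open>Both sequences generate ideals with radical \<open>m\<close>, and \<open>v\<close> lies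
  in \<open>m\<close> as a generator of the second.\<close>

lemma sop_in_radical:
  assumes "sop m d s" "sop m d t" "v \<in> set t"
  shows "in_radical s v"
proof -
  have "v ^ 1 \<in> genideal class_ring (set t)"
    using assms(3) by (auto simp: genideal_def)
  then have "v \<in> m"
    using assms(2) unfolding sop_def by blast
  then obtain N where "v ^ N \<in> genideal class_ring (set s)"
    using assms(1) unfolding sop_def by blast
  then show ?thesis
    unfolding in_radical_def using genideal_class_ringD by blast
qed

section \<open>Independence of local cohomology classes of the system of parameters\<close>

lemma sop_Kcanonical:
  assumes "sop m d s" "sop m d t"
  shows "\<forall>v\<in>set t. in_radical s v" "d = 0 \<longrightarrow> t = []"
  using assms sop_in_radical[OF assms] by (auto simp: sop_def)

text \<open>Each side is a family over all systems of parameters, so \<open>s\<close> and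
  \<open>t\<close> have to be compared against an arbitrary third one.\<close>

lemma lc_class_eq:
  assumes s: "sop m d s" and t: "sop m d t" and z: "z \<in> Kcocycles (s @ t) d"
  shows "lc_class m d s (Kclass s d (Kproj1 s d z)) = lc_class m d t (Kclass t d (Kproj2 s t d z))"
proof -
  have "(Kclass s d (Kproj1 s d z), c) \<in> Kcanonical s u d
      \<longleftrightarrow> (Kclass t d (Kproj2 s t d z), c) \<in> Kcanonical t u d" if u: "sop m d u" for u c
  proof -
    \<comment> \<open>A lift \<open>y\<close> of \<open>z\<close> to \<open>K\<^sub>\<infinity>(s @ t @ u)\<close> restricts to both \<open>K\<^sub>\<infinity>(s @ u)\<close> and \<open>K\<^sub>\<infinity>(t @ u)\<close>.\<close>
    have "\<forall>v\<in>set u. in_radical (s @ t) v"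
      using sop_Kcanonical(1)[OF s u] in_radical_append by blast
    then obtain y where y: "y \<in> Kcocycles (s @ t @ u) d" and zy: "z = Kproj1 (s @ t) d y"
      using cocycle_lift[of u "s @ t" z d] z by (metis append.assoc)
    let ?f = "\<lambda>j. if j < length s then j else j + length t" and ?g = "\<lambda>j. length s + j"
    have f: "idx_emb (s @ u) ?f (s @ t @ u)" by (rule idx_emb_outer)
    have g: "idx_emb (t @ u) ?g (s @ t @ u)" by (rule idx_emb_right)
    note [simp] = Kproj1_eq_Kpull Kproj2_eq_Kpull Kpull_Kpull[OF idx_emb_left] Kpull_Kpull[OF idx_emb_right]
    have s1: "Kproj1 s d (Kpull (s @ u) ?f d y) = Kproj1 s d z"
      by (simp add: zy) (rule Kpull_cong, simp)
    have t1: "Kproj1 t d (Kpull (t @ u) ?g d y) = Kproj2 s t d z"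
      by (simp add: zy)
    have u1: "Kproj2 s u d (Kpull (s @ u) ?f d y) = Kproj2 t u d (Kpull (t @ u) ?g d y)"
      by simp (rule Kpull_cong, simp)
    show ?thesis
      using Kcanonical_iff[OF sop_Kcanonical[OF s u] Kpull_cocycle[OF f y], of c]
        Kcanonical_iff[OF sop_Kcanonical[OF t u] Kpull_cocycle[OF g y], of c]
      unfolding s1 t1 u1 by simp
  qed
  then show ?thesis
    by (auto simp: lc_class_def)
qed

text \<open>Evaluates a family at \<open>t\<close>: its value is the class of the second projection
  of any lift of \<open>x\<close> to \<open>s @ t\<close>. The pointwise operations are computed
  through such lifts.\<close>

lemma lc_class_lift:
  assumes s: "sop m d s" and t: "sop m d t" and x: "x \<in> Kcocycles s d"
  shows "\<exists>z\<in>Kcocycles (s @ t) d. Kproj1 s d z = x \<and>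
    (\<forall>c. (t, c) \<in> lc_class m d s (Kclass s d x) \<longleftrightarrow> c = Kclass t d (Kproj2 s t d z))"
proof -
  obtain z where z: "z \<in> Kcocycles (s @ t) d" "Kproj1 s d z = x"
    using cocycle_lift[OF sop_Kcanonical(1)[OF s t] x] by blast
  show ?thesis
    using Kcanonical_iff[OF sop_Kcanonical[OF s t] z(1)] z t
    by (auto simp: lc_class_def)
qed

lemma lc_class_sop: "(t, c) \<in> lc_class m d s b \<Longrightarrow> sop m d t"
  by (simp add: lc_class_def)

text \<open>Lifts to \<open>s @ t\<close> may be added before projecting, since both projections are
  additive.\<close>

lemma lc_class_add:
  assumes s: "sop m d s" and x: "x \<in> Kcocycles s d" "y \<in> Kcocycles s d"
  shows "lc_class m d s (Kclass s d x) \<oplus>\<^bsub>local_cohomology m d\<^esub> lc_class m d s (Kclass s d y)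
    = lc_class m d s (Kclass s d (x \<oplus>\<^bsub>Kmod s d\<^esub> y))"
proof -
  have "(\<exists>c c'. b = c \<oplus>\<^bsub>Kcohom t d\<^esub> c' \<and> (t, c) \<in> lc_class m d s (Kclass s d x)
        \<and> (t, c') \<in> lc_class m d s (Kclass s d y))
      \<longleftrightarrow> (t, b) \<in> lc_class m d s (Kclass s d (x \<oplus>\<^bsub>Kmod s d\<^esub> y))" if t: "sop m d t" for t b
  proof -
    obtain z where z: "z \<in> Kcocycles (s @ t) d" "Kproj1 s d z = x"
      "\<And>c. (t, c) \<in> lc_class m d s (Kclass s d x) \<longleftrightarrow> c = Kclass t d (Kproj2 s t d z)"
      using lc_class_lift[OF s t x(1)] by blast
    obtain z' where z': "z' \<in> Kcocycles (s @ t) d" "Kproj1 s d z' = y"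
      "\<And>c. (t, c) \<in> lc_class m d s (Kclass s d y) \<longleftrightarrow> c = Kclass t d (Kproj2 s t d z')"
      using lc_class_lift[OF s t x(2)] by blast
    have "Kproj1 s d (z \<oplus>\<^bsub>Kmod (s @ t) d\<^esub> z') = x \<oplus>\<^bsub>Kmod s d\<^esub> y"
      using z z' by (simp add: Kproj1_eq_Kpull Kpull_add[OF idx_emb_left] Kcocycles_carrier)
    moreover have "Kproj2 s t d (z \<oplus>\<^bsub>Kmod (s @ t) d\<^esub> z')
        = Kproj2 s t d z \<oplus>\<^bsub>Kmod t d\<^esub> Kproj2 s t d z'"
      using z z' by (simp add: Kproj2_eq_Kpull Kpull_add[OF idx_emb_right] Kcocycles_carrier)
    ultimately have "(t, b) \<in> lc_class m d s (Kclass s d (x \<oplus>\<^bsub>Kmod s d\<^esub> y))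
        \<longleftrightarrow> b = Kclass t d (Kproj2 s t d z \<oplus>\<^bsub>Kmod t d\<^esub> Kproj2 s t d z')"
      using Kcanonical_iff[OF sop_Kcanonical[OF s t] Kcocycles_add[OF z(1) z'(1)], of b] t
      by (simp add: lc_class_def)
    then show ?thesis
      using z(3) z'(3) Kcohom_add[OF Kcocycles_carrier[OF Kpull_cocycle[OF idx_emb_right z(1)]]
          Kcocycles_carrier[OF Kpull_cocycle[OF idx_emb_right z'(1)]]]
      by (simp add: Kproj2_eq_Kpull)
  qed
  then show ?thesis
    by (auto simp: local_cohomology_def dest: lc_class_sop) (metis lc_class_sop)+
qed

lemma lc_class_smult:
  assumes s: "sop m d s" and x: "x \<in> Kcocycles s d"
  shows "r \<odot>\<^bsub>local_cohomology m d\<^esub> lc_class m d s (Kclass s d x)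
    = lc_class m d s (Kclass s d (r \<odot>\<^bsub>Kmod s d\<^esub> x))"
proof -
  have "(\<exists>c. b = r \<odot>\<^bsub>Kcohom t d\<^esub> c \<and> (t, c) \<in> lc_class m d s (Kclass s d x))
      \<longleftrightarrow> (t, b) \<in> lc_class m d s (Kclass s d (r \<odot>\<^bsub>Kmod s d\<^esub> x))" if t: "sop m d t" for t b
  proof -
    obtain z where z: "z \<in> Kcocycles (s @ t) d" "Kproj1 s d z = x"
      "\<And>c. (t, c) \<in> lc_class m d s (Kclass s d x) \<longleftrightarrow> c = Kclass t d (Kproj2 s t d z)"
      using lc_class_lift[OF s t x] by blast
    have "Kproj1 s d (r \<odot>\<^bsub>Kmod (s @ t) d\<^esub> z) = r \<odot>\<^bsub>Kmod s d\<^esub> x"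
      using z by (simp add: Kproj1_eq_Kpull Kpull_smult[OF idx_emb_left] Kcocycles_carrier)
    moreover have "Kproj2 s t d (r \<odot>\<^bsub>Kmod (s @ t) d\<^esub> z) = r \<odot>\<^bsub>Kmod t d\<^esub> Kproj2 s t d z"
      using z by (simp add: Kproj2_eq_Kpull Kpull_smult[OF idx_emb_right] Kcocycles_carrier)
    ultimately have "(t, b) \<in> lc_class m d s (Kclass s d (r \<odot>\<^bsub>Kmod s d\<^esub> x))
        \<longleftrightarrow> b = Kclass t d (r \<odot>\<^bsub>Kmod t d\<^esub> Kproj2 s t d z)"
      using Kcanonical_iff[OF sop_Kcanonical[OF s t] Kcocycles_smult[OF z(1)], of r b] t
      by (simp add: lc_class_def)
    then show ?thesis
      using z(3) Kcohom_smult[OF Kcocycles_carrier[OF Kpull_cocycle[OF idx_emb_right z(1)]], of r]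
      by (simp add: Kproj2_eq_Kpull)
  qed
  then show ?thesis
    by (auto simp: local_cohomology_def dest: lc_class_sop) (metis lc_class_sop)+
qed

section \<open>Generalised fractions\<close>

text \<open>The class of \<open>a\<close> over the \<open>k\<close>-th power of the product of
  \<open>s\<close>, without the normalising sign of \<open>gen_frac\<close>. The exponent varies so
  that every element of local cohomology has this form.\<close>

definition lc_frac :: "'a::comm_ring_1 set \<Rightarrow> nat \<Rightarrow> 'a list \<Rightarrow> nat \<Rightarrow> 'a \<Rightarrow> 'a lc_elt" where
  "lc_frac m d s k a = lc_class m d s (Kclass s d (cfrac s d k (\<lambda>_. a)))"

lemma Kidx_top: "length s = d \<Longrightarrow> Kidx s d = {{..<d}}"
  by (auto simp: Kidx_def) (metis card_lessThan card_subset_eq finite_lessThan lessThan_iff)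

lemma Kidx_above: "length s = d \<Longrightarrow> Kidx s (Suc d) = {}"
  by (auto simp: Kidx_def dest: card_mono[rotated])

lemma sop_length: "sop m d s \<Longrightarrow> length s = d"
  by (simp add: sop_def)

text \<open>No index set has \<open>Suc d\<close> elements, so the cocycle condition is
  vacuous.\<close>

lemma cocycle_top:
  "length s = d \<Longrightarrow> cfrac s d k r \<in> Kcocycles s d"
  by (intro cocycleI) (simp add: Kidx_above)

lemma lc_frac_carrier:
  assumes s: "sop m d s"
  shows "lc_frac m d s k a \<in> carrier (local_cohomology m d)"
proof -
  have "Kclass s d (cfrac s d k (\<lambda>_. a)) \<in> carrier (Kcohom s d)"
    using cocycle_top[OF sop_length[OF s]] by (simp add: Kcohom_def)
  then show ?thesis
    using s by (auto simp: local_cohomology_def lc_frac_def)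
qed

text \<open>A class given over another system is transported to \<open>s\<close> through a lift to
  the concatenation; in top degree there is one index set, so a cochain is a single
  fraction.\<close>

lemma carrier_lc_frac:
  assumes s: "sop m d s" and A: "A \<in> carrier (local_cohomology m d)"
  shows "\<forall>\<^sub>F k in sequentially. \<exists>a. A = lc_frac m d s k a"
proof -
  obtain s' x where s': "sop m d s'" and x: "x \<in> Kcocycles s' d" "A = lc_class m d s' (Kclass s' d x)"
    using A by (auto simp: local_cohomology_def Kcohom_def)
  obtain z where z: "z \<in> Kcocycles (s' @ s) d" "Kproj1 s' d z = x"
    using cocycle_lift[OF sop_Kcanonical(1)[OF s' s] x(1)] by blast
  have A: "A = lc_class m d s (Kclass s d (Kproj2 s' s d z))"
    using lc_class_eq[OF s' s z(1)] z(2) x(2) by simp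
  have "Kproj2 s' s d z \<in> carrier (Kmod s d)"
    unfolding Kproj2_eq_Kpull by (intro Kcocycles_carrier Kpull_cocycle[OF idx_emb_right] z(1))
  from cfrac_surj[OF this] show ?thesis
  proof eventually_elim
    case (elim k)
    then obtain r where r: "Kproj2 s' s d z = cfrac s d k r" by blast
    also have "\<dots> = cfrac s d k (\<lambda>_. r {..<d})"
      by (rule cfrac_cong) (simp add: Kidx_top[OF sop_length[OF s]])
    finally show ?case
      using A by (auto simp: lc_frac_def)
  qed
qed

lemma lc_frac_add:
  "sop m d s \<Longrightarrow> lc_frac m d s k a \<oplus>\<^bsub>local_cohomology m d\<^esub> lc_frac m d s k b = lc_frac m d s k (a + b)"
  unfolding lc_frac_def by (simp add: lc_class_add cocycle_top sop_length Kmod_add)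

lemma lc_frac_smult:
  "sop m d s \<Longrightarrow> c \<odot>\<^bsub>local_cohomology m d\<^esub> lc_frac m d s k a = lc_frac m d s k (c * a)"
  unfolding lc_frac_def by (simp add: lc_class_smult cocycle_top sop_length Kmod_smult)

lemma lc_frac_zero:
  assumes s: "sop m d s"
  shows "\<zero>\<^bsub>local_cohomology m d\<^esub> = lc_frac m d s k 0"
proof -
  have "(t, c) \<in> lc_frac m d s k 0 \<longleftrightarrow> c = \<zero>\<^bsub>Kcohom t d\<^esub>" if t: "sop m d t" for t c
  proof -
    have "cfrac (s @ t) d k (\<lambda>_. 0) \<in> Kcocycles (s @ t) d"
      by (intro cocycleI) (simp add: koszul_diff_def)
    from Kcanonical_iff[OF sop_Kcanonical[OF s t] this, of c] show ?thesis
      using t unfolding Kproj1_cfrac Kproj2_eq_Kpull Kpull_cfrac[OF idx_emb_right]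
      by (simp add: lc_frac_def lc_class_def Kmod_zero[symmetric] Kclass_zero Kcohom_def)
  qed
  then show ?thesis
    by (auto simp: local_cohomology_def) (auto simp: lc_frac_def dest: lc_class_sop)
qed

text \<open>Any three elements are fractions over the same \<open>s\<close> at a common level, where
  addition is that of numerators.\<close>

lemma abelian_monoid_local_cohomology:
  assumes s: "sop m d s"
  shows "abelian_monoid (local_cohomology m d)"
proof (rule abelian_monoidI)
  fix x y z
  assume "x \<in> carrier (local_cohomology m d)" "y \<in> carrier (local_cohomology m d)"
    "z \<in> carrier (local_cohomology m d)"
  then have "\<forall>\<^sub>F k in sequentially. (\<exists>a. x = lc_frac m d s k a) \<and> (\<exists>a. y = lc_frac m d s k a)
      \<and> (\<exists>a. z = lc_frac m d s k a)"
    by (intro eventually_conj carrier_lc_frac[OF s])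
  then obtain k a b c where x: "x = lc_frac m d s k a" "y = lc_frac m d s k b" "z = lc_frac m d s k c"
    by (auto dest: eventually_happens)
  show "x \<oplus>\<^bsub>local_cohomology m d\<^esub> y \<in> carrier (local_cohomology m d)"
    by (simp add: x lc_frac_add[OF s] lc_frac_carrier[OF s])
  show "x \<oplus>\<^bsub>local_cohomology m d\<^esub> y \<oplus>\<^bsub>local_cohomology m d\<^esub> z
      = x \<oplus>\<^bsub>local_cohomology m d\<^esub> (y \<oplus>\<^bsub>local_cohomology m d\<^esub> z)"
    by (simp add: x lc_frac_add[OF s] add.assoc)
  show "x \<oplus>\<^bsub>local_cohomology m d\<^esub> y = y \<oplus>\<^bsub>local_cohomology m d\<^esub> x"
    by (simp add: x lc_frac_add[OF s] add.commute)
  show "\<zero>\<^bsub>local_cohomology m d\<^esub> \<oplus>\<^bsub>local_cohomology m d\<^esub> x = x"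
    by (simp add: x lc_frac_add[OF s] lc_frac_zero[OF s, of k])
next
  show "\<zero>\<^bsub>local_cohomology m d\<^esub> \<in> carrier (local_cohomology m d)"
    by (simp add: lc_frac_zero[OF s, of 0] lc_frac_carrier[OF s])
qed

section \<open>Arithmetic of generalised fractions over a fixed system of parameters\<close>

lemma gen_frac_eq_lc_frac:
  assumes s: "sop m d s"
  shows "gen_frac m d a s = lc_frac m d s 1 ((-1) ^ d * a)"
proof -
  note len = sop_length[OF s]
  have "(\<lambda>J\<in>Kidx s d. lfrac (mult_set s J) a (prod_list s)) = cfrac s d 1 (\<lambda>_. a)"
    unfolding cfrac_def Kidx_top[OF len]
    by (intro restrict_ext) (simp add: idx_prod_def prod.list_conv_set_nth len atLeast0LessThan)
  then show ?thesis
    by (simp add: gen_frac_def lc_frac_def Kcohom_smult Kmod_smult)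
qed

lemma gen_frac_smult:
  "sop m d s \<Longrightarrow> c \<odot>\<^bsub>local_cohomology m d\<^esub> gen_frac m d a s = gen_frac m d (c * a) s"
  by (simp add: gen_frac_eq_lc_frac lc_frac_smult algebra_simps)

lemma gen_frac_carrier: "sop m d s \<Longrightarrow> gen_frac m d a s \<in> carrier (local_cohomology m d)"
  by (simp add: gen_frac_eq_lc_frac lc_frac_carrier)

lemma gen_frac_add:
  "sop m d s \<Longrightarrow> gen_frac m d a s \<oplus>\<^bsub>local_cohomology m d\<^esub> gen_frac m d b s = gen_frac m d (a + b) s"
  by (simp add: gen_frac_eq_lc_frac lc_frac_add algebra_simps)

lemma gen_frac_finsum:
  assumes s: "sop m d s" and A: "finite A"
  shows "(\<Oplus>\<^bsub>local_cohomology m d\<^esub>i\<in>A. gen_frac m d (f i) s) = gen_frac m d (\<Sum>i\<in>A. f i) s"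
proof -
  interpret abelian_monoid "local_cohomology m d"
    by (rule abelian_monoid_local_cohomology[OF s])
  from A show ?thesis
  proof (induction A)
    case empty
    show ?case by (simp add: gen_frac_eq_lc_frac[OF s] lc_frac_zero[OF s])
  next
    case (insert i A)
    then show ?case
      by (subst finsum_insert) (auto simp: gen_frac_carrier[OF s] gen_frac_add[OF s])
  qed
qed

text \<open>In the fraction with numerator \<open>s ! i * c i\<close> the factor
  \<open>s ! i\<close> cancels, so the fraction comes from degree \<open>d - 1\<close>, from the
  component at the complement of \<open>i\<close>. The difference is therefore a coboundary.\<close>

lemma gen_frac_cong_ideal:
  assumes s: "sop m d s" and ab: "a - b = (\<Sum>i<d. s ! i * c i)"
  shows "gen_frac m d a s = gen_frac m d b s"
proof -
  note len = sop_length[OF s]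
  have "cfrac s d 1 (\<lambda>_. (-1) ^ d * a - (-1) ^ d * b) \<in> Kcoboundaries s d"
  proof (cases d)
    case 0
    \<comment> \<open>For \<open>d = 0\<close> the sum is empty, so \<open>a = b\<close>.\<close>
    then show ?thesis
      using ab by (simp add: Kcoboundaries_def Kmod_zero[of s 0 1])
  next
    case (Suc q)
    \<comment> \<open>At \<open>J = {..<d} - {i}\<close> the inner sum reduces to
      \<open>(-1) ^ i * c i\<close>, whose sign cancels that of the differential;
      \<open>(-1) ^ d\<close> is the normalisation of \<open>gen_frac\<close>.\<close>
    define e where "e J = (-1) ^ d * (\<Sum>i\<in>{..<d} - J. (-1) ^ i * c i)" for J
    have "koszul_diff s 1 e {..<d} = (-1) ^ d * a - (-1) ^ d * b"
    proof -
      have "koszul_diff s 1 e {..<d} = (\<Sum>i<d. (-1) ^ d * (s ! i * c i))"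
        unfolding koszul_diff_def
      proof (intro sum.cong refl)
        fix i assume i: "i \<in> {..<d}"
        then have "{j\<in>{..<d}. j < i} = {..<i}" "{..<d} - ({..<d} - {i}) = {i}"
          by auto
        then show "(-1) ^ card {j\<in>{..<d}. j < i} * (s ! i) ^ 1 * e ({..<d} - {i}) = (-1) ^ d * (s ! i * c i)"
          by (simp add: e_def algebra_simps)
      qed
      then show ?thesis
        by (simp add: sum_distrib_left[symmetric] ab[symmetric] right_diff_distrib)
    qed
    then have "cfrac s d 1 (\<lambda>_. (-1) ^ d * a - (-1) ^ d * b) = cfrac s d 1 (koszul_diff s 1 e)"
      by (intro cfrac_cong) (simp add: Kidx_top[OF len])
    then show ?thesis
      using coboundaryI[of s q 1 e] by (simp add: Suc)
  qed
  then show ?thesis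
    unfolding gen_frac_eq_lc_frac[OF s] lc_frac_def
    by (intro arg_cong[where f = "lc_class m d s"]) (simp only: Kclass_eq_cfrac)
qed

text \<open>The numerators \<open>r\<close> over first powers define a cocycle of
  \<open>s @ t\<close>; each projection retains one index set, \<open>{..<d}\<close> or
  \<open>{d..<2 * d}\<close>.\<close>

lemma gen_frac_transfer:
  assumes s: "sop m d s" and t: "sop m d t"
    and r: "\<And>J. J \<subseteq> {..<2 * d} \<Longrightarrow> card J = Suc d \<Longrightarrow> koszul_diff (s @ t) 1 r J = 0"
  shows "gen_frac m d (r {..<d}) s = gen_frac m d (r {d..<2 * d}) t"
proof -
  note len = sop_length[OF s] sop_length[OF t]
  let ?r = "\<lambda>J. (-1) ^ d * r J"
  have z: "cfrac (s @ t) d 1 ?r \<in> Kcocycles (s @ t) d"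
    using r len by (intro cocycleI) (auto simp: koszul_diff_scale Kidx_def mult_2)
  have img: "(+) d ` {..<d} = {d..<2 * d}"
    using image_add_atLeastLessThan[of d 0 d] by (simp add: mult_2 atLeast0LessThan)
  have "cfrac s d 1 (\<lambda>_. (-1) ^ d * r {..<d}) = cfrac s d 1 ?r"
    by (rule cfrac_cong) (simp add: Kidx_top len)
  moreover have "cfrac t d 1 (\<lambda>_. (-1) ^ d * r {d..<2 * d}) = cfrac t d 1 (\<lambda>J. ?r ((+) d ` J))"
    by (rule cfrac_cong) (simp add: Kidx_top len img)
  moreover have "Kproj2 s t d (cfrac (s @ t) d 1 ?r) = cfrac t d 1 (\<lambda>J. ?r ((+) d ` J))"
    using Kpull_cfrac[OF idx_emb_right[of t s], of d 1 ?r] len by (simp add: Kproj2_eq_Kpull)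
  ultimately show ?thesis
    using lc_class_eq[OF s t z]
    by (simp add: gen_frac_eq_lc_frac s t lc_frac_def Kproj1_cfrac)
qed

section \<open>Traces of composites of homotopies\<close>

lemma mat_assoc:
  fixes A B C :: "'a::comm_ring_1 mat"
  assumes "dim_col A = dim_row B" "dim_col B = dim_row C"
  shows "A * B * C = A * (B * C)"
  using assms by (intro assoc_mult_mat[of _ "dim_row A" "dim_col A" _ "dim_col B" _ "dim_col C"]) auto

lemma mat_trace_comm:
  fixes A B :: "'a::comm_ring_1 mat"
  assumes "dim_row A = dim_col B" "dim_col A = dim_row B"
  shows "mat_trace (A * B) = mat_trace (B * A)"
proof -
  have "mat_trace (A * B) = (\<Sum>k<dim_row A. \<Sum>l<dim_row B. A $$ (k, l) * B $$ (l, k))"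
    using assms by (simp add: mat_trace_def scalar_prod_def atLeast0LessThan)
  also have "\<dots> = (\<Sum>l<dim_row B. \<Sum>k<dim_row A. B $$ (l, k) * A $$ (k, l))"
    by (subst sum.swap) (simp add: mult.commute)
  also have "\<dots> = mat_trace (B * A)"
    using assms by (simp add: mat_trace_def scalar_prod_def atLeast0LessThan)
  finally show ?thesis .
qed

lemma mat_trace_add:
  "dim_row A = dim_row B \<Longrightarrow> dim_col A = dim_row A \<Longrightarrow> dim_col B = dim_row B \<Longrightarrow>
    mat_trace (A + B) = mat_trace A + mat_trace B"
  by (simp add: mat_trace_def sum.distrib)

lemma mat_trace_smult: "dim_col A = dim_row A \<Longrightarrow> mat_trace (c \<cdot>\<^sub>m A) = c * mat_trace A"
  by (simp add: mat_trace_def sum_distrib_left)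

lemma mat_trace_zero [simp]: "mat_trace (0\<^sub>m n n) = 0"
  by (simp add: mat_trace_def)

section \<open>Differentials and ordered products of homotopies\<close>

definition free_complex :: "'a::comm_ring_1 free_complex \<Rightarrow> bool" where
  "free_complex X \<longleftrightarrow> (\<forall>i. diff X i \<in> carrier_mat (rk X (i + 1)) (rk X i)) \<and>
     (\<forall>i. diff X (i + 1) * diff X i = 0\<^sub>m (rk X (i + 2)) (rk X i))"

lemma acyclic_free_complexD: "acyclic_free_complex X \<Longrightarrow> free_complex X"
  by (simp add: acyclic_free_complex_def free_complex_def)

lemma diff_carrier:
  "free_complex X \<Longrightarrow> j = i + 1 \<Longrightarrow> diff X i \<in> carrier_mat (rk X j) (rk X i)"
  by (simp add: free_complex_def)

lemma diff_diff:
  "free_complex X \<Longrightarrow> j = i + 1 \<Longrightarrow> diff X j * diff X i = 0\<^sub>m (rk X (i + 2)) (rk X i)"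
  by (simp add: free_complex_def)

lemma null_homotopies_Cons:
  "null_homotopies X (a # ts) (h # hs) \<longleftrightarrow>
    (\<forall>i. h i \<in> carrier_mat (rk X (i - 1)) (rk X i) \<and>
      h (i + 1) * diff X i + diff X (i - 1) * h i = a \<cdot>\<^sub>m 1\<^sub>m (rk X i)) \<and>
    null_homotopies X ts hs"
  by (auto simp: null_homotopies_def All_less_Suc2)

lemma null_homotopies_carrier:
  "null_homotopies X ts hs \<Longrightarrow> h \<in> set hs \<Longrightarrow> h i \<in> carrier_mat (rk X (i - 1)) (rk X i)"
  by (auto simp: null_homotopies_def in_set_conv_nth)

lemma htpy_comp_carrier:
  assumes "\<And>h i. h \<in> set hs \<Longrightarrow> h i \<in> carrier_mat (rk X (i - 1)) (rk X i)"
  shows "htpy_comp X hs i \<in> carrier_mat (rk X (i - int (length hs))) (rk X i)"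
  using assms
proof (induction hs)
  case (Cons h hs)
  then have "h (i - int (length hs)) \<in> carrier_mat (rk X (i - int (length hs) - 1)) (rk X (i - int (length hs)))"
    "htpy_comp X hs i \<in> carrier_mat (rk X (i - int (length hs))) (rk X i)"
    by simp_all
  moreover have "i - int (length (h # hs)) = i - int (length hs) - 1" by simp
  ultimately show ?case
    by (simp only: htpy_comp.simps mult_carrier_mat)
qed simp

lemma length_nths_card: "J \<subseteq> {..<length xs} \<Longrightarrow> length (nths xs J) = card J"
  by (simp add: length_nths) (intro arg_cong[where f = card]; auto)

lemma htpy_comp_nths_carrier:
  assumes "null_homotopies X ts hs" "J \<subseteq> {..<length hs}" "j = i - int (card J)"
  shows "htpy_comp X (nths hs J) i \<in> carrier_mat (rk X j) (rk X i)"
  using htpy_comp_carrier[of "nths hs J" X i] assms null_homotopies_carrier[OF assms(1)]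
  by (auto simp: length_nths_card dest: in_set_nthsD)

text \<open>
  The commutator of \<open>\<partial>\<close> with a product of homotopies, tested against a matrix \<open>A\<close> so that no sums of
  matrices of varying size occur.
\<close>

lemma trace_htpy_comp:
  fixes X :: "'a::comm_ring_1 free_complex"
  assumes X: "free_complex X"
    and "null_homotopies X ts hs" "J \<subseteq> {..<length hs}"
    and "A \<in> carrier_mat (rk X i) (rk X (i - int (card J) + 1))"
  shows "mat_trace (A * (diff X (i - int (card J)) * htpy_comp X (nths hs J) i))
    - (-1) ^ card J * mat_trace (A * (htpy_comp X (nths hs J) (i + 1) * diff X i))
    = (\<Sum>k\<in>J. (-1) ^ card {j\<in>J. j < k} * ts ! k * mat_trace (A * htpy_comp X (nths hs (J - {k})) i))"
  using assms(2-)
proof (induction hs arbitrary: ts J A)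
  case Nil
  then show ?case
    using diff_carrier[OF X refl, of i] by simp
next
  case (Cons h hs ts' J A)
  obtain a ts where ts': "ts' = a # ts"
    using Cons.prems(1) by (cases ts') (auto simp: null_homotopies_def)
  have hs: "null_homotopies X ts hs"
    and h: "\<And>i. h i \<in> carrier_mat (rk X (i - 1)) (rk X i)"
    and null: "\<And>i. h (i + 1) * diff X i + diff X (i - 1) * h i = a \<cdot>\<^sub>m 1\<^sub>m (rk X i)"
    using Cons.prems(1) by (auto simp: ts' null_homotopies_Cons)
  \<comment> \<open>The induction splits off \<open>h\<close>, which is applied last;
    \<open>J'\<close> holds the positions of \<open>J\<close> in the tail, shifted down by
    one.\<close>
  define J' where "J' = {j. Suc j \<in> J}"
  have J': "J' \<subseteq> {..<length hs}" using Cons.prems(2) by (auto simp: J'_def)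
  then have fin: "finite J'" by (rule finite_subset) simp
  have rem: "{j. Suc j \<in> J - {Suc k}} = J' - {k}" for k by (auto simp: J'_def)
  show ?case
  proof (cases "0 \<in> J")
    case False
    have J: "J = Suc ` J'"
    proof (intro equalityI subsetI)
      fix j assume "j \<in> J"
      with False show "j \<in> Suc ` J'" by (cases j) (auto simp: J'_def)
    qed (auto simp: J'_def)
    have card: "card J = card J'" by (simp add: J card_image)
    have ord: "card {j\<in>J. j < Suc k} = card {j\<in>J'. j < k}" for k
    proof -
      have "{j\<in>J. j < Suc k} = Suc ` {j\<in>J'. j < k}" by (auto simp: J)
      then show ?thesis by (simp add: card_image)
    qed
    have n: "nths (h # hs) J = nths hs J'" "nths (h # hs) (J - {Suc k}) = nths hs (J' - {k})" for k
      using False unfolding nths_Cons rem by (auto simp: J'_def)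
    have "(\<Sum>k\<in>J. (-1) ^ card {j\<in>J. j < k} * ts' ! k * mat_trace (A * htpy_comp X (nths (h # hs) (J - {k})) i))
        = (\<Sum>k\<in>J'. (-1) ^ card {j\<in>J'. j < k} * ts ! k * mat_trace (A * htpy_comp X (nths hs (J' - {k})) i))"
      by (subst J, subst sum.reindex) (simp_all add: ord n ts')
    then show ?thesis
      using Cons.IH[OF hs J', of A] Cons.prems(3) by (simp add: n card)
  next
    case True
    have J: "J = insert 0 (Suc ` J')"
    proof (intro equalityI subsetI)
      fix j assume "j \<in> J"
      with True show "j \<in> insert 0 (Suc ` J')" by (cases j) (auto simp: J'_def)
    qed (use True in \<open>auto simp: J'_def\<close>)
    have card: "card J = Suc (card J')" by (simp add: J card_image fin)
    \<comment> \<open>Position 0 precedes all others, so every count grows by one; this is the minus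
      sign in \<open>sum\<close>.\<close>
    have ord: "card {j\<in>J. j < Suc k} = Suc (card {j\<in>J'. j < k})" for k
    proof -
      have "{j\<in>J. j < Suc k} = insert 0 (Suc ` {j\<in>J'. j < k})" by (auto simp: J)
      then show ?thesis by (simp add: card_image fin)
    qed
    have n: "nths (h # hs) J = h # nths hs J'" "nths (h # hs) (J - {0}) = nths hs J'"
      "nths (h # hs) (J - {Suc k}) = h # nths hs (J' - {k})" for k
      using True unfolding nths_Cons rem by (auto simp: J'_def)
    let ?c = "i - int (card J')"
    let ?H = "h (?c + 1)" and ?F = "htpy_comp X (nths hs J')"
    have A: "A \<in> carrier_mat (rk X i) (rk X ?c)" using Cons.prems(3) by (simp add: card)
    have H: "?H \<in> carrier_mat (rk X ?c) (rk X (?c + 1))" using h[of "?c + 1"] by simp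
    have D: "diff X ?c \<in> carrier_mat (rk X (?c + 1)) (rk X ?c)"
      "diff X (?c - 1) \<in> carrier_mat (rk X ?c) (rk X (?c - 1))"
      "diff X i \<in> carrier_mat (rk X (i + 1)) (rk X i)"
      using X by (auto intro: diff_carrier)
    have F: "?F i \<in> carrier_mat (rk X ?c) (rk X i)" "?F (i + 1) \<in> carrier_mat (rk X (?c + 1)) (rk X (i + 1))"
      by (rule htpy_comp_nths_carrier[OF hs J']; simp)+
    have hc: "h ?c \<in> carrier_mat (rk X (?c - 1)) (rk X ?c)" using h .
    have len: "length (nths hs J') = card J'" using J' by (rule length_nths_card)
    \<comment> \<open>The null-homotopy identity, multiplied by \<open>A\<close> on the left and by
      the tail on the right, moves the differential past \<open>h\<close>.\<close>
    have first: "mat_trace (A * (diff X (?c - 1) * (h ?c * ?F i)))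
        = a * mat_trace (A * ?F i) - mat_trace (A * ?H * (diff X ?c * ?F i))"
    proof -
      have "?H * diff X ?c * ?F i + diff X (?c - 1) * h ?c * ?F i = a \<cdot>\<^sub>m ?F i"
        using arg_cong[OF null[of ?c], of "\<lambda>B. B * ?F i"] H D F hc
        by (subst (asm) add_mult_distrib_mat[of _ "rk X ?c" "rk X ?c" _ _ "rk X i"]) auto
      then have "A * (?H * (diff X ?c * ?F i)) + A * (diff X (?c - 1) * (h ?c * ?F i)) = a \<cdot>\<^sub>m (A * ?F i)"
        using arg_cong[of _ "a \<cdot>\<^sub>m ?F i" "\<lambda>B. A * B"] A H D F hc
          mult_add_distrib_mat[of A "rk X i" "rk X ?c" "?H * (diff X ?c * ?F i)" "rk X i"
            "diff X (?c - 1) * (h ?c * ?F i)"]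
        by (simp add: mat_assoc mult_smult_distrib[of _ "rk X i" "rk X ?c"])
      from arg_cong[OF this, of mat_trace] show ?thesis
        using A H D F hc by (simp add: mat_trace_add mat_trace_smult mat_assoc algebra_simps)
    qed
    \<comment> \<open>With \<open>h\<close> absorbed into the test matrix, the remaining commutator
      is that of the tail.\<close>
    have "A * ?H \<in> carrier_mat (rk X i) (rk X (?c + 1))" using A H by simp
    note IH = Cons.IH[OF hs J' this]
    have sum: "(\<Sum>k\<in>J. (-1) ^ card {j\<in>J. j < k} * ts' ! k * mat_trace (A * htpy_comp X (nths (h # hs) (J - {k})) i))
        = a * mat_trace (A * ?F i)
          - (\<Sum>k\<in>J'. (-1) ^ card {j\<in>J'. j < k} * ts ! k * mat_trace (A * ?H * htpy_comp X (nths hs (J' - {k})) i))"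
    proof -
      have step: "mat_trace (A * htpy_comp X (nths (h # hs) (J - {Suc k})) i)
          = mat_trace (A * ?H * htpy_comp X (nths hs (J' - {k})) i)" if k: "k \<in> J'" for k
      proof -
        have sub: "J' - {k} \<subseteq> {..<length hs}" using J' by auto
        have ck: "int (card (J' - {k})) = int (card J') - 1"
          using k fin card_gt_0_iff[of J'] by (auto simp: card_Diff_singleton)
        have "htpy_comp X (nths hs (J' - {k})) i \<in> carrier_mat (rk X (?c + 1)) (rk X i)"
          using hs sub by (rule htpy_comp_nths_carrier) (simp add: ck)
        moreover have "i - int (length (nths hs (J' - {k}))) = ?c + 1"
          using length_nths_card[OF sub] ck by simp
        ultimately show ?thesis
          using A H unfolding n htpy_comp.simps by (simp only: mat_assoc carrier_matD)
      qed
      have "(\<Sum>k\<in>J. (-1) ^ card {j\<in>J. j < k} * ts' ! k * mat_trace (A * htpy_comp X (nths (h # hs) (J - {k})) i))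
        = a * mat_trace (A * htpy_comp X (nths (h # hs) (J - {0})) i)
          + (\<Sum>k\<in>J'. (-1) ^ card {j\<in>J. j < Suc k} * ts' ! Suc k * mat_trace (A * htpy_comp X (nths (h # hs) (J - {Suc k})) i))"
        by (subst (1) J, subst sum.insert) (simp_all add: fin sum.reindex ts' comp_def)
      then show ?thesis
        unfolding ord n(2) using step by (simp add: ts' sum_negf)
    qed
    show ?thesis
      unfolding sum card n(1) htpy_comp.simps len IH[symmetric]
      using first A H D F hc by (simp add: mat_assoc algebra_simps)
  qed
qed

section \<open>Chain maps into shifts and the cocycle of mixed traces\<close>

lemma shift_simps [simp]:
  "rk (shift n X) i = rk X (i + n)" "diff (shift n X) i = sign_of n \<cdot>\<^sub>m diff X (i + n)"
  by (simp_all add: shift_def)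

lemma sign_of_minus_one: "sign_of (i - 1) = - (sign_of i :: 'a::comm_ring_1)"
  by (simp add: sign_of_def)

lemma sign_of_nat: "sign_of (int d - 1) = - ((-1) ^ d :: 'a::comm_ring_1)"
  by (simp add: sign_of_def)

lemma chain_map_carrier: "chain_map X Y f \<Longrightarrow> f i \<in> carrier_mat (rk Y i) (rk X i)"
  by (simp add: chain_map_def)

lemma chain_map_diff: "chain_map X Y f \<Longrightarrow> diff Y i * f i = f (i + 1) * diff X i"
  by (simp add: chain_map_def)

lemma chain_map_shift:
  assumes "free_complex X" "chain_map Y (shift n X) \<psi>" "j = i + n"
  shows "\<psi> i \<in> carrier_mat (rk X j) (rk Y i)"
    "\<psi> (i + 1) * diff Y i = sign_of n \<cdot>\<^sub>m (diff X j * \<psi> i)"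
proof -
  show c: "\<psi> i \<in> carrier_mat (rk X j) (rk Y i)"
    using assms by (auto simp: chain_map_def)
  have "\<psi> (i + 1) * diff Y i = (sign_of n \<cdot>\<^sub>m diff X j) * \<psi> i"
    using assms by (simp add: chain_map_def)
  also have "\<dots> = sign_of n \<cdot>\<^sub>m (diff X j * \<psi> i)"
    using c diff_carrier[OF assms(1) refl] by (rule mult_smult_assoc_mat[rotated])
  finally show "\<psi> (i + 1) * diff Y i = sign_of n \<cdot>\<^sub>m (diff X j * \<psi> i)" .
qed

lemma mat_smult_assoc:
  fixes A B :: "'a::comm_ring_1 mat"
  shows "dim_col A = dim_row B \<Longrightarrow> (c \<cdot>\<^sub>m A) * B = c \<cdot>\<^sub>m (A * B)"
    "dim_col A = dim_row B \<Longrightarrow> A * (c \<cdot>\<^sub>m B) = c \<cdot>\<^sub>m (A * B)"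
  by (auto intro!: mult_smult_assoc_mat[of _ "dim_row A" "dim_col A" _ "dim_col B"]
      mult_smult_distrib[of _ "dim_row A" "dim_col A" _ "dim_col B"])

lemma mat_zero_mult:
  fixes B :: "'a::comm_ring_1 mat"
  shows "dim_row B = k \<Longrightarrow> 0\<^sub>m n k * B = 0\<^sub>m n (dim_col B)"
    "dim_col B = k \<Longrightarrow> B * 0\<^sub>m k n = 0\<^sub>m (dim_row B) n"
  by (auto intro!: left_mult_zero_mat right_mult_zero_mat)

text \<open>Removing indices from the two halves of \<open>J\<close> gives the commutators of the
  differential with the products of \<open>\<mu>\<close>s and of \<open>\<lambda>\<close>s, by
  \<open>trace_htpy_comp\<close>. Of the four resulting traces two vanish and two cancel because
  \<open>\<phi>\<close> is a chain map.\<close>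

lemma mixed_trace_cocycle:
  fixes X Y :: "'a::comm_ring_1 free_complex" and s t :: "'a list"
  assumes X: "free_complex X" and Y: "free_complex Y"
    and s: "length s = d" "null_homotopies Y s \<mu>" and t: "length t = d" "null_homotopies X t ls"
    and \<psi>: "chain_map Y (shift (int d - 1) X) \<psi>" and \<phi>: "chain_map X Y \<phi>"
    and r: "\<And>J. r J = mat_trace (\<psi> (i + 1 - int d) *
        (htpy_comp Y (nths \<mu> (J \<inter> {..<d})) (i + 1 - int (card {j. d + j \<in> J})) *
          (\<phi> (i + 1 - int (card {j. d + j \<in> J})) *
            (htpy_comp X (nths ls {j. d + j \<in> J}) (i + 1) * diff X i))))"
    and J: "J \<subseteq> {..<2 * d}" "card J = Suc d"
  shows "koszul_diff (s @ t) 1 r J = 0"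
proof -
  define J1 where "J1 = J \<inter> {..<d}"
  define J2 where "J2 = {j. d + j \<in> J}"
  have J1: "J1 \<subseteq> {..<d}" "finite J1" and J2: "J2 \<subseteq> {..<d}"
    using J(1) by (auto simp: J1_def J2_def)
  have fin2: "finite J2" using J2 by (rule finite_subset) simp
  have J_eq: "J = J1 \<union> (+) d ` J2"
  proof (intro equalityI subsetI)
    fix j assume "j \<in> J"
    then show "j \<in> J1 \<union> (+) d ` J2"
      by (cases "j < d") (auto simp: J1_def J2_def intro!: image_eqI[of _ _ "j - d"])
  qed (auto simp: J1_def J2_def)
  have disj: "J1 \<inter> (+) d ` J2 = {}" using J1 by auto
  have "card J = card J1 + card J2"
    unfolding J_eq using J1 fin2 disj by (subst card_Un_disjoint) (auto simp: card_image)
  then have n: "int (card J1) + int (card J2) = int d + 1" using J(2) by simp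
  have len: "length \<mu> = d" "length ls = d"
    using s t by (auto simp: null_homotopies_def)
  \<comment> \<open>The degree in which \<open>\<phi>\<close> acts after an index of
    \<open>J1\<close> is removed; removing one from \<open>J2\<close> makes it
    \<open>c + 1\<close>.\<close>
  define c where "c = i + 1 - int (card J2)"
  have ci: "i + 1 - int d = c - int (card J1) + 1" using n by (simp add: c_def)
  define P where "P = \<psi> (i + 1 - int d)"
  define M where "M = htpy_comp Y (nths \<mu> J1)"
  define L where "L = htpy_comp X (nths ls J2)"
  let ?D = "diff X i" and ?E = "diff Y c" and ?Q = "diff X c"
  have P: "P \<in> carrier_mat (rk X i) (rk Y (i + 1 - int d))"
    unfolding P_def using X \<psi> by (rule chain_map_shift) simp
  have M: "M c \<in> carrier_mat (rk Y (i - int d)) (rk Y c)"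
    "M (c + 1) \<in> carrier_mat (rk Y (i + 1 - int d)) (rk Y (c + 1))"
    unfolding M_def using s(2) J1 len ci by (auto intro: htpy_comp_nths_carrier)
  have L: "L (i + 1) \<in> carrier_mat (rk X c) (rk X (i + 1))"
    "L (i + 1 + 1) \<in> carrier_mat (rk X (c + 1)) (rk X (i + 1 + 1))"
    unfolding L_def using t(2) J2 len by (auto intro!: htpy_comp_nths_carrier simp: c_def)
  have F: "\<phi> c \<in> carrier_mat (rk Y c) (rk X c)"
    "\<phi> (c + 1) \<in> carrier_mat (rk Y (c + 1)) (rk X (c + 1))"
    using \<phi> by (auto intro: chain_map_carrier)
  have D: "?D \<in> carrier_mat (rk X (i + 1)) (rk X i)"
    "diff X (i + 1) \<in> carrier_mat (rk X (i + 1 + 1)) (rk X (i + 1))"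
    "?Q \<in> carrier_mat (rk X (c + 1)) (rk X c)"
    "?E \<in> carrier_mat (rk Y (c + 1)) (rk Y c)"
    "diff X (i - 1) \<in> carrier_mat (rk X i) (rk X (i - 1))"
    "diff Y (i - int d) \<in> carrier_mat (rk Y (i + 1 - int d)) (rk Y (i - int d))"
    using X Y by (auto intro: diff_carrier)
  \<comment> \<open>Test matrices for \<open>trace_htpy_comp\<close>: cyclicity brings the relevant
    product of homotopies to the end, and \<open>C\<close> for \<open>\<mu>\<close>,
    \<open>B\<close> for \<open>\<lambda>\<close>, collect the other factors.\<close>
  define C where "C = \<phi> c * (L (i + 1) * (?D * P))"
  define B where "B = ?D * (P * (M (c + 1) * \<phi> (c + 1)))"
  have C: "C \<in> carrier_mat (rk Y c) (rk Y (c - int (card J1) + 1))"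
    unfolding C_def ci[symmetric] using F L D P by auto
  have B: "B \<in> carrier_mat (rk X (i + 1)) (rk X (i + 1 - int (card J2) + 1))"
    unfolding B_def c_def[symmetric] using F M D P by auto

  have r1: "r (J - {k}) = mat_trace (C * htpy_comp Y (nths \<mu> (J1 - {k})) c)" if k: "k \<in> J1" for k
  proof -
    have eq: "(J - {k}) \<inter> {..<d} = J1 - {k}" "{j. d + j \<in> J - {k}} = J2"
      using k J1 by (auto simp: J1_def J2_def)
    have "card (J1 - {k}) = card J1 - 1" "card J1 > 0"
      using k J1 by (auto simp: card_gt_0_iff)
    then have Mk: "htpy_comp Y (nths \<mu> (J1 - {k})) c \<in> carrier_mat (rk Y (i + 1 - int d)) (rk Y c)"
      using s(2) J1 len ci by (intro htpy_comp_nths_carrier) auto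
    have "r (J - {k}) = mat_trace (P * htpy_comp Y (nths \<mu> (J1 - {k})) c * (\<phi> c * (L (i + 1) * ?D)))"
      unfolding r eq c_def[symmetric] L_def[symmetric] P_def[symmetric]
      using P Mk F L D by (simp add: mat_assoc)
    also have "\<dots> = mat_trace (\<phi> c * (L (i + 1) * ?D) * (P * htpy_comp Y (nths \<mu> (J1 - {k})) c))"
      using P Mk F L D by (intro mat_trace_comm) auto
    also have "\<dots> = mat_trace (C * htpy_comp Y (nths \<mu> (J1 - {k})) c)"
      unfolding C_def using P Mk F L D by (simp add: mat_assoc)
    finally show ?thesis .
  qed
  have r2: "r (J - {d + k}) = mat_trace (B * htpy_comp X (nths ls (J2 - {k})) (i + 1))" if k: "k \<in> J2" for k
  proof -
    have eq: "(J - {d + k}) \<inter> {..<d} = J1" "{j. d + j \<in> J - {d + k}} = J2 - {k}"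
      using k by (auto simp: J1_def J2_def)
    have ck: "card (J2 - {k}) = card J2 - 1" "card J2 > 0"
      using k fin2 by (auto simp: card_gt_0_iff)
    then have Lk: "htpy_comp X (nths ls (J2 - {k})) (i + 1) \<in> carrier_mat (rk X (c + 1)) (rk X (i + 1))"
      using t(2) J2 len by (intro htpy_comp_nths_carrier) (auto simp: c_def)
    have c1: "i + 1 - int (card (J2 - {k})) = c + 1" using ck by (simp add: c_def)
    have "r (J - {d + k}) = mat_trace (P * (M (c + 1) * (\<phi> (c + 1) * htpy_comp X (nths ls (J2 - {k})) (i + 1))) * ?D)"
      unfolding r eq c1 M_def[symmetric] P_def[symmetric]
      using P Lk F M D by (simp add: mat_assoc)
    also have "\<dots> = mat_trace (?D * (P * (M (c + 1) * (\<phi> (c + 1) * htpy_comp X (nths ls (J2 - {k})) (i + 1)))))"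
      using P Lk F M D by (intro mat_trace_comm) auto
    also have "\<dots> = mat_trace (B * htpy_comp X (nths ls (J2 - {k})) (i + 1))"
      unfolding B_def using P Lk F M D by (simp add: mat_assoc)
    finally show ?thesis .
  qed
  have ord1: "{j\<in>J. j < k} = {j\<in>J1. j < k}" if "k \<in> J1" for k
    using that by (auto simp: J1_def)
  \<comment> \<open>All of \<open>J1\<close> precedes the shifted indices, which gives the common
    sign \<open>(-1) ^ card J1\<close>.\<close>
  have ord2: "card {j\<in>J. j < d + k} = card J1 + card {j\<in>J2. j < k}" for k
  proof -
    have "{j\<in>J. j < d + k} = J1 \<union> (+) d ` {j\<in>J2. j < k}"
      unfolding J_eq using J1 by auto
    moreover have "J1 \<inter> (+) d ` {j\<in>J2. j < k} = {}"
      using J1 by auto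
    ultimately show ?thesis
      using J1(2) fin2 by (simp add: card_Un_disjoint card_image)
  qed
  have "koszul_diff (s @ t) 1 r J
      = (\<Sum>k\<in>J1. (-1) ^ card {j\<in>J. j < k} * (s @ t) ! k * r (J - {k}))
      + (\<Sum>k\<in>J2. (-1) ^ card {j\<in>J. j < d + k} * (s @ t) ! (d + k) * r (J - {d + k}))"
    unfolding koszul_diff_def
    using J1 fin2 disj by (subst (1) J_eq, subst sum.union_disjoint) (auto simp: sum.reindex)
  also have "(\<Sum>k\<in>J1. (-1) ^ card {j\<in>J. j < k} * (s @ t) ! k * r (J - {k}))
      = (\<Sum>k\<in>J1. (-1) ^ card {j\<in>J1. j < k} * s ! k * mat_trace (C * htpy_comp Y (nths \<mu> (J1 - {k})) c))"
    using J1 s(1) by (intro sum.cong refl) (auto simp: r1 ord1 nth_append)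
  also have "\<dots> = mat_trace (C * (diff Y (c - int (card J1)) * M c)) - (-1) ^ card J1 * mat_trace (C * (M (c + 1) * ?E))"
    unfolding M_def using trace_htpy_comp[OF Y s(2) _ C] J1 len by simp
  also have "(\<Sum>k\<in>J2. (-1) ^ card {j\<in>J. j < d + k} * (s @ t) ! (d + k) * r (J - {d + k}))
      = (-1) ^ card J1 * (\<Sum>k\<in>J2. (-1) ^ card {j\<in>J2. j < k} * t ! k * mat_trace (B * htpy_comp X (nths ls (J2 - {k})) (i + 1)))"
    unfolding sum_distrib_left
    using s(1) by (intro sum.cong refl) (simp add: r2 ord2 nth_append power_add mult.assoc)
  also have "(\<Sum>k\<in>J2. (-1) ^ card {j\<in>J2. j < k} * t ! k * mat_trace (B * htpy_comp X (nths ls (J2 - {k})) (i + 1)))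
      = mat_trace (B * (?Q * L (i + 1))) - (-1) ^ card J2 * mat_trace (B * (L (i + 1 + 1) * diff X (i + 1)))"
    unfolding L_def c_def using trace_htpy_comp[OF X t(2) _ B] J2 len by simp
  \<comment> \<open>The differential of \<open>Y\<close> crosses \<open>\<psi>\<close> and becomes,
    up to sign, that of \<open>X\<close>, which \<open>?D\<close> kills.\<close>
  also have "C * (diff Y (c - int (card J1)) * M c) = 0\<^sub>m (rk Y c) (rk Y c)"
  proof -
    have c1: "c - int (card J1) = i - int d" using ci by simp
    have "P * diff Y (i - int d) = sign_of (int d - 1) \<cdot>\<^sub>m (diff X (i - 1) * \<psi> (i - int d))"
      unfolding P_def using chain_map_shift(2)[OF X \<psi>, of "i - 1" "i - int d"] by (simp add: algebra_simps)
    moreover have "\<psi> (i - int d) \<in> carrier_mat (rk X (i - 1)) (rk Y (i - int d))"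
      using X \<psi> by (rule chain_map_shift) simp
    moreover have "?D * diff X (i - 1) = 0\<^sub>m (rk X (i + 1)) (rk X (i - 1))"
      using diff_diff[OF X, of i "i - 1"] by (simp add: algebra_simps)
    ultimately have "?D * (P * diff Y (i - int d)) = 0\<^sub>m (rk X (i + 1)) (rk Y (i - int d))"
      using D by (simp add: mat_smult_assoc mat_zero_mult flip: mat_assoc)
    moreover have "C * (diff Y (i - int d) * M c) = \<phi> c * (L (i + 1) * ((?D * (P * diff Y (i - int d))) * M c))"
      unfolding C_def using F L D P M by (simp add: mat_assoc)
    ultimately show ?thesis
      unfolding c1 using F L M by (simp add: mat_zero_mult)
  qed
  \<comment> \<open>Cyclicity puts \<open>diff X (i + 1)\<close> directly in front of
    \<open>?D\<close>.\<close>
  also have "mat_trace (B * (L (i + 1 + 1) * diff X (i + 1))) = 0"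
  proof -
    have "mat_trace (B * (L (i + 1 + 1) * diff X (i + 1))) = mat_trace (L (i + 1 + 1) * diff X (i + 1) * B)"
      using B L D by (intro mat_trace_comm) (auto simp: c_def)
    also have "L (i + 1 + 1) * diff X (i + 1) * B
        = L (i + 1 + 1) * ((diff X (i + 1) * ?D) * (P * (M (c + 1) * \<phi> (c + 1))))"
      unfolding B_def using F L D P M by (simp add: mat_assoc)
    also have "\<dots> = 0\<^sub>m (rk X (c + 1)) (rk X (c + 1))"
      using F L D P M by (simp add: diff_diff[OF X] mat_zero_mult add.commute[of i 2])
    finally show ?thesis by simp
  qed
  \<comment> \<open>The two surviving traces agree by moving the differential across
    \<open>\<phi>\<close> and rotating.\<close>
  also have "mat_trace (C * (M (c + 1) * ?E)) = mat_trace (B * (?Q * L (i + 1)))"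
  proof -
    have "C * (M (c + 1) * ?E) = \<phi> c * (L (i + 1) * (?D * (P * (M (c + 1) * ?E))))"
      unfolding C_def using F L D P M by (simp add: mat_assoc)
    then have "mat_trace (C * (M (c + 1) * ?E)) = mat_trace (L (i + 1) * (?D * (P * (M (c + 1) * ?E))) * \<phi> c)"
      using mat_trace_comm[of "\<phi> c" "L (i + 1) * (?D * (P * (M (c + 1) * ?E)))"] F L D P M by simp
    also have "L (i + 1) * (?D * (P * (M (c + 1) * ?E))) * \<phi> c
        = L (i + 1) * (?D * (P * (M (c + 1) * (?E * \<phi> c))))"
      using F L D P M by (simp add: mat_assoc)
    also have "?E * \<phi> c = \<phi> (c + 1) * ?Q"
      using \<phi> by (rule chain_map_diff)
    also have "L (i + 1) * (?D * (P * (M (c + 1) * (\<phi> (c + 1) * ?Q)))) = L (i + 1) * (B * ?Q)"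
      unfolding B_def using F L D P M by (simp add: mat_assoc)
    also have "mat_trace (L (i + 1) * (B * ?Q)) = mat_trace (B * ?Q * L (i + 1))"
      using L D B by (intro mat_trace_comm) (auto simp: c_def)
    also have "B * ?Q * L (i + 1) = B * (?Q * L (i + 1))"
      using L D B by (intro mat_assoc) (auto simp: c_def)
    finally show ?thesis .
  qed
  finally show ?thesis by simp
qed

section \<open>Comparison of the traces over two systems of parameters\<close>

lemma null_homotopies_length: "null_homotopies X t ls \<Longrightarrow> length ls = length t"
  by (simp add: null_homotopies_def)

lemma htpy_comp_full_carrier:
  "null_homotopies X t ls \<Longrightarrow> length t = d \<Longrightarrow> j = i - int d \<Longrightarrow> htpy_comp X ls i \<in> carrier_mat (rk X j) (rk X i)"
  using htpy_comp_carrier[of ls X i] null_homotopies_carrier[of X t ls]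
  by (auto simp: null_homotopies_length)

lemma gen_frac_trace_transfer:
  fixes X Y :: "'a::comm_ring_1 free_complex"
  assumes X: "free_complex X" and Y: "free_complex Y"
    and s: "sop m d s" "null_homotopies Y s \<mu>" and t: "sop m d t" "null_homotopies X t ls"
    and \<psi>: "chain_map Y (shift (int d - 1) X) \<psi>" and \<phi>: "chain_map X Y \<phi>"
  shows "gen_frac m d (mat_trace (\<psi> (i + 1 - int d) * htpy_comp Y \<mu> (i + 1) * diff Y i * \<phi> i)) s
    = gen_frac m d (mat_trace (\<psi> (i + 1 - int d) * \<phi> (i + 1 - int d) * htpy_comp X ls (i + 1) * diff X i)) t"
proof -
  note len = sop_length[OF s(1)] sop_length[OF t(1)]
  have len': "length \<mu> = d" "length ls = d"
    using len null_homotopies_length[OF s(2)] null_homotopies_length[OF t(2)] by auto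
  define r where "r J = mat_trace (\<psi> (i + 1 - int d) *
        (htpy_comp Y (nths \<mu> (J \<inter> {..<d})) (i + 1 - int (card {j. d + j \<in> J})) *
          (\<phi> (i + 1 - int (card {j. d + j \<in> J})) *
            (htpy_comp X (nths ls {j. d + j \<in> J}) (i + 1) * diff X i))))" for J
  have D: "diff X i \<in> carrier_mat (rk X (i + 1)) (rk X i)" "diff Y i \<in> carrier_mat (rk Y (i + 1)) (rk Y i)"
    using X Y by (auto intro: diff_carrier)
  have P: "\<psi> (i + 1 - int d) \<in> carrier_mat (rk X i) (rk Y (i + 1 - int d))"
    using X \<psi> by (rule chain_map_shift) simp
  have M: "htpy_comp Y \<mu> (i + 1) \<in> carrier_mat (rk Y (i + 1 - int d)) (rk Y (i + 1))"
    using s(2) len(1) by (rule htpy_comp_full_carrier) simp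
  have L: "htpy_comp X ls (i + 1) \<in> carrier_mat (rk X (i + 1 - int d)) (rk X (i + 1))"
    using t(2) len(2) by (rule htpy_comp_full_carrier) simp
  have F: "\<phi> j \<in> carrier_mat (rk Y j) (rk X j)" for j
    using \<phi> by (rule chain_map_carrier)
  have "r {..<d} = mat_trace (\<psi> (i + 1 - int d) * htpy_comp Y \<mu> (i + 1) * diff Y i * \<phi> i)"
  proof -
    \<comment> \<open>No homotopy of \<open>X\<close> is left here, so \<open>\<phi>\<close> meets
      the differential and can be moved to the right end.\<close>
    have "r {..<d} = mat_trace (\<psi> (i + 1 - int d) * (htpy_comp Y \<mu> (i + 1) * (\<phi> (i + 1) * diff X i)))"
      using D by (simp add: r_def nths_all len')
    also have "\<phi> (i + 1) * diff X i = diff Y i * \<phi> i"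
      using chain_map_diff[OF \<phi>] by simp
    finally show ?thesis
      using D P M F[of i] by (simp add: mat_assoc)
  qed
  moreover have "r {d..<2 * d} = mat_trace (\<psi> (i + 1 - int d) * \<phi> (i + 1 - int d) * htpy_comp X ls (i + 1) * diff X i)"
  proof -
    have "{d..<2 * d} \<inter> {..<d} = {}" "{j. d + j \<in> {d..<2 * d}} = {..<d}"
      by auto
    then show ?thesis
      using D P L F[of "i + 1 - int d"] by (simp add: r_def nths_all len' mat_assoc)
  qed
  moreover have "gen_frac m d (r {..<d}) s = gen_frac m d (r {d..<2 * d}) t"
    using s(1) t(1) by (rule gen_frac_transfer)
      (rule mixed_trace_cocycle[OF X Y len(1) s(2) len(2) t(2) \<psi> \<phi> r_def])
  ultimately show ?thesis by simp
qed

section \<open>Independence of the pretrace of parameters, degree and representative\<close>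

lemma gen_frac_trace_parameters:
  fixes X :: "'a::comm_ring_1 free_complex"
  assumes X: "free_complex X" and \<alpha>: "chain_map X (shift (int d - 1) X) \<alpha>"
    and s: "sop m d s" "null_homotopies X s \<mu>" and t: "sop m d t" "null_homotopies X t ls"
  shows "gen_frac m d (mat_trace (\<alpha> (i + 1 - int d) * htpy_comp X \<mu> (i + 1) * diff X i)) s
    = gen_frac m d (mat_trace (\<alpha> (i + 1 - int d) * htpy_comp X ls (i + 1) * diff X i)) t"
proof -
  have "chain_map X X (\<lambda>i. 1\<^sub>m (rk X i))"
    using left_mult_one_mat[OF diff_carrier[OF X refl]] right_mult_one_mat[OF diff_carrier[OF X refl]]
    by (simp add: chain_map_def)
  from gen_frac_trace_transfer[OF X X s t \<alpha> this, of i] show ?thesis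
    using chain_map_shift(1)[OF X \<alpha>, of i "i + 1 - int d"] diff_carrier[OF X refl, of i]
    by simp
qed

text \<open>Each term of the commutator formula carries a factor \<open>t ! k\<close>, so modulo the
  ideal of \<open>t\<close> the full product commutes with the differential up to
  \<open>(-1) ^ d\<close>.\<close>

lemma trace_htpy_comp_full:
  fixes X :: "'a::comm_ring_1 free_complex"
  assumes X: "free_complex X" and t: "null_homotopies X t ls" "length t = d"
    and A: "A \<in> carrier_mat (rk X i) (rk X (i - int d + 1))"
  shows "\<exists>c. mat_trace (A * (diff X (i - int d) * htpy_comp X ls i))
      - (-1) ^ d * mat_trace (A * (htpy_comp X ls (i + 1) * diff X i)) = (\<Sum>k<d. t ! k * c k)"
proof -
  have len: "length ls = d" using t null_homotopies_length by auto
  then have "nths ls {..<d} = ls" by (simp add: nths_all)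
  with trace_htpy_comp[OF X t(1), of "{..<d}" A i] A show ?thesis
    by (intro exI[of _ "\<lambda>k. (-1) ^ card {j\<in>{..<d}. j < k} * mat_trace (A * htpy_comp X (nths ls ({..<d} - {k})) i)"])
      (simp add: len mult_ac)
qed

text \<open>Moving the differential past \<open>\<alpha>\<close> costs the sign of the shift, moving
  it past the homotopies costs \<open>(-1) ^ d\<close> modulo the ideal. Together they give
  \<open>-1\<close>, which \<open>sign_of\<close> compensates.\<close>

lemma gen_frac_trace_degree_step:
  fixes X :: "'a::comm_ring_1 free_complex"
  assumes X: "free_complex X" and \<alpha>: "chain_map X (shift (int d - 1) X) \<alpha>"
    and t: "sop m d t" "null_homotopies X t ls"
  shows "gen_frac m d (sign_of i * mat_trace (\<alpha> (i + 1 - int d) * htpy_comp X ls (i + 1) * diff X i)) t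
    = gen_frac m d (sign_of (i - 1) * mat_trace (\<alpha> (i - int d) * htpy_comp X ls i * diff X (i - 1))) t"
proof -
  note len = sop_length[OF t(1)]
  let ?T = "mat_trace (\<alpha> (i + 1 - int d) * htpy_comp X ls (i + 1) * diff X i)"
    and ?T' = "mat_trace (\<alpha> (i - int d) * htpy_comp X ls i * diff X (i - 1))"
  have D: "diff X i \<in> carrier_mat (rk X (i + 1)) (rk X i)" "diff X (i - 1) \<in> carrier_mat (rk X i) (rk X (i - 1))"
    "diff X (i - int d) \<in> carrier_mat (rk X (i + 1 - int d)) (rk X (i - int d))"
    using X by (auto intro: diff_carrier)
  have L: "htpy_comp X ls (i + 1) \<in> carrier_mat (rk X (i + 1 - int d)) (rk X (i + 1))"
    "htpy_comp X ls i \<in> carrier_mat (rk X (i - int d)) (rk X i)"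
    using t(2) len by (auto intro: htpy_comp_full_carrier)
  have A: "\<alpha> (i + 1 - int d) \<in> carrier_mat (rk X i) (rk X (i + 1 - int d))"
    "\<alpha> (i - int d) \<in> carrier_mat (rk X (i - 1)) (rk X (i - int d))"
    by (rule chain_map_shift(1)[OF X \<alpha>]; simp)+
  have comm: "\<alpha> (i + 1 - int d) * diff X (i - int d) = sign_of (int d - 1) \<cdot>\<^sub>m (diff X (i - 1) * \<alpha> (i - int d))"
    using chain_map_shift(2)[OF X \<alpha>, of "i - 1" "i - int d"] by (simp add: algebra_simps)
  have "mat_trace (\<alpha> (i + 1 - int d) * (diff X (i - int d) * htpy_comp X ls i))
      = sign_of (int d - 1) * mat_trace (diff X (i - 1) * (\<alpha> (i - int d) * htpy_comp X ls i))"
  proof -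
    have "\<alpha> (i + 1 - int d) * (diff X (i - int d) * htpy_comp X ls i)
        = (\<alpha> (i + 1 - int d) * diff X (i - int d)) * htpy_comp X ls i"
      using A D L by (simp add: mat_assoc)
    also have "\<dots> = sign_of (int d - 1) \<cdot>\<^sub>m (diff X (i - 1) * (\<alpha> (i - int d) * htpy_comp X ls i))"
      unfolding comm using A D L by (simp add: mat_smult_assoc mat_assoc)
    finally show ?thesis
      using A D L by (simp add: mat_trace_smult)
  qed
  also have "mat_trace (diff X (i - 1) * (\<alpha> (i - int d) * htpy_comp X ls i)) = ?T'"
    using A D L by (intro mat_trace_comm) auto
  finally have first: "mat_trace (\<alpha> (i + 1 - int d) * (diff X (i - int d) * htpy_comp X ls i)) = - ((-1) ^ d * ?T')"
    by (simp add: sign_of_nat)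
  have "\<alpha> (i + 1 - int d) \<in> carrier_mat (rk X i) (rk X (i - int d + 1))"
    using A(1) by (simp add: algebra_simps)
  from trace_htpy_comp_full[OF X t(2) len this] obtain c where
    c: "mat_trace (\<alpha> (i + 1 - int d) * (diff X (i - int d) * htpy_comp X ls i))
      - (-1) ^ d * mat_trace (\<alpha> (i + 1 - int d) * (htpy_comp X ls (i + 1) * diff X i)) = (\<Sum>k<d. t ! k * c k)"
    by blast
  have second: "mat_trace (\<alpha> (i + 1 - int d) * (htpy_comp X ls (i + 1) * diff X i)) = ?T"
    using A D L by (simp add: mat_assoc)
  have "sign_of i * ?T - sign_of (i - 1) * ?T' = - sign_of i * (-1) ^ d * (- ((-1) ^ d * ?T') - (-1) ^ d * ?T)"
    by (simp add: sign_of_minus_one algebra_simps flip: power_add mult_2)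
  also have "\<dots> = (\<Sum>k<d. t ! k * (- sign_of i * (-1) ^ d * c k))"
    using c unfolding first second by (simp add: sum_distrib_left mult_ac)
  finally show ?thesis
    using t(1) by (intro gen_frac_cong_ideal)
qed

lemma gen_frac_trace_degree:
  fixes X :: "'a::comm_ring_1 free_complex"
  assumes X: "free_complex X" and \<alpha>: "chain_map X (shift (int d - 1) X) \<alpha>"
    and t: "sop m d t" "null_homotopies X t ls"
  shows "gen_frac m d (sign_of i * mat_trace (\<alpha> (i + 1 - int d) * htpy_comp X ls (i + 1) * diff X i)) t
    = gen_frac m d (mat_trace (\<alpha> (1 - int d) * htpy_comp X ls 1 * diff X 0)) t"
proof (induction i rule: int_induct[where k = 0])
  case base
  show ?case by (simp add: sign_of_def)
next
  case (step1 i)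
  then show ?case
    using gen_frac_trace_degree_step[OF X \<alpha> t, of "i + 1"] by (simp add: algebra_simps)
next
  case (step2 i)
  then show ?case
    using gen_frac_trace_degree_step[OF X \<alpha> t, of i] by (simp add: algebra_simps)
qed

text \<open>A null-homotopic difference has two parts. The one beginning with the differential has
  trace zero by cyclicity; the other one lies in the ideal of \<open>t\<close> after commuting the
  differential past the homotopies.\<close>

lemma gen_frac_trace_homotopy:
  fixes X :: "'a::comm_ring_1 free_complex"
  assumes X: "free_complex X" and \<alpha>\<beta>: "(\<alpha>, \<beta>) \<in> homotopy_rel X (shift (int d - 1) X)"
    and t: "sop m d t" "null_homotopies X t ls"
  shows "gen_frac m d (mat_trace (\<alpha> (1 - int d) * htpy_comp X ls 1 * diff X 0)) t
    = gen_frac m d (mat_trace (\<beta> (1 - int d) * htpy_comp X ls 1 * diff X 0)) t"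
proof -
  note len = sop_length[OF t(1)]
  let ?j = "1 - int d" and ?e = "sign_of (int d - 1) :: 'a"
  obtain h where h: "\<And>i. h i \<in> carrier_mat (rk X (i - 1 + (int d - 1))) (rk X i)"
    and eq: "\<And>i. \<alpha> i - \<beta> i = (?e \<cdot>\<^sub>m diff X (i - 1 + (int d - 1))) * h i + h (i + 1) * diff X i"
    and ch: "chain_map X (shift (int d - 1) X) \<alpha>" "chain_map X (shift (int d - 1) X) \<beta>"
    using \<alpha>\<beta> by (auto simp: homotopy_rel_def)
  have A: "\<alpha> ?j \<in> carrier_mat (rk X 0) (rk X ?j)" "\<beta> ?j \<in> carrier_mat (rk X 0) (rk X ?j)"
    by (rule chain_map_shift(1)[OF X ch(1)] chain_map_shift(1)[OF X ch(2)]; simp)+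
  have H: "h ?j \<in> carrier_mat (rk X (-1)) (rk X ?j)" "h (?j + 1) \<in> carrier_mat (rk X 0) (rk X (?j + 1))"
    using h[of ?j] h[of "?j + 1"] by (simp_all add: algebra_simps)
  have D: "diff X 0 \<in> carrier_mat (rk X 1) (rk X 0)" "diff X (-1) \<in> carrier_mat (rk X 0) (rk X (-1))"
    "diff X ?j \<in> carrier_mat (rk X (?j + 1)) (rk X ?j)" "diff X 1 \<in> carrier_mat (rk X 2) (rk X 1)"
    using X by (auto intro: diff_carrier)
  have L: "htpy_comp X ls 1 \<in> carrier_mat (rk X ?j) (rk X 1)"
    "htpy_comp X ls (1 + 1) \<in> carrier_mat (rk X (?j + 1)) (rk X 2)"
    using t(2) len by (auto intro!: htpy_comp_full_carrier[where i = 2] htpy_comp_full_carrier[where i = 1])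
  let ?B = "htpy_comp X ls 1 * diff X 0"
  have B: "?B \<in> carrier_mat (rk X ?j) (rk X 0)" using L D by auto
  have "\<alpha> ?j = \<beta> ?j + (?e \<cdot>\<^sub>m (diff X (-1) * h ?j) + h (?j + 1) * diff X ?j)"
  proof -
    have "\<alpha> ?j = \<beta> ?j + (\<alpha> ?j - \<beta> ?j)" using A by (intro eq_matI) auto
    then show ?thesis
      unfolding eq using D H by (simp add: mat_smult_assoc)
  qed
  then have "\<alpha> ?j * ?B = \<beta> ?j * ?B + (?e \<cdot>\<^sub>m (diff X (-1) * h ?j) * ?B + h (?j + 1) * diff X ?j * ?B)"
    using add_mult_distrib_mat[of "\<beta> ?j" "rk X 0" "rk X ?j" "?e \<cdot>\<^sub>m (diff X (-1) * h ?j) + h (?j + 1) * diff X ?j" ?B "rk X 0"]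
      add_mult_distrib_mat[of "?e \<cdot>\<^sub>m (diff X (-1) * h ?j)" "rk X 0" "rk X ?j" "h (?j + 1) * diff X ?j" ?B "rk X 0"]
      A B D H by simp
  then have "mat_trace (\<alpha> ?j * ?B) = mat_trace (\<beta> ?j * ?B)
      + (?e * mat_trace (diff X (-1) * (h ?j * ?B)) + mat_trace (h (?j + 1) * (diff X ?j * ?B)))"
    using A B D H L by (simp add: mat_trace_add mat_trace_smult mat_smult_assoc mat_assoc)
  moreover have "mat_trace (diff X (-1) * (h ?j * ?B)) = 0"
  proof -
    have "mat_trace (diff X (-1) * (h ?j * ?B)) = mat_trace (h ?j * ?B * diff X (-1))"
      using B D H by (intro mat_trace_comm) auto
    also have "h ?j * ?B * diff X (-1) = h ?j * (htpy_comp X ls 1 * (diff X 0 * diff X (-1)))"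
      using L D H by (simp add: mat_assoc)
    also have "\<dots> = 0\<^sub>m (rk X (-1)) (rk X (-1))"
      using L D H diff_diff[OF X, of 0 "-1"] by (simp add: mat_zero_mult)
    finally show ?thesis by simp
  qed
  moreover have "\<exists>c. mat_trace (h (?j + 1) * (diff X ?j * ?B)) = (\<Sum>k<d. t ! k * c k)"
  proof -
    \<comment> \<open>The trace is rotated so that its last factor \<open>diff X 0\<close> comes
      first; with \<open>h\<close> it forms the test matrix, and the commuted term contains
      \<open>diff X 1 * diff X 0\<close>.\<close>
    have "diff X 0 * h (?j + 1) \<in> carrier_mat (rk X 1) (rk X (1 - int d + 1))"
      using D H by auto
    from trace_htpy_comp_full[OF X t(2) len this] obtain c where
      "mat_trace (diff X 0 * h (?j + 1) * (diff X ?j * htpy_comp X ls 1))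
      - (-1) ^ d * mat_trace (diff X 0 * h (?j + 1) * (htpy_comp X ls (1 + 1) * diff X 1)) = (\<Sum>k<d. t ! k * c k)"
      by blast
    moreover have "mat_trace (diff X 0 * h (?j + 1) * (htpy_comp X ls (1 + 1) * diff X 1)) = 0"
    proof -
      have "mat_trace (diff X 0 * h (?j + 1) * (htpy_comp X ls (1 + 1) * diff X 1))
          = mat_trace (htpy_comp X ls (1 + 1) * diff X 1 * (diff X 0 * h (?j + 1)))"
        using L D H by (intro mat_trace_comm) auto
      also have "htpy_comp X ls (1 + 1) * diff X 1 * (diff X 0 * h (?j + 1))
          = htpy_comp X ls (1 + 1) * (diff X 1 * diff X 0 * h (?j + 1))"
        using L D H by (simp add: mat_assoc)
      also have "\<dots> = 0\<^sub>m (rk X (?j + 1)) (rk X (?j + 1))"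
        using L D H diff_diff[OF X, of 1 0] by (simp add: mat_zero_mult)
      finally show ?thesis by simp
    qed
    moreover have "mat_trace (diff X 0 * h (?j + 1) * (diff X ?j * htpy_comp X ls 1))
        = mat_trace (h (?j + 1) * (diff X ?j * ?B))"
    proof -
      have "mat_trace (diff X 0 * h (?j + 1) * (diff X ?j * htpy_comp X ls 1))
          = mat_trace (diff X 0 * (h (?j + 1) * (diff X ?j * htpy_comp X ls 1)))"
        using L D H by (simp add: mat_assoc)
      also have "\<dots> = mat_trace (h (?j + 1) * (diff X ?j * htpy_comp X ls 1) * diff X 0)"
        using L D H by (intro mat_trace_comm) auto
      finally show ?thesis
        using L D H by (simp add: mat_assoc)
    qed
    ultimately show ?thesis by auto
  qed
  ultimately obtain c where "mat_trace (\<alpha> ?j * ?B) - mat_trace (\<beta> ?j * ?B) = (\<Sum>k<d. t ! k * c k)"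
    by auto
  moreover have "\<alpha> ?j * ?B = \<alpha> ?j * htpy_comp X ls 1 * diff X 0" "\<beta> ?j * ?B = \<beta> ?j * htpy_comp X ls 1 * diff X 0"
    using A D L by (simp_all add: mat_assoc)
  ultimately show ?thesis
    using t(1) by (intro gen_frac_cong_ideal) auto
qed

section \<open>The pretrace and the duality pairing\<close>

lemma free_complex_shift:
  assumes X: "free_complex X"
  shows "free_complex (shift n X)"
  unfolding free_complex_def
proof (intro conjI allI)
  fix i
  have D: "diff X (i + n) \<in> carrier_mat (rk X (i + n + 1)) (rk X (i + n))"
    "diff X (i + n + 1) \<in> carrier_mat (rk X (i + n + 2)) (rk X (i + n + 1))"
    using X by (auto intro: diff_carrier)
  then show "diff (shift n X) i \<in> carrier_mat (rk (shift n X) (i + 1)) (rk (shift n X) i)"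
    by (simp add: add_ac)
  have eq: "i + 1 + n = i + n + 1" "i + 2 + n = i + n + 2" by simp_all
  show "diff (shift n X) (i + 1) * diff (shift n X) i = 0\<^sub>m (rk (shift n X) (i + 2)) (rk (shift n X) i)"
    unfolding shift_simps eq using D by (simp add: mat_smult_assoc diff_diff[OF X])
qed

lemma chain_map_comp:
  assumes X: "free_complex X" and Y: "free_complex Y" and Z: "free_complex Z"
    and \<psi>: "chain_map Y Z \<psi>" and \<phi>: "chain_map X Y \<phi>"
  shows "chain_map X Z (\<lambda>i. \<psi> i * \<phi> i)"
  unfolding chain_map_def
proof (intro conjI allI)
  fix i
  note c = chain_map_carrier[OF \<psi>, of i] chain_map_carrier[OF \<psi>, of "i + 1"]
    chain_map_carrier[OF \<phi>, of i] chain_map_carrier[OF \<phi>, of "i + 1"]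
    diff_carrier[OF X refl, of i] diff_carrier[OF Y refl, of i] diff_carrier[OF Z refl, of i]
  show "\<psi> i * \<phi> i \<in> carrier_mat (rk Z i) (rk X i)"
    using c by auto
  have "diff Z i * (\<psi> i * \<phi> i) = diff Z i * \<psi> i * \<phi> i"
    using c by (simp add: mat_assoc)
  also have "\<dots> = \<psi> (i + 1) * (diff Y i * \<phi> i)"
    unfolding chain_map_diff[OF \<psi>] using c by (simp add: mat_assoc)
  also have "\<dots> = \<psi> (i + 1) * \<phi> (i + 1) * diff X i"
    unfolding chain_map_diff[OF \<phi>] using c by (simp add: mat_assoc)
  finally show "diff Z i * (\<psi> i * \<phi> i) = \<psi> (i + 1) * \<phi> (i + 1) * diff X i" .
qed

lemma homotopy_rel_comp_right:
  fixes X Y Z :: "'a::comm_ring_1 free_complex"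
  assumes X: "free_complex X" and Y: "free_complex Y" and Z: "free_complex Z"
    and f: "(f, g) \<in> homotopy_rel Y Z" and \<phi>: "chain_map X Y \<phi>"
  shows "(\<lambda>i. f i * \<phi> i, \<lambda>i. g i * \<phi> i) \<in> homotopy_rel X Z"
proof -
  obtain h where fg: "chain_map Y Z f" "chain_map Y Z g"
    and h: "\<And>i. h i \<in> carrier_mat (rk Z (i - 1)) (rk Y i)"
    and eq: "\<And>i. f i - g i = diff Z (i - 1) * h i + h (i + 1) * diff Y i"
    using f by (auto simp: homotopy_rel_def)
  have h': "h i * \<phi> i \<in> carrier_mat (rk Z (i - 1)) (rk X i)" for i
    using h[of i] chain_map_carrier[OF \<phi>, of i] by auto
  have e: "f i * \<phi> i - g i * \<phi> i = diff Z (i - 1) * (h i * \<phi> i) + h (i + 1) * \<phi> (i + 1) * diff X i" for i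
  proof -
    have h1: "h (i + 1) \<in> carrier_mat (rk Z i) (rk Y (i + 1))" using h[of "i + 1"] by simp
    have D: "diff Z (i - 1) \<in> carrier_mat (rk Z i) (rk Z (i - 1))" using Z by (rule diff_carrier) simp
    note c = chain_map_carrier[OF fg(1), of i] chain_map_carrier[OF fg(2), of i] h[of i] h1 D
      chain_map_carrier[OF \<phi>, of i] chain_map_carrier[OF \<phi>, of "i + 1"]
      diff_carrier[OF X refl, of i] diff_carrier[OF Y refl, of i]
    have "f i * \<phi> i - g i * \<phi> i = (f i - g i) * \<phi> i"
      by (rule minus_mult_distrib_mat[symmetric]) (rule c)+
    also have "\<dots> = diff Z (i - 1) * h i * \<phi> i + h (i + 1) * diff Y i * \<phi> i"
      unfolding eq using c by (intro add_mult_distrib_mat[of _ "rk Z i" "rk Y i"]) auto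
    also have "diff Z (i - 1) * h i * \<phi> i = diff Z (i - 1) * (h i * \<phi> i)"
      using c by (simp add: mat_assoc)
    also have "h (i + 1) * diff Y i * \<phi> i = h (i + 1) * (diff Y i * \<phi> i)"
      using c by (simp add: mat_assoc)
    also have "\<dots> = h (i + 1) * \<phi> (i + 1) * diff X i"
      unfolding chain_map_diff[OF \<phi>] using c by (simp add: mat_assoc)
    finally show ?thesis .
  qed
  show ?thesis
    unfolding homotopy_rel_def
    using chain_map_comp[OF X Y Z fg(1) \<phi>] chain_map_comp[OF X Y Z fg(2) \<phi>] h' e
    by (intro CollectI case_prodI conjI exI[of _ "\<lambda>i. h i * \<phi> i"] allI) simp_all
qed

lemma homotopy_rel_comp_left:
  fixes X Y Z :: "'a::comm_ring_1 free_complex"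
  assumes X: "free_complex X" and Y: "free_complex Y" and Z: "free_complex Z"
    and \<psi>: "chain_map Y Z \<psi>" and f: "(f, g) \<in> homotopy_rel X Y"
  shows "(\<lambda>i. \<psi> i * f i, \<lambda>i. \<psi> i * g i) \<in> homotopy_rel X Z"
proof -
  obtain h where fg: "chain_map X Y f" "chain_map X Y g"
    and h: "\<And>i. h i \<in> carrier_mat (rk Y (i - 1)) (rk X i)"
    and eq: "\<And>i. f i - g i = diff Y (i - 1) * h i + h (i + 1) * diff X i"
    using f by (auto simp: homotopy_rel_def)
  have h': "\<psi> (i - 1) * h i \<in> carrier_mat (rk Z (i - 1)) (rk X i)" for i
    using h[of i] chain_map_carrier[OF \<psi>, of "i - 1"] by auto
  have e: "\<psi> i * f i - \<psi> i * g i = diff Z (i - 1) * (\<psi> (i - 1) * h i) + \<psi> i * h (i + 1) * diff X i" for i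
  proof -
    have h1: "h (i + 1) \<in> carrier_mat (rk Y i) (rk X (i + 1))" using h[of "i + 1"] by simp
    have D: "diff Y (i - 1) \<in> carrier_mat (rk Y i) (rk Y (i - 1))" "diff Z (i - 1) \<in> carrier_mat (rk Z i) (rk Z (i - 1))"
      using Y Z by (auto intro: diff_carrier)
    note c = chain_map_carrier[OF fg(1), of i] chain_map_carrier[OF fg(2), of i] h[of i] h1 D
      chain_map_carrier[OF \<psi>, of i] chain_map_carrier[OF \<psi>, of "i - 1"]
      diff_carrier[OF X refl, of i]
    have "\<psi> i * f i - \<psi> i * g i = \<psi> i * (f i - g i)"
      by (rule mult_minus_distrib_mat[symmetric]) (rule c)+
    also have "\<dots> = \<psi> i * (diff Y (i - 1) * h i) + \<psi> i * (h (i + 1) * diff X i)"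
      unfolding eq using c by (intro mult_add_distrib_mat[of _ "rk Z i" "rk Y i" _ "rk X i"]) auto
    also have "\<psi> i * (diff Y (i - 1) * h i) = \<psi> i * diff Y (i - 1) * h i"
      using c by (simp add: mat_assoc)
    also have "\<psi> i * diff Y (i - 1) = diff Z (i - 1) * \<psi> (i - 1)"
      using chain_map_diff[OF \<psi>, of "i - 1"] by simp
    also have "diff Z (i - 1) * \<psi> (i - 1) * h i = diff Z (i - 1) * (\<psi> (i - 1) * h i)"
      using c by (simp add: mat_assoc)
    also have "\<psi> i * (h (i + 1) * diff X i) = \<psi> i * h (i + 1) * diff X i"
      using c by (simp add: mat_assoc)
    finally show ?thesis .
  qed
  show ?thesis
    unfolding homotopy_rel_def
    using chain_map_comp[OF X Y Z \<psi> fg(1)] chain_map_comp[OF X Y Z \<psi> fg(2)] h' e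
    by (intro CollectI case_prodI conjI exI[of _ "\<lambda>i. \<psi> (i - 1) * h i"] allI) simp_all
qed

lemma homotopy_rel_refl:
  assumes X: "free_complex X" and Z: "free_complex Z" and f: "chain_map X Z f"
  shows "(f, f) \<in> homotopy_rel X Z"
  unfolding homotopy_rel_def
proof (intro CollectI case_prodI conjI exI[of _ "\<lambda>i. 0\<^sub>m (rk Z (i - 1)) (rk X i)"] allI f)
  fix i
  have "diff Z (i - 1) \<in> carrier_mat (rk Z i) (rk Z (i - 1))" using Z by (rule diff_carrier) simp
  then show "f i - f i = diff Z (i - 1) * 0\<^sub>m (rk Z (i - 1)) (rk X i) + 0\<^sub>m (rk Z (i + 1 - 1)) (rk X (i + 1)) * diff X i"
    using diff_carrier[OF X refl, of i] chain_map_carrier[OF f, of i] by (simp add: mat_zero_mult)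
qed simp

text \<open>With \<open>f\<close> and \<open>g\<close> generating the two classes, one passes from
  \<open>f g\<close> to \<open>\<psi> g\<close> and then to \<open>\<psi> \<phi>\<close>, each time
  by a homotopy of composites.\<close>

lemma gen_frac_trace_K_comp:
  fixes X Y :: "'a::comm_ring_1 free_complex"
  assumes X: "free_complex X" and Y: "free_complex Y"
    and t: "sop m d t" "null_homotopies X t ls"
    and K: "\<Psi> \<in> K_hom Y (shift (int d - 1) X)" "\<Phi> \<in> K_hom X Y"
    and mem: "\<psi> \<in> \<Psi>" "\<phi> \<in> \<Phi>" and \<alpha>: "\<alpha> \<in> K_comp X (shift (int d - 1) X) \<Psi> \<Phi>"
  shows "gen_frac m d (mat_trace (\<alpha> (1 - int d) * htpy_comp X ls 1 * diff X 0)) t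
    = gen_frac m d (mat_trace (\<psi> (1 - int d) * \<phi> (1 - int d) * htpy_comp X ls 1 * diff X 0)) t"
proof -
  let ?Z = "shift (int d - 1) X"
  have Z: "free_complex ?Z" using X by (rule free_complex_shift)
  obtain f g where f: "\<And>\<psi>. \<psi> \<in> \<Psi> \<longleftrightarrow> (f, \<psi>) \<in> homotopy_rel Y ?Z"
    and g: "\<And>\<phi>. \<phi> \<in> \<Phi> \<longleftrightarrow> (g, \<phi>) \<in> homotopy_rel X Y"
    using K by (auto simp: K_hom_def quotient_def)
  let ?T = "\<lambda>\<alpha>. gen_frac m d (mat_trace (\<alpha> (1 - int d) * htpy_comp X ls 1 * diff X 0)) t"
  have base: "?T (\<lambda>i. f i * g i) = ?T (\<lambda>i. \<psi> i * \<phi> i)" if "\<psi> \<in> \<Psi>" "\<phi> \<in> \<Phi>" for \<psi> \<phi>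
  proof -
    have h: "(f, \<psi>) \<in> homotopy_rel Y ?Z" "(g, \<phi>) \<in> homotopy_rel X Y"
      using that f g by auto
    then have "chain_map Y ?Z \<psi>" "chain_map X Y g"
      by (auto simp: homotopy_rel_def)
    then show ?thesis
      using gen_frac_trace_homotopy[OF X homotopy_rel_comp_right[OF X Y Z h(1)] t]
        gen_frac_trace_homotopy[OF X homotopy_rel_comp_left[OF X Y Z _ h(2)] t] by simp
  qed
  from \<alpha> obtain \<psi>' \<phi>' where mem': "\<psi>' \<in> \<Psi>" "\<phi>' \<in> \<Phi>"
    and h: "(\<lambda>i. \<psi>' i * \<phi>' i, \<alpha>) \<in> homotopy_rel X ?Z"
    by (auto simp: K_comp_def)
  show ?thesis
    using gen_frac_trace_homotopy[OF X h t] base[OF mem'] base[OF mem] by simp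
qed

text \<open>\<open>pretrace\<close> takes the element of a set of values, so this set has to be a
  singleton: degree, parameters and representative are replaced in turn by \<open>0\<close>,
  \<open>t\<close> with \<open>ls\<close>, and the given composite.\<close>

lemma pretrace_K_comp:
  fixes X Y :: "'a::comm_ring_1 free_complex"
  assumes X: "free_complex X" and Y: "free_complex Y"
    and t: "sop m d t" "null_homotopies X t ls"
    and K: "\<Psi> \<in> K_hom Y (shift (int d - 1) X)" "\<Phi> \<in> K_hom X Y"
    and mem: "\<psi> \<in> \<Psi>" "\<phi> \<in> \<Phi>"
  shows "pretrace m d X (K_comp X (shift (int d - 1) X) \<Psi> \<Phi>)
    = gen_frac m d (bsign d * mat_trace (\<psi> (1 - int d) * \<phi> (1 - int d) * htpy_comp X ls 1 * diff X 0)) t"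
    (is "_ = gen_frac m d (_ * ?T) t")
proof -
  let ?Z = "shift (int d - 1) X" and ?H = "local_cohomology m d"
  have Z: "free_complex ?Z" using X by (rule free_complex_shift)
  have chain: "chain_map X ?Z \<alpha>" if "\<alpha> \<in> K_comp X ?Z \<Psi> \<Phi>" for \<alpha>
    using that by (auto simp: K_comp_def homotopy_rel_def)
  have single: "(bsign d * sign_of i) \<odot>\<^bsub>?H\<^esub>
      gen_frac m d (mat_trace (\<alpha> (i + 1 - int d) * htpy_comp X ls' (i + 1) * diff X i)) t'
      = gen_frac m d (bsign d * ?T) t"
    if \<alpha>: "\<alpha> \<in> K_comp X ?Z \<Psi> \<Phi>" and t': "sop m d t'" "null_homotopies X t' ls'" for i \<alpha> t' ls'
  proof -
    let ?S = "mat_trace (\<alpha> (i + 1 - int d) * htpy_comp X ls' (i + 1) * diff X i)"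
    have "gen_frac m d (sign_of i * ?S) t'
        = gen_frac m d (mat_trace (\<alpha> (1 - int d) * htpy_comp X ls' 1 * diff X 0)) t'"
      using gen_frac_trace_degree[OF X chain[OF \<alpha>] t'] .
    also have "\<dots> = gen_frac m d (mat_trace (\<alpha> (1 - int d) * htpy_comp X ls 1 * diff X 0)) t"
      using gen_frac_trace_parameters[OF X chain[OF \<alpha>] t' t, of 0] by simp
    also have "\<dots> = gen_frac m d ?T t"
      using gen_frac_trace_K_comp[OF X Y t K mem \<alpha>] .
    finally have "bsign d \<odot>\<^bsub>?H\<^esub> gen_frac m d (sign_of i * ?S) t' = bsign d \<odot>\<^bsub>?H\<^esub> gen_frac m d ?T t"
      by simp
    then show ?thesis
      by (simp add: gen_frac_smult t t' mult.assoc)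
  qed
  have comp: "(\<lambda>i. \<psi> i * \<phi> i) \<in> K_comp X ?Z \<Psi> \<Phi>"
  proof -
    have "chain_map Y ?Z \<psi>" "chain_map X Y \<phi>"
      using K mem by (auto simp: K_hom_def quotient_def homotopy_rel_def)
    from homotopy_rel_refl[OF X Z chain_map_comp[OF X Y Z this]] show ?thesis
      using mem by (auto simp: K_comp_def)
  qed
  let ?S = "{(bsign d * sign_of i) \<odot>\<^bsub>?H\<^esub>
        gen_frac m d (mat_trace (\<alpha> (i + 1 - int d) * htpy_comp X ls (i + 1) * diff X i)) t
      | i \<alpha> t ls. \<alpha> \<in> K_comp X ?Z \<Psi> \<Phi> \<and> sop m d t \<and> null_homotopies X t ls}"
  have "x = gen_frac m d (bsign d * ?T) t" if "x \<in> ?S" for x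
    using that by (elim CollectE exE conjE) (simp only: single)
  \<comment> \<open>The set is nonempty: the composite of the given representatives attains the
    value in degree 0.\<close>
  moreover have "gen_frac m d (bsign d * ?T) t \<in> ?S"
    unfolding single[OF comp t, of 0, symmetric]
    by (intro CollectI exI[of _ 0] exI[of _ "\<lambda>i. \<psi> i * \<phi> i"] exI[of _ t] exI[of _ ls] conjI comp t refl)
  ultimately have "?S = {gen_frac m d (bsign d * ?T) t}"
    by blast
  then show ?thesis
    by (simp add: pretrace_def)
qed

section \<open>Evaluation of the duality pairing\<close>

lemma mat_vec_assoc:
  fixes A B :: "'a::comm_ring_1 mat"
  assumes "dim_col A = dim_row B" "dim_col B = dim_vec v"
  shows "(A * B) *\<^sub>v v = A *\<^sub>v (B *\<^sub>v v)"
  using assms by (intro assoc_mult_mat_vec[of _ "dim_row A" "dim_col A" _ "dim_col B"]) auto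

text \<open>The coordinate sum in \<open>tensor_map\<close> is a matrix-vector product and the sum
  over the basis of \<open>X\<close> is a trace; both can be carried out on numerators because all
  fractions have denominator \<open>s\<close>.\<close>

lemma pairing_value_eq:
  fixes X Y :: "'a::comm_ring_1 free_complex"
  assumes X: "free_complex X" and Y: "free_complex Y"
    and s: "sop m d s" "null_homotopies Y s \<mu>"
    and \<psi>: "chain_map Y (shift (int d - 1) X) \<psi>" and \<phi>: "chain_map X Y \<phi>"
  shows "pairing_value m d X Y s \<mu> \<psi> \<phi>
    = gen_frac m d (bsign d * mat_trace (\<psi> (1 - int d) * htpy_comp Y \<mu> 1 * diff Y 0 * \<phi> 0)) s"
proof -
  let ?H = "local_cohomology m d" and ?n = "rk X 0" and ?b = "bsign d :: 'a"
  interpret abelian_monoid ?H by (rule abelian_monoid_local_cohomology[OF s(1)])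
  let ?P = "\<psi> (1 - int d)" and ?M = "htpy_comp Y \<mu> 1" and ?D = "diff Y 0" and ?F = "\<phi> 0"
  have P: "?P \<in> carrier_mat ?n (rk Y (1 - int d))"
    using X \<psi> by (rule chain_map_shift) simp
  have M: "?M \<in> carrier_mat (rk Y (1 - int d)) (rk Y 1)"
    using s(2) sop_length[OF s(1)] by (rule htpy_comp_full_carrier) simp
  have D: "?D \<in> carrier_mat (rk Y 1) (rk Y 0)" "diff Y (-1) \<in> carrier_mat (rk Y 0) (rk Y (-1))"
    using Y by (auto intro: diff_carrier)
  have F: "?F \<in> carrier_mat (rk Y 0) ?n" using \<phi> by (rule chain_map_carrier)
  \<comment> \<open>Representatives of a cokernel class differ by the image of
    \<open>diff Y (-1)\<close>, which \<open>diff Y 0\<close> kills; so the image of the class is a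
    singleton.\<close>
  have res: "complete_inj_res m d Y s \<mu> (coker_class Y y)
      = vec (rk Y (1 - int d)) (\<lambda>l. gen_frac m d (?b * (?M *\<^sub>v (?D *\<^sub>v y)) $ l) s)"
    if y: "y \<in> carrier_vec (rk Y 0)" for y
  proof -
    have "tensor_elt ?H (?b \<cdot>\<^sub>v (?M *\<^sub>v (?D *\<^sub>v y'))) (gen_frac m d 1 s)
        = vec (rk Y (1 - int d)) (\<lambda>l. gen_frac m d (?b * (?M *\<^sub>v (?D *\<^sub>v y)) $ l) s)"
      if y'_mem: "y' \<in> coker_class Y y" for y'
    proof -
      obtain u where u: "u \<in> carrier_vec (rk Y (-1))" and y': "y' = y + diff Y (-1) *\<^sub>v u"
        using y'_mem by (auto simp: coker_class_def)
      have "?D *\<^sub>v (diff Y (-1) *\<^sub>v u) = (?D * diff Y (-1)) *\<^sub>v u"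
        using D u by (intro assoc_mult_mat_vec[symmetric]) auto
      also have "\<dots> = 0\<^sub>v (rk Y 1)"
        using diff_diff[OF Y, of 0 "-1"] u by (intro eq_vecI) simp_all
      finally have "?D *\<^sub>v y' = ?D *\<^sub>v y"
        unfolding y' using D u y by (subst mult_add_distrib_mat_vec[of _ "rk Y 1" "rk Y 0"]) auto
      then show ?thesis
        using M by (intro eq_vecI) (auto simp: tensor_elt_def gen_frac_smult s(1))
    qed
    moreover have "coker_class Y y \<noteq> {}"
      unfolding coker_class_def using zero_carrier_vec by blast
    ultimately show ?thesis
      unfolding complete_inj_res_def by (simp add: image_constant_conv cong: image_cong_simp)
  qed
  have entry: "g_map m d Y s \<mu> \<psi> (coker_class Y (?F *\<^sub>v unit_vec ?n k)) $ k
      = gen_frac m d (?b * (?P * ?M * ?D * ?F) $$ (k, k)) s" if k: "k < ?n" for k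
  proof -
    let ?y = "?F *\<^sub>v unit_vec ?n k"
    define v where "v = ?M *\<^sub>v (?D *\<^sub>v ?y)"
    have y: "?y \<in> carrier_vec (rk Y 0)" using F by auto
    have v: "v \<in> carrier_vec (rk Y (1 - int d))" unfolding v_def using M D y by (metis mult_mat_vec_carrier)
    have "g_map m d Y s \<mu> \<psi> (coker_class Y ?y) $ k
        = (\<Oplus>\<^bsub>?H\<^esub>l\<in>{..<rk Y (1 - int d)}. ?P $$ (k, l) \<odot>\<^bsub>?H\<^esub>
            vec (rk Y (1 - int d)) (\<lambda>l. gen_frac m d (?b * v $ l) s) $ l)"
      using P k by (simp add: g_map_def res[OF y] tensor_map_def v_def[symmetric])
    also have "\<dots> = (\<Oplus>\<^bsub>?H\<^esub>l\<in>{..<rk Y (1 - int d)}. gen_frac m d (?P $$ (k, l) * (?b * v $ l)) s)"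
      by (intro finsum_cong') (auto simp: gen_frac_smult s(1) gen_frac_carrier)
    also have "\<dots> = gen_frac m d (\<Sum>l<rk Y (1 - int d). ?P $$ (k, l) * (?b * v $ l)) s"
      using s(1) by (intro gen_frac_finsum) simp_all
    also have "(\<Sum>l<rk Y (1 - int d). ?P $$ (k, l) * (?b * v $ l)) = ?b * (?P *\<^sub>v v) $ k"
      using P k v by (simp add: scalar_prod_def sum_distrib_left atLeast0LessThan mult_ac)
    also have "?P *\<^sub>v v = (?P * ?M * ?D * ?F) *\<^sub>v unit_vec ?n k"
      unfolding v_def using P M D F by (simp add: mat_vec_assoc)
    also have "((?P * ?M * ?D * ?F) *\<^sub>v unit_vec ?n k) $ k = (?P * ?M * ?D * ?F) $$ (k, k)"
      using P F k by (simp add: scalar_prod_right_unit)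
    finally show ?thesis .
  qed
  have "pairing_value m d X Y s \<mu> \<psi> \<phi> = (\<Oplus>\<^bsub>?H\<^esub>k\<in>{..<?n}. gen_frac m d (?b * (?P * ?M * ?D * ?F) $$ (k, k)) s)"
    unfolding pairing_value_def by (intro finsum_cong') (auto simp: entry gen_frac_carrier[OF s(1)])
  also have "\<dots> = gen_frac m d (\<Sum>k<?n. ?b * (?P * ?M * ?D * ?F) $$ (k, k)) s"
    using s(1) by (intro gen_frac_finsum) simp_all
  also have "(\<Sum>k<?n. ?b * (?P * ?M * ?D * ?F) $$ (k, k)) = ?b * mat_trace (?P * ?M * ?D * ?F)"
    using P by (simp add: mat_trace_def sum_distrib_left)
  finally show ?thesis .
qed

theorem theorem5p2:
  fixes m :: "'a::comm_ring_1 set" and d :: nat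
    and X Y :: "'a free_complex"
    and t s :: "'a list" and ls \<mu> :: "(int \<Rightarrow> 'a mat) list"
    and \<Psi> \<Phi> :: "(int \<Rightarrow> 'a mat) set" and \<psi> \<phi> :: "int \<Rightarrow> 'a mat"
  assumes "gorenstein_local_ring (class_ring :: 'a ring) m"
    and "krull_dim (class_ring :: 'a ring) = enat d"
    and "isolated_singularity m"
    and "acyclic_free_complex X" and "acyclic_free_complex Y"
    and "sop m d s" and "null_homotopies Y s \<mu>"
    and "sop m d t" and "null_homotopies X t ls"
    and "\<Psi> \<in> K_hom Y (shift (int d - 1) X)" and "\<Phi> \<in> K_hom X Y"
    and "\<psi> \<in> \<Psi>" and "\<phi> \<in> \<Phi>"
  shows "duality_pairing m d X Y s \<mu> \<Psi> \<Phi> = pretrace m d X (K_comp X (shift (int d - 1) X) \<Psi> \<Phi>)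
    \<and> pretrace m d X (K_comp X (shift (int d - 1) X) \<Psi> \<Phi>) =
        bsign d \<odot>\<^bsub>local_cohomology m d\<^esub>
          gen_frac m d
            (mat_trace (\<psi> (1 - int d) * \<phi> (1 - int d) * htpy_comp X ls 1 * diff X 0)) t"
proof -
  let ?Z = "shift (int d - 1) X"
  let ?tr = "pretrace m d X (K_comp X ?Z \<Psi> \<Phi>)"
  have X: "free_complex X" and Y: "free_complex Y"
    using assms(4,5) by (auto intro: acyclic_free_complexD)
  note s = assms(6,7) and t = assms(8,9) and K = assms(10,11) and mem = assms(12,13)
  have tr: "?tr = gen_frac m d (bsign d * mat_trace (\<psi> (1 - int d) * \<phi> (1 - int d) * htpy_comp X ls 1 * diff X 0)) t"
    if "\<psi> \<in> \<Psi>" "\<phi> \<in> \<Phi>" for \<psi> \<phi>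
    using X Y t K that by (rule pretrace_K_comp)
  \<comment> \<open>The pairing is the fraction over \<open>s\<close> of the trace with
    \<open>\<mu>\<close>; the transfer in degree 0 rewrites it over \<open>t\<close> with
    \<open>ls\<close>, where it is the pretrace.\<close>
  have pair: "pairing_value m d X Y s \<mu> \<psi> \<phi> = ?tr" if "\<psi> \<in> \<Psi>" "\<phi> \<in> \<Phi>" for \<psi> \<phi>
  proof -
    have ch: "chain_map Y ?Z \<psi>" "chain_map X Y \<phi>"
      using K that by (auto simp: K_hom_def quotient_def homotopy_rel_def)
    show ?thesis
      unfolding pairing_value_eq[OF X Y s ch] tr[OF that]
      using gen_frac_trace_transfer[OF X Y s t ch, of 0] by (simp flip: gen_frac_smult[OF s(1)] gen_frac_smult[OF t(1)])
  qed
  then have "{pairing_value m d X Y s \<mu> \<psi> \<phi> | \<psi> \<phi>. \<psi> \<in> \<Psi> \<and> \<phi> \<in> \<Phi>} = {?tr}"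
    using mem by blast
  then have "duality_pairing m d X Y s \<mu> \<Psi> \<Phi> = ?tr"
    by (simp add: duality_pairing_def)
  then show ?thesis
    using tr[OF mem] by (simp add: gen_frac_smult[OF t(1)])
qed

end
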